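(* Let $N\ge1$ and let $P,Q\subset\mathbb{R}^N$ be Lebesgue measurable sets of finite Lebesgue measure whose boundaries have Lebesgue measure zero. Let $\mathbf{A}=\mathbf{A}(\tau)$ and $\mathbf{B}=\mathbf{B}(\rho)$ be invertible real $N\times N$ matrices depending on real parameters $\tau,\rho$, and let $(\tau_0,\rho_0)$ be a limit point of the parameter range (possibly with infinite coordinates). For a matrix $\mathbf{M}$ and set $S$ write $\mathbf{M}S=\{\mathbf{M}\mathbf{x}:\mathbf{x}\in S\}$. Let $\mathcal{T}_{\mathbf{A}P}f=\mathds{1}_{\mathbf{A}P}f$ and $\mathcal{B}_{\mathbf{B}Q}f=\mathcal{F}^{-1}\mathds{1}_{\mathbf{B}Q}\mathcal{F}f$ on $L^2(\mathbb{R}^N)$. For $0<\epsilon<1$ let $N_{\mathbf{A},\mathbf{B}}(\epsilon)$ be the number of eigenvalues (counted with multiplicity) of $\mathcal{T}_{\mathbf{A}P}\mathcal{B}_{\mathbf{B}Q}\mathcal{T}_{\mathbf{A}P}$ not smaller than $\epsilon$. Let $U$ be the closed unit ball of $\mathbb{R}^N$, and suppose that $\mathbf{B}^T\mathbf{A}U\to\mathbb{R}^N$ as $(\tau,\rho)\to(\tau_0,\rho_0)$, in the sense that for every $R>0$ the set $\mathbf{B}^T\mathbf{A}U$ contains the ball of radius $R$ centered at the origin for all $(\tau,\rho)$ sufficiently close to $(\tau_0,\rho_0)$. Then $$\lim_{(\tau,\rho)\to(\tau_0,\rho_0)}\frac{N_{\mathbf{A},\mathbf{B}}(\epsilon)}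{|\det\mathbf{A}|\,|\det\mathbf{B}|}=(2\pi)^{-N}m(P)\,m(Q).$$
   Context: $m(\cdot)$ denotes Lebesgue measure, $\mathds{1}_S$ the indicator of $S$, $\mathbf{B}^T$ the transpose of $\mathbf{B}$. The Fourier transform is $\mathcal{F}f(\mathbf{u})=\int_{\mathbb{R}^N}f(\mathbf{x})e^{-i\mathbf{x}\cdot\mathbf{u}}\,d\mathbf{x}$ (extended to $L^2$). The operator $\mathcal{T}_{\mathbf{A}P}\mathcal{B}_{\mathbf{B}Q}\mathcal{T}_{\mathbf{A}P}$ is positive, self-adjoint, compact and bounded by one. *)

theory Defs
  imports "HOL-Analysis.Analysis"
begin

definition sq_integrable :: "(real^'n \<Rightarrow> complex) \<Rightarrow> bool" where
  "sq_integrable f \<longleftrightarrow> f \<in> borel_measurable lebesgue \<and>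
      integrable lebesgue (\<lambda>x. (cmod (f x))\<^sup>2)"

definition l2_inner :: "(real^'n \<Rightarrow> complex) \<Rightarrow> (real^'n \<Rightarrow> complex) \<Rightarrow> complex" where
  "l2_inner f g = (LINT x|lebesgue. f x * cnj (g x))"

definition fourier :: "(real^'n \<Rightarrow> complex) \<Rightarrow> real^'n \<Rightarrow> complex" where
  "fourier f u = (LINT x|lebesgue. f x * exp (- (\<i> * complex_of_real (x \<bullet> u))))"

definition inv_fourier :: "(real^'n \<Rightarrow> complex) \<Rightarrow> real^'n \<Rightarrow> complex" where
  "inv_fourier g x = complex_of_real (1 / (2 * pi) ^ CARD('n)) *
      (LINT u|lebesgue. g u * exp (\<i> * complex_of_real (x \<bullet> u)))"

text \<open>The operator T_S B_T T_S f = 1_S F^{-1} 1_T F (1_S f).  For f in L^2 and S, T of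
  finite measure, 1_S f and 1_T F(1_S f) lie in L^1 \<inter> L^2, so the L^2 Fourier transforms
  coincide with the integral formulas above.\<close>

definition TBT :: "(real^'n) set \<Rightarrow> (real^'n) set \<Rightarrow> (real^'n \<Rightarrow> complex) \<Rightarrow> real^'n \<Rightarrow> complex" where
  "TBT S T f x = indicator S x *
      inv_fourier (\<lambda>u. indicator T u * fourier (\<lambda>y. indicator S y * f y) u) x"

definition eigenspace_L2 :: "((real^'n \<Rightarrow> complex) \<Rightarrow> real^'n \<Rightarrow> complex) \<Rightarrow> real \<Rightarrow> (real^'n \<Rightarrow> complex) set" where
  "eigenspace_L2 K lam = {f. sq_integrable f \<and> (AE x in lebesgue. K f x = complex_of_real lam * f x)}"

definition l2_orthonormal :: "(real^'n \<Rightarrow> complex) set \<Rightarrow> bool" where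
  "l2_orthonormal F \<longleftrightarrow> (\<forall>f\<in>F. \<forall>g\<in>F. l2_inner f g = (if f = g then 1 else 0))"

text \<open>Multiplicity = dimension of the eigenspace in L^2 (maximal size of an orthonormal family).\<close>
definition multiplicity_L2 :: "((real^'n \<Rightarrow> complex) \<Rightarrow> real^'n \<Rightarrow> complex) \<Rightarrow> real \<Rightarrow> nat" where
  "multiplicity_L2 K lam = Sup {card F | F. finite F \<and> F \<subseteq> eigenspace_L2 K lam \<and> l2_orthonormal F}"

definition is_eigenvalue_L2 :: "((real^'n \<Rightarrow> complex) \<Rightarrow> real^'n \<Rightarrow> complex) \<Rightarrow> real \<Rightarrow> bool" where
  "is_eigenvalue_L2 K lam \<longleftrightarrow> (\<exists>f\<in>eigenspace_L2 K lam. \<not> (AE x in lebesgue. f x = 0))"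

definition eig_count :: "((real^'n \<Rightarrow> complex) \<Rightarrow> real^'n \<Rightarrow> complex) \<Rightarrow> real \<Rightarrow> nat" where
  "eig_count K eps = (\<Sum>lam\<in>{lam. eps \<le> lam \<and> is_eigenvalue_L2 K lam}. multiplicity_L2 K lam)"

definition mat_image :: "real^'n^'n \<Rightarrow> (real^'n) set \<Rightarrow> (real^'n) set" where
  "mat_image M S = (\<lambda>x. M *v x) ` S"

definition param_filter :: "(real \<times> real) set \<Rightarrow> ereal \<times> ereal \<Rightarrow> (real \<times> real) filter" where
  "param_filter D p0 = filtercomap (\<lambda>(t, r). (ereal t, ereal r))
      (at p0 within ((\<lambda>(t, r). (ereal t, ereal r)) ` D))"

end

theory Submission
  imports Defs "HOL-Probability.Characteristic_Functions" "HOL-Complex_Analysis.Great_Picard"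
begin

text \<open>
  Write \<open>S = A P\<close>, \<open>T = B Q\<close>, \<open>K\<close> for the operator, and \<open>d = |det A| |det B|\<close>. With the waves
  \<open>e\<^sub>u(x) = 1\<^sub>S(x) exp(i x \<bullet> u)\<close> and the measure \<open>\<nu> = (2\<pi>)\<^sup>-\<^sup>N 1\<^sub>T(u) du\<close> one has
  \<open>K f = \<integral> \<langle>f, e\<^sub>u\<rangle> e\<^sub>u d\<nu>(u)\<close>, and Plancherel's inequality says that \<open>f \<mapsto> (u \<mapsto> \<langle>f, e\<^sub>u\<rangle>)\<close> is a
  contraction into \<open>L\<^sup>2(\<nu>)\<close>. Since \<open>|1[\<lambda> \<ge> \<epsilon>] - \<lambda>| \<le> C\<^sub>\<epsilon> \<lambda> (1 - \<lambda>)\<close> on \<open>[0, 1]\<close>, the eigenvalue count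
  differs from \<open>tr K = (2\<pi>)\<^sup>-\<^sup>N m(P) m(Q) d\<close> by at most \<open>C\<^sub>\<epsilon> (tr K - tr K\<^sup>2)\<close>. A linear substitution gives
  \<open>tr K\<^sup>2 = (2\<pi>)\<^sup>-\<^sup>2\<^sup>N d \<integral>\<integral> 1\<^sub>Q(u) 1\<^sub>Q(u + W w) |F 1\<^sub>P(w)|\<^sup>2 dw du\<close> with \<open>W = (A\<^sup>T B)\<^sup>-\<^sup>1\<close>, and \<open>W w \<rightarrow> 0\<close>
  pointwise by the hypothesis on \<open>B\<^sup>T A\<close>; Fatou's lemma and Plancherel's identity for \<open>1\<^sub>P\<close> yield
  \<open>tr K - tr K\<^sup>2 = o(d)\<close>. The sets may be taken open because their boundaries are null.

  The spectral theorem is not needed in full: the traces are integrals over \<open>u\<close>, and it suffices that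
  the quadratic form of \<open>K\<close> is at most \<open>\<epsilon>\<close> on the orthogonal complement of a maximal orthonormal
  family of eigenfunctions with eigenvalues \<open>\<ge> \<epsilon>\<close>.
\<close>

section \<open>Square-integrable functions\<close>

text \<open>The constant is C = 1/\<epsilon> + 1/(1 - \<epsilon>): for \<lambda> \<ge> \<epsilon>
  one has 1 - \<lambda> \<le> \<lambda>(1 - \<lambda>)/\<epsilon>, and for \<lambda> < \<epsilon>
  one has \<lambda> \<le> \<lambda>(1 - \<lambda>)/(1 - \<epsilon>). Eigenvalues below \<epsilon>
  are never listed; the bound on the quadratic form stands in for them. Finiteness of the count
  comes from the trace: an orthonormal family of eigenfunctions with eigenvalues at least \<epsilon>
  has at most tr K / \<epsilon> members. The error term is tr K - tr K^2, so tr K^2 has to be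
  estimated from below only. This one-sidedness shapes the analysis: indicators of open sets are
  lower semicontinuous, so Fatou's lemma applies and no continuity of translations in the mean is
  required. Fatou's lemma speaks of sequences, while the parameters move along a filter. The
  estimate is therefore proved uniformly in the matrices: some radius R works for all invertible A,
  B such that the image of the unit ball under the transpose of B times A contains the ball of
  radius R. That R exists is shown by contradiction, which produces a sequence.\<close>

definition L2 :: "'a measure \<Rightarrow> ('a \<Rightarrow> complex) \<Rightarrow> bool" where
  "L2 M f \<longleftrightarrow> f \<in> borel_measurable M \<and> integrable M (\<lambda>x. (cmod (f x))\<^sup>2)"

definition ip :: "'a measure \<Rightarrow> ('a \<Rightarrow> complex) \<Rightarrow> ('a \<Rightarrow> complex) \<Rightarrow> complex" where
  "ip M f g = (LINT x|M. f x * cnj (g x))"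

text \<open>Functions are not identified modulo null sets, so this is only the square of a seminorm.
  The measure is a parameter because functions of position and functions of frequency are both
  measured this way.\<close>

definition sqnorm :: "'a measure \<Rightarrow> ('a \<Rightarrow> complex) \<Rightarrow> real" where
  "sqnorm M f = (LINT x|M. (cmod (f x))\<^sup>2)"

lemma L2_measurable [measurable_dest]: "L2 M f \<Longrightarrow> f \<in> borel_measurable M"
  and L2_integrable_square: "L2 M f \<Longrightarrow> integrable M (\<lambda>x. (cmod (f x))\<^sup>2)"
  by (auto simp: L2_def)

lemma borel_measurable_cnj [measurable (raw)]:
  "f \<in> borel_measurable M \<Longrightarrow> (\<lambda>x. cnj (f x)) \<in> borel_measurable M"
  by (rule measurable_compose[OF _ borel_measurable_continuous_onI]) (auto intro: continuous_intros)

lemma L2_zero [simp]: "L2 M (\<lambda>x. 0)"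
  by (simp add: L2_def)

lemma L2_mult_left: "L2 M f \<Longrightarrow> L2 M (\<lambda>x. c * f x)"
  by (auto simp: L2_def norm_mult power_mult_distrib)

lemma L2_add:
  assumes "L2 M f" "L2 M g"
  shows "L2 M (\<lambda>x. f x + g x)"
proof -
  have [measurable]: "f \<in> borel_measurable M" "g \<in> borel_measurable M"
    using assms by (auto simp: L2_def)
  have "integrable M (\<lambda>x. (cmod (f x + g x))\<^sup>2)"
  proof (rule Bochner_Integration.integrable_bound)
    show "integrable M (\<lambda>x. 2 * (cmod (f x))\<^sup>2 + 2 * (cmod (g x))\<^sup>2)"
      using assms by (auto simp: L2_def)
    have "(cmod (f x + g x))\<^sup>2 \<le> 2 * (cmod (f x))\<^sup>2 + 2 * (cmod (g x))\<^sup>2" for x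
    proof -
      have "(cmod (f x + g x))\<^sup>2 \<le> (cmod (f x) + cmod (g x))\<^sup>2"
        by (intro power_mono norm_triangle_ineq) auto
      also have "\<dots> \<le> 2 * (cmod (f x))\<^sup>2 + 2 * (cmod (g x))\<^sup>2"
        using sum_squares_bound[of "cmod (f x)" "cmod (g x)"] by (simp add: power2_sum)
      finally show ?thesis .
    qed
    then show "AE x in M. norm ((cmod (f x + g x))\<^sup>2) \<le> norm (2 * (cmod (f x))\<^sup>2 + 2 * (cmod (g x))\<^sup>2)"
      by auto
  qed measurable
  then show ?thesis by (simp add: L2_def)
qed

lemma L2_diff:
  assumes "L2 M f" "L2 M g"
  shows "L2 M (\<lambda>x. f x - g x)"
  using L2_add[OF assms(1) L2_mult_left[OF assms(2), of "-1"]] by simp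

lemma L2_sum: "(\<And>i. i \<in> I \<Longrightarrow> L2 M (f i)) \<Longrightarrow> L2 M (\<lambda>x. \<Sum>i\<in>I. f i x)"
  by (induction I rule: infinite_finite_induct) (auto intro: L2_add)

lemma integrable_L2_mult:
  assumes "L2 M f" "L2 M g"
  shows "integrable M (\<lambda>x. f x * cnj (g x))"
proof (rule Bochner_Integration.integrable_bound)
  have [measurable]: "f \<in> borel_measurable M" "g \<in> borel_measurable M"
    using assms by (auto simp: L2_def)
  show "integrable M (\<lambda>x. (cmod (f x))\<^sup>2 + (cmod (g x))\<^sup>2)"
    using assms by (auto simp: L2_def)
  show "(\<lambda>x. f x * cnj (g x)) \<in> borel_measurable M" by measurable
  have "cmod (f x) * cmod (g x) \<le> (cmod (f x))\<^sup>2 + (cmod (g x))\<^sup>2" for x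
    using sum_squares_bound[of "cmod (f x)" "cmod (g x)"]
      mult_nonneg_nonneg[of "cmod (f x)" "cmod (g x)"] by (simp del: mult_nonneg_nonneg)
  then show "AE x in M. norm (f x * cnj (g x)) \<le> norm ((cmod (f x))\<^sup>2 + (cmod (g x))\<^sup>2)"
    by (auto simp: norm_mult)
qed

lemma ip_self: "ip M f f = complex_of_real (sqnorm M f)"
  by (simp add: ip_def sqnorm_def complex_norm_square[symmetric] flip: of_real_power)

lemma ip_commute: "ip M g f = cnj (ip M f g)"
proof -
  have "cnj (ip M f g) = (LINT x|M. cnj (f x * cnj (g x)))"
    unfolding ip_def by (rule Bochner_Integration.integral_cnj[symmetric])
  then show ?thesis
    by (simp add: ip_def mult.commute)
qed

lemma sqnorm_nonneg [simp]: "0 \<le> sqnorm M f"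
  by (simp add: sqnorm_def)

lemma ip_diff_left: "L2 M f \<Longrightarrow> L2 M g \<Longrightarrow> L2 M h \<Longrightarrow> ip M (\<lambda>x. f x - g x) h = ip M f h - ip M g h"
  by (simp add: ip_def left_diff_distrib integrable_L2_mult)

lemma ip_sum_left:
  assumes "\<And>i. i \<in> I \<Longrightarrow> L2 M (f i)" "L2 M h"
  shows "ip M (\<lambda>x. \<Sum>i\<in>I. c i * f i x) h = (\<Sum>i\<in>I. c i * ip M (f i) h)"
  using assms by (simp add: ip_def sum_distrib_right mult.assoc integrable_L2_mult)

lemma ip_mult_left: "ip M (\<lambda>x. c * f x) h = c * ip M f h"
  by (simp add: ip_def mult.assoc)

lemma sqnorm_mult: "sqnorm M (\<lambda>x. c * f x) = (cmod c)\<^sup>2 * sqnorm M f"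
  by (simp add: sqnorm_def norm_mult power_mult_distrib)

text \<open>Both cross terms and the square of the projection equal the same real number
  \<open>w\<close>. The weights \<mu> let one computation serve twice: with weights 1 for
  orthonormal eigenfunctions, and with the eigenvalues for their coefficient functions, which are
  orthogonal with square norms \<mu> i. Writing the factor \<mu> i into \<open>coeff\<close> avoids
  dividing by it.\<close>

lemma sqnorm_minus_projection:
  assumes "finite I" and \<phi>: "\<And>i. i \<in> I \<Longrightarrow> L2 M (\<phi> i)" and e: "L2 M e"
    and orth: "\<And>i j. i \<in> I \<Longrightarrow> j \<in> I \<Longrightarrow> ip M (\<phi> i) (\<phi> j) = (if i = j then complex_of_real (\<mu> i) else 0)"
    and coeff: "\<And>i. i \<in> I \<Longrightarrow> ip M e (\<phi> i) = of_real (\<mu> i) * c i"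
  shows "sqnorm M (\<lambda>x. e x - (\<Sum>i\<in>I. c i * \<phi> i x)) = sqnorm M e - (\<Sum>i\<in>I. \<mu> i * (cmod (c i))\<^sup>2)"
proof -
  define S where "S = (\<lambda>x. \<Sum>i\<in>I. c i * \<phi> i x)"
  define w where "w = (\<Sum>i\<in>I. complex_of_real (\<mu> i * (cmod (c i))\<^sup>2))"
  have S: "L2 M S" unfolding S_def by (intro L2_sum L2_mult_left \<phi>)
  have eS: "L2 M (\<lambda>x. e x - S x)" by (intro L2_diff e S)
  have Sg: "ip M S g = (\<Sum>i\<in>I. c i * ip M (\<phi> i) g)" if "L2 M g" for g
    unfolding S_def by (rule ip_sum_left[OF \<phi> that])
  have \<phi>S: "ip M (\<phi> i) S = of_real (\<mu> i) * cnj (c i)" if i: "i \<in> I" for i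
  proof -
    have "ip M S (\<phi> i) = (\<Sum>j\<in>I. c j * (if j = i then complex_of_real (\<mu> i) else 0))"
      unfolding Sg[OF \<phi>[OF i]] by (intro sum.cong) (auto simp: orth i)
    also have "\<dots> = c i * of_real (\<mu> i)"
      using assms(1) i by (simp add: if_distrib sum.delta cong: if_cong)
    finally show ?thesis by (simp add: ip_commute[of M "\<phi> i" S] mult.commute)
  qed
  have SS: "ip M S S = w"
    unfolding Sg[OF S] w_def
    by (intro sum.cong) (auto simp: \<phi>S complex_norm_square algebra_simps simp del: of_real_power)
  have Se: "ip M S e = w"
    unfolding Sg[OF e] w_def
    by (intro sum.cong) (auto simp: ip_commute[of M _ e] coeff complex_norm_square algebra_simps simp del: of_real_power)
  have w: "cnj w = w" by (simp add: w_def)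
  have "ip M (\<lambda>x. e x - S x) (\<lambda>x. e x - S x) = ip M e (\<lambda>x. e x - S x) - ip M S (\<lambda>x. e x - S x)"
    by (rule ip_diff_left[OF e S eS])
  also have "ip M e (\<lambda>x. e x - S x) = cnj (ip M e e - ip M S e)"
    using ip_diff_left[OF e S e] ip_commute by metis
  also have "ip M S (\<lambda>x. e x - S x) = cnj (ip M e S - ip M S S)"
    using ip_diff_left[OF e S S] ip_commute by metis
  also have "ip M e S = cnj w" using Se ip_commute by metis
  finally have "ip M (\<lambda>x. e x - S x) (\<lambda>x. e x - S x) = ip M e e - w"
    by (simp add: SS Se w) (simp add: ip_self)
  then have "complex_of_real (sqnorm M (\<lambda>x. e x - S x)) = of_real (sqnorm M e - (\<Sum>i\<in>I. \<mu> i * (cmod (c i))\<^sup>2))"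
    by (simp add: ip_self w_def)
  then show ?thesis unfolding S_def of_real_eq_iff .
qed

lemma sqnorm_diff:
  assumes f: "L2 M f" and h: "L2 M h"
  shows "sqnorm M (\<lambda>x. f x - h x) = sqnorm M f - 2 * Re (ip M f h) + sqnorm M h"
proof -
  have fh: "L2 M (\<lambda>x. f x - h x)" by (intro L2_diff f h)
  have "ip M (\<lambda>x. f x - h x) (\<lambda>x. f x - h x) = ip M f (\<lambda>x. f x - h x) - ip M h (\<lambda>x. f x - h x)"
    by (rule ip_diff_left[OF f h fh])
  also have "ip M f (\<lambda>x. f x - h x) = cnj (ip M f f - ip M h f)"
    using ip_diff_left[OF f h f] ip_commute by metis
  also have "ip M h (\<lambda>x. f x - h x) = cnj (ip M f h - ip M h h)"
    using ip_diff_left[OF f h h] ip_commute by metis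
  finally have "Re (ip M (\<lambda>x. f x - h x) (\<lambda>x. f x - h x)) =
      Re (cnj (ip M f f - ip M h f) - cnj (ip M f h - ip M h h))" by simp
  then show ?thesis
    using ip_commute[of M h f] by (simp add: ip_self)
qed

text \<open>Nonnegativity of the square norm of f + h bounds the cross term. It replaces the
  triangle inequality and avoids square roots.\<close>

lemma sqnorm_diff_le:
  assumes "L2 M f" "L2 M h"
  shows "sqnorm M (\<lambda>x. f x - h x) \<le> 2 * sqnorm M f + 2 * sqnorm M h"
proof -
  have "0 \<le> sqnorm M (\<lambda>x. f x - (- 1) * h x)" by simp
  also have "\<dots> = sqnorm M f + 2 * Re (ip M f h) + sqnorm M h"
    using sqnorm_diff[OF assms(1) L2_mult_left[OF assms(2), of "-1"]]
      ip_commute[of M f "\<lambda>x. - 1 * h x"] ip_commute[of M f h] ip_mult_left[of M "-1" h f]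
      sqnorm_mult[of M "-1" h] by simp
  finally show ?thesis using sqnorm_diff[OF assms] by simp
qed

lemma cmod_ip_square_le:
  assumes f: "L2 M f" and g: "L2 M g"
  shows "(cmod (ip M f g))\<^sup>2 \<le> sqnorm M f * sqnorm M g"
proof -
  define a b c where "a = sqnorm M f" and "b = sqnorm M g" and "c = ip M f g"
  have pos: "0 \<le> a" "0 \<le> b" by (simp_all add: a_def b_def)
  have key: "0 \<le> a - 2 * t * (cmod c)\<^sup>2 + t\<^sup>2 * (cmod c)\<^sup>2 * b" for t
  proof -
    define h where "h = (\<lambda>x. (of_real t * c) * g x)"
    have h: "L2 M h" unfolding h_def by (rule L2_mult_left[OF g])
    have hf: "ip M h f = of_real (t * (cmod c)\<^sup>2)"
      using ip_commute[of M g f] complex_norm_square[of c]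
      by (simp add: h_def ip_mult_left c_def del: of_real_power)
    have fh': "ip M f h = of_real (t * (cmod c)\<^sup>2)"
      using ip_commute[of M f h] hf by simp
    have hh: "sqnorm M h = t\<^sup>2 * (cmod c)\<^sup>2 * b"
      unfolding h_def sqnorm_mult b_def by (simp add: norm_mult power_mult_distrib)
    have "sqnorm M (\<lambda>x. f x - h x) = a - 2 * (t * (cmod c)\<^sup>2) + t\<^sup>2 * (cmod c)\<^sup>2 * b"
      unfolding sqnorm_diff[OF f h] fh' hh a_def by simp
    then show ?thesis using sqnorm_nonneg[of M "\<lambda>x. f x - h x"] by (simp add: mult.assoc)
  qed
  have "(cmod c)\<^sup>2 \<le> a * b"
  proof (cases "b = 0")
    case True
    have "c = 0"
    proof (rule ccontr)
      assume "c \<noteq> 0"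
      \<comment> \<open>For b = 0 the quadratic in t degenerates to a - 2 t |c|^2, and this t gives
        it the value -1.\<close>
      with key[of "(a + 1) / (2 * (cmod c)\<^sup>2)"] True show False
        by (simp add: field_simps)
    qed
    then show ?thesis using pos by simp
  next
    case False
    with key[of "1 / b"] pos show ?thesis
      by (simp add: field_simps power2_eq_square)
  qed
  then show ?thesis by (simp add: a_def b_def c_def)
qed

section \<open>Operators generated by a Bessel family\<close>

text \<open>Abstracts the family of waves indexed by frequency. Domination by the indicator of a set
  of finite measure bounds all norms uniformly and supplies dominating functions; continuity in the
  index is the source of compactness; \<open>contraction\<close> is Bessel's inequality in integral
  form. The index lives in a Euclidean space so that a countable dense set of indices
  exists.\<close>

locale bessel_kernel = M: sigma_finite_measure M + N: finite_measure N
  for M :: "'a measure" and N :: "'b::euclidean_space measure" +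
  fixes S :: "'a set" and e :: "'b \<Rightarrow> 'a \<Rightarrow> complex"
  assumes sets_N: "sets N = sets borel"
    and S_meas [measurable]: "S \<in> sets M" and S_fin: "emeasure M S < \<infinity>"
    and e_meas: "(\<lambda>p. e (fst p) (snd p)) \<in> borel_measurable (N \<Otimes>\<^sub>M M)"
    and e_bound: "cmod (e u x) \<le> indicator S x"
    and e_cont: "continuous_on UNIV (\<lambda>u. e u x)"
    and contraction: "L2 M f \<Longrightarrow> sqnorm N (\<lambda>u. ip M f (e u)) \<le> sqnorm M f"
begin

definition coef :: "('a \<Rightarrow> complex) \<Rightarrow> 'b \<Rightarrow> complex" where
  "coef f u = ip M f (e u)"

text \<open>This is \<open>coef\<close> followed by its adjoint, hence positive, and at most one by
  \<open>contraction\<close>.\<close>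

definition op :: "('a \<Rightarrow> complex) \<Rightarrow> 'a \<Rightarrow> complex" where
  "op f x = (LINT u|N. e u x * coef f u)"

sublocale NM: pair_sigma_finite N M ..

lemma space_N: "space N = UNIV"
  using sets_eq_imp_space_eq[OF sets_N] by simp

lemma e_meas_comp [measurable (raw)]:
  assumes "f \<in> measurable L N" "g \<in> measurable L M"
  shows "(\<lambda>x. e (f x) (g x)) \<in> borel_measurable L"
  using measurable_compose[OF measurable_Pair[OF assms] e_meas] by simp

lemma e_meas1 [measurable]: "e u \<in> borel_measurable M"
  by (rule e_meas_comp[where f = "\<lambda>_. u" and g = "\<lambda>x. x"]) (auto simp: space_N)

lemma e_sq_bound: "(cmod (e u x))\<^sup>2 \<le> indicator S x"
  using e_bound[of u x] by (auto simp: power_le_one split: split_indicator split_indicator_asm)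

lemma integrable_indicator_S: "integrable M (indicator S :: 'a \<Rightarrow> real)"
  using S_fin by (auto intro!: integrable_real_indicator)

lemma e_L2: "L2 M (e u)"
  unfolding L2_def
proof
  show "integrable M (\<lambda>x. (cmod (e u x))\<^sup>2)"
    by (rule Bochner_Integration.integrable_bound[OF integrable_indicator_S])
       (use e_sq_bound in \<open>auto\<close>)
qed measurable

lemma sqnorm_e_le: "sqnorm M (e u) \<le> measure M S"
proof -
  have "sqnorm M (e u) \<le> (LINT x|M. indicator S x)"
    unfolding sqnorm_def
    by (intro integral_mono L2_integrable_square e_L2 integrable_indicator_S e_sq_bound)
  also have "\<dots> = measure M S"
    using sets.sets_into_space[OF S_meas] by (simp add: Int_absorb2)
  finally show ?thesis .
qed

lemma cmod_coef_le:
  assumes "L2 M f" "sqnorm M f \<le> C\<^sup>2" "0 \<le> C"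
  shows "cmod (coef f u) \<le> C * sqrt (measure M S)"
proof (rule power2_le_imp_le)
  have "(cmod (coef f u))\<^sup>2 \<le> sqnorm M f * sqnorm M (e u)"
    unfolding coef_def by (rule cmod_ip_square_le[OF assms(1) e_L2])
  also have "\<dots> \<le> C\<^sup>2 * measure M S"
    by (intro mult_mono assms(2) sqnorm_e_le) auto
  finally show "(cmod (coef f u))\<^sup>2 \<le> (C * sqrt (measure M S))\<^sup>2"
    by (simp add: power_mult_distrib)
qed (use assms in auto)

lemma coef_bounded:
  assumes "L2 M f"
  obtains C where "0 \<le> C" "\<And>u. cmod (coef f u) \<le> C"
  using cmod_coef_le[OF assms, of "sqrt (sqnorm M f)"] that[of "sqrt (sqnorm M f) * sqrt (measure M S)"]
  by auto

lemma coef_meas [measurable]: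
  assumes [measurable]: "f \<in> borel_measurable M"
  shows "coef f \<in> borel_measurable N"
  unfolding coef_def[abs_def] ip_def by measurable

lemma L2_N_bounded:
  assumes [measurable]: "F \<in> borel_measurable N" and "\<And>u. cmod (F u) \<le> C"
  shows "L2 N F"
  unfolding L2_def
proof
  show "integrable N (\<lambda>u. (cmod (F u))\<^sup>2)"
    by (rule N.integrable_const_bound[of _ "C\<^sup>2"]) (auto intro!: power_mono assms)
qed fact

lemma coef_L2: "L2 M f \<Longrightarrow> L2 N (coef f)"
  by (metis L2_N_bounded L2_measurable coef_bounded coef_meas)

lemma integrable_e_mult:
  assumes [measurable]: "F \<in> borel_measurable N" and "\<And>u. cmod (F u) \<le> C"
    and x: "x \<in> space M"
  shows "integrable N (\<lambda>u. e u x * F u)"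
proof (rule N.integrable_const_bound[of _ "C"])
  have "cmod (e u x * F u) \<le> 1 * C" for u
    unfolding norm_mult
    using e_bound[of u x] by (intro mult_mono assms) (auto split: split_indicator_asm)
  then show "AE u in N. cmod (e u x * F u) \<le> C" by simp
  show "(\<lambda>u. e u x * F u) \<in> borel_measurable N"
    using x by measurable
qed

text \<open>Stated for any bounded \<open>F\<close>, not just coefficient functions, because it is
  also applied to pointwise limits of coefficient functions that are not yet known to be coefficient
  functions themselves.\<close>

lemma cmod_synthesis_le:
  assumes [measurable]: "F \<in> borel_measurable N" and F: "\<And>u. cmod (F u) \<le> C" and "0 \<le> C"
  shows "cmod (LINT u|N. e u x * F u) \<le> indicator S x * (C * measure N (space N))"
proof (cases "x \<in> S")
  case True
  have x: "x \<in> space M" using True sets.sets_into_space[OF S_meas] by auto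
  have "cmod (e u x * F u) \<le> 1 * C" for u
    unfolding norm_mult
    using e_bound[of u x] by (intro mult_mono assms) (auto split: split_indicator_asm)
  then have "cmod (LINT u|N. e u x * F u) \<le> (LINT u|N. C)"
    by (intro Bochner_Integration.integral_norm_bound_integral integrable_e_mult[where C = C] x assms) auto
  then show ?thesis using True by (simp add: mult.commute)
next
  case False
  then have "e u x = 0" for u using e_bound[of u x] by simp
  then show ?thesis using False by simp
qed

lemma synthesis_L2:
  assumes F [measurable]: "F \<in> borel_measurable N" "\<And>u. cmod (F u) \<le> C" "0 \<le> C"
  shows "L2 M (\<lambda>x. LINT u|N. e u x * F u)"
  unfolding L2_def
proof
  show "integrable M (\<lambda>x. (cmod (LINT u|N. e u x * F u))\<^sup>2)"
  proof (rule Bochner_Integration.integrable_bound)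
    show "integrable M (\<lambda>x. indicator S x * (C * measure N (space N))\<^sup>2 :: real)"
      using integrable_indicator_S by simp
    have "(cmod (LINT u|N. e u x * F u))\<^sup>2 \<le> indicator S x * (C * measure N (space N))\<^sup>2" for x
      using power_mono[OF cmod_synthesis_le[OF F, of x] norm_ge_zero, of 2]
      by (simp split: split_indicator_asm)
    then show "AE x in M. norm ((cmod (LINT u|N. e u x * F u))\<^sup>2) \<le> norm (indicator S x * (C * measure N (space N))\<^sup>2)"
      by auto
  qed measurable
qed measurable

lemma op_L2: "L2 M f \<Longrightarrow> L2 M (op f)"
  unfolding op_def[abs_def]
  by (metis synthesis_L2 L2_measurable coef_bounded coef_meas)

lemma ip_op:
  assumes f: "L2 M f" and g: "L2 M g"
  shows "ip M (op f) g = ip N (coef f) (coef g)"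
proof -
  note [measurable] = L2_measurable[OF f] L2_measurable[OF g]
  obtain C where C: "0 \<le> C" "\<And>u. cmod (coef f u) \<le> C" using coef_bounded[OF f] by blast
  define h where "h = (\<lambda>u x. e u x * coef f u * cnj (g x))"
  have [measurable]: "(\<lambda>p. h (fst p) (snd p)) \<in> borel_measurable (N \<Otimes>\<^sub>M M)"
    unfolding h_def by measurable
  have inner_int: "integrable M (h u)" for u
    using integrable_L2_mult[OF e_L2[of u] g] unfolding h_def
    by (simp add: mult.commute[of _ "coef f u"] mult.assoc)
  \<comment> \<open>As S has finite measure, its indicator is square integrable, so its product with
    g is integrable. This dominates the inner integrals for Fubini.\<close>
  have Sg: "integrable M (\<lambda>x. indicator S x * cmod (g x))"
  proof -
    have "(\<lambda>x. (cmod (indicator S x))\<^sup>2) = (indicator S :: 'a \<Rightarrow> real)"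
      by (auto simp: fun_eq_iff split: split_indicator)
    then have "L2 M (\<lambda>x. indicator S x)"
      unfolding L2_def using integrable_indicator_S by simp
    from integrable_norm[OF integrable_L2_mult[OF this g]] show ?thesis
      by (simp add: norm_mult cong: if_cong) (simp add: indicator_def of_bool_def if_distrib cong: if_cong)
  qed
  have "integrable (N \<Otimes>\<^sub>M M) (\<lambda>p. h (fst p) (snd p))"
  proof (rule NM.Fubini_integrable)
    show "integrable N (\<lambda>u. LINT x|M. norm (h (fst (u, x)) (snd (u, x))))"
    proof (rule N.integrable_const_bound)
      have "norm (h u x) \<le> C * (indicator S x * cmod (g x))" for u x
        unfolding h_def norm_mult
        using mult_mono[OF mult_mono[OF e_bound[of u x] C(2)[of u]] order_refl, of "cmod (g x)"] C(1)
        by (simp add: mult_ac)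
      then have "(LINT x|M. norm (h u x)) \<le> (LINT x|M. C * (indicator S x * cmod (g x)))" for u
        by (intro integral_mono integrable_norm inner_int integrable_mult_right Sg)
      then show "AE u in N. norm (LINT x|M. norm (h (fst (u, x)) (snd (u, x)))) \<le> (LINT x|M. C * (indicator S x * cmod (g x)))"
        by simp
    qed measurable
  qed (use inner_int in auto)
  then have "(LINT x|M. LINT u|N. h u x) = (LINT u|N. LINT x|M. h u x)"
    by (intro NM.Fubini_integral) (simp add: split_beta')
  moreover have "(LINT x|M. LINT u|N. h u x) = ip M (op f) g"
    unfolding ip_def op_def h_def by simp
  moreover have "(LINT x|M. h u x) = coef f u * cnj (coef g u)" for u
  proof -
    have "(LINT x|M. h u x) = coef f u * ip M (e u) g"
      unfolding h_def ip_def by (subst integral_mult_right_zero[symmetric]) (simp add: mult_ac)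
    then show ?thesis by (simp add: coef_def ip_commute[of M "e u" g])
  qed
  ultimately show ?thesis by (simp add: ip_def)
qed

lemma sqnorm_coef_le: "L2 M f \<Longrightarrow> sqnorm N (coef f) \<le> sqnorm M f"
  using contraction by (simp add: coef_def[abs_def])

lemma coef_diff: "L2 M f \<Longrightarrow> L2 M g \<Longrightarrow> coef (\<lambda>x. f x - g x) u = coef f u - coef g u"
  by (simp add: coef_def ip_diff_left e_L2)

lemma coef_mult: "coef (\<lambda>x. c * f x) u = c * coef f u"
  by (simp add: coef_def ip_mult_left)

lemma coef_sum: "(\<And>i. i \<in> I \<Longrightarrow> L2 M (f i)) \<Longrightarrow>
    coef (\<lambda>x. \<Sum>i\<in>I. c i * f i x) u = (\<Sum>i\<in>I. c i * coef (f i) u)"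
  by (simp add: coef_def ip_sum_left e_L2)

definition eigen :: "real \<Rightarrow> ('a \<Rightarrow> complex) \<Rightarrow> bool" where
  "eigen s f \<longleftrightarrow> L2 M f \<and> (AE x in M. op f x = of_real s * f x)"

lemma eigen_L2: "eigen s f \<Longrightarrow> L2 M f"
  by (simp add: eigen_def)

lemma ip_coef_eigen:
  assumes "eigen s f" "L2 M g"
  shows "ip N (coef f) (coef g) = of_real s * ip M f g"
proof -
  have f: "L2 M f" by (rule eigen_L2[OF assms(1)])
  have "ip M (op f) g = ip M (\<lambda>x. of_real s * f x) g"
    unfolding ip_def using assms(1) f op_L2[OF f] L2_measurable[OF assms(2)]
    by (intro integral_cong_AE) (auto simp: eigen_def dest: L2_measurable)
  then show ?thesis by (simp add: ip_op[OF f assms(2)] ip_mult_left)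
qed

lemma eigen_orthogonal:
  assumes "eigen s f" "eigen t g" "s \<noteq> t"
  shows "ip M f g = 0"
proof -
  have "of_real s * ip M f g = ip N (coef f) (coef g)"
    using ip_coef_eigen[OF assms(1) eigen_L2[OF assms(2)]] by simp
  also have "\<dots> = cnj (ip N (coef g) (coef f))" by (rule ip_commute)
  also have "\<dots> = cnj (of_real t * ip M g f)"
    using ip_coef_eigen[OF assms(2) eigen_L2[OF assms(1)]] by simp
  also have "\<dots> = of_real t * ip M f g" by (simp add: ip_commute[of M f g])
  finally show ?thesis using assms(3) by simp
qed

lemma sqnorm_coef_eigen:
  assumes "eigen s f"
  shows "sqnorm N (coef f) = s * sqnorm M f"
proof -
  have "complex_of_real (sqnorm N (coef f)) = of_real (s * sqnorm M f)"
    using ip_coef_eigen[OF assms eigen_L2[OF assms]] by (simp add: ip_self)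
  then show ?thesis unfolding of_real_eq_iff .
qed

section \<open>Compactness of the operator and its largest eigenvalue on a complement\<close>

lemma sqnorm_e_diff_tendsto_0:
  assumes "u \<longlonglongrightarrow> v"
  shows "(\<lambda>n. sqnorm M (\<lambda>x. e (u n) x - e v x)) \<longlonglongrightarrow> 0"
proof -
  have "(\<lambda>n. LINT x|M. (cmod (e (u n) x - e v x))\<^sup>2) \<longlonglongrightarrow> (LINT x|M. 0)"
  proof (rule integral_dominated_convergence)
    show "integrable M (\<lambda>x. 4 * indicator S x :: real)"
      using integrable_indicator_S by simp
    have "(\<lambda>n. (cmod (e (u n) x - e v x))\<^sup>2) \<longlonglongrightarrow> (cmod (e v x - e v x))\<^sup>2" for x
      using e_cont[of x] assms
      by (intro tendsto_intros) (auto simp: continuous_on_sequentially comp_def)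
    then show "AE x in M. (\<lambda>n. (cmod (e (u n) x - e v x))\<^sup>2) \<longlonglongrightarrow> 0" by simp
    have "(cmod (e (u n) x - e v x))\<^sup>2 \<le> 4 * indicator S x" for n x
    proof -
      have "cmod (e (u n) x - e v x) \<le> 2 * indicator S x"
        using e_bound[of "u n" x] e_bound[of v x] norm_triangle_ineq4[of "e (u n) x" "e v x"] by linarith
      then have "(cmod (e (u n) x - e v x))\<^sup>2 \<le> (2 * indicator S x)\<^sup>2"
        by (rule power_mono) simp
      then show ?thesis by (simp split: split_indicator_asm)
    qed
    then show "AE x in M. norm ((cmod (e (u n) x - e v x))\<^sup>2) \<le> 4 * indicator S x" for n
      by simp
  qed measurable
  then show ?thesis by (simp add: sqnorm_def)
qed

text \<open>Weak sequential compactness of the unit ball, seen through the coefficients: a diagonal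
  subsequence converges on a countable dense set of parameters, and equicontinuity does the rest.\<close>

lemma coef_convergent_subsequence:
  assumes g: "\<And>n. L2 M (g n)" "\<And>n. sqnorm M (g n) \<le> 1"
  obtains k :: "nat \<Rightarrow> nat" and F where "strict_mono k" "\<And>u. (\<lambda>n. coef (g (k n)) u) \<longlonglongrightarrow> F u"
proof -
  obtain D :: "'b set" where D: "countable D" "\<And>X. open X \<Longrightarrow> X \<noteq> {} \<Longrightarrow> \<exists>d\<in>D. d \<in> X"
    using countable_dense_exists by blast
  have bd: "cmod (coef (g n) u) \<le> sqrt (measure M S)" for n u
    using cmod_coef_le[OF g(1), of n 1 u] g(2)[of n] by simp
  obtain k :: "nat \<Rightarrow> nat" where k: "strict_mono k"
    and conv: "\<And>u. u \<in> D \<Longrightarrow> \<exists>l. (\<lambda>n. coef (g (k n)) u) \<longlonglongrightarrow> l"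
    by (rule function_convergent_subsequence[OF D(1), of "\<lambda>n. coef (g n)" "sqrt (measure M S)"])
       (use bd in auto)
  have "convergent (\<lambda>n. coef (g (k n)) v)" for v
    unfolding Cauchy_convergent_iff[symmetric]
  proof (rule metric_CauchyI)
    fix \<delta> :: real assume \<delta>: "0 < \<delta>"
    have "\<exists>d\<in>D. d \<in> ball v (1 / real (Suc n))" for n by (intro D(2)) auto
    then obtain d where d: "\<And>n. d n \<in> D" "\<And>n. dist v (d n) < 1 / real (Suc n)"
      by (metis mem_ball)
    have "(\<lambda>n. dist (d n) v) \<longlonglongrightarrow> 0"
    proof (rule Lim_null_comparison)
      show "(\<lambda>n. 1 / real (Suc n)) \<longlonglongrightarrow> 0" by (rule LIMSEQ_Suc[OF lim_1_over_n])
      show "\<forall>\<^sub>F n in sequentially. norm (dist (d n) v) \<le> 1 / real (Suc n)"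
        using d(2) by (auto simp: dist_commute less_imp_le)
    qed
    then have "d \<longlonglongrightarrow> v" by (rule iffD2[OF tendsto_dist_iff])
    then have "(\<lambda>n. sqnorm M (\<lambda>x. e (d n) x - e v x)) \<longlonglongrightarrow> 0"
      by (rule sqnorm_e_diff_tendsto_0)
    then have "\<forall>\<^sub>F n in sequentially. sqnorm M (\<lambda>x. e (d n) x - e v x) < (\<delta> / 3)\<^sup>2"
      by (rule order_tendstoD(2)) (use \<delta> in simp)
    then obtain m where m: "sqnorm M (\<lambda>x. e (d m) x - e v x) < (\<delta> / 3)\<^sup>2"
      using eventually_happens'[OF sequentially_bot] by blast
    define w where "w = d m"
    \<comment> \<open>Equicontinuity: by Cauchy-Schwarz the difference is controlled by the distance
      of \<open>e w\<close> and \<open>e v\<close>, with no dependence on n since the norms of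
      \<open>g n\<close> are at most 1.\<close>
    have near: "cmod (coef (g n) w - coef (g n) v) < \<delta> / 3" for n
    proof (rule power_less_imp_less_base)
      have "coef (g n) w - coef (g n) v = cnj (ip M (\<lambda>x. e w x - e v x) (g n))"
        using ip_commute[of M "g n"] by (simp add: coef_def ip_diff_left e_L2 g)
      then have "(cmod (coef (g n) w - coef (g n) v))\<^sup>2 \<le> sqnorm M (\<lambda>x. e w x - e v x) * sqnorm M (g n)"
        using cmod_ip_square_le[OF L2_diff[OF e_L2 e_L2] g(1)] by simp
      also have "\<dots> \<le> sqnorm M (\<lambda>x. e w x - e v x) * 1"
        by (intro mult_left_mono g) simp
      also have "\<dots> < (\<delta> / 3)\<^sup>2" using m by (simp add: w_def)
      finally show "(cmod (coef (g n) w - coef (g n) v))\<^sup>2 < (\<delta> / 3)\<^sup>2" .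
    qed (use \<delta> in simp)
    have "Cauchy (\<lambda>n. coef (g (k n)) w)"
      using conv[of w] d(1) by (auto simp: w_def intro: LIMSEQ_imp_Cauchy)
    then obtain n0 where n0: "\<And>n n'. n \<ge> n0 \<Longrightarrow> n' \<ge> n0 \<Longrightarrow> dist (coef (g (k n)) w) (coef (g (k n')) w) < \<delta> / 3"
      using \<delta> metric_CauchyD[of "\<lambda>n. coef (g (k n)) w" "\<delta> / 3"] by auto
    have "dist (coef (g (k n)) v) (coef (g (k n')) v) < \<delta>" if "n \<ge> n0" "n' \<ge> n0" for n n'
    proof -
      have "dist (coef (g (k n)) v) (coef (g (k n')) v) \<le>
        cmod (coef (g (k n)) w - coef (g (k n)) v) + cmod (coef (g (k n)) w - coef (g (k n')) w)
          + cmod (coef (g (k n')) w - coef (g (k n')) v)"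
        unfolding dist_norm by norm
      also have "\<dots> < \<delta> / 3 + \<delta> / 3 + \<delta> / 3"
        using n0[OF that] near[of "k n"] near[of "k n'"] unfolding dist_norm by linarith
      finally show ?thesis by simp
    qed
    then show "\<exists>n0. \<forall>n\<ge>n0. \<forall>n'\<ge>n0. dist (coef (g (k n)) v) (coef (g (k n')) v) < \<delta>" by blast
  qed
  then have "(\<lambda>n. coef (g (k n)) v) \<longlonglongrightarrow> lim (\<lambda>n. coef (g (k n)) v)" for v
    by (simp add: convergent_LIMSEQ_iff)
  with k show ?thesis by (rule that)
qed

text \<open>Weak convergence becomes norm convergence, which is the compactness of
  \<open>op\<close>. Dominated convergence is used twice: over frequencies, where the measure is
  finite and the coefficients are uniformly bounded, and then over positions, where everything is
  dominated on S.\<close>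

lemma op_tendsto_L2:
  assumes g: "\<And>n. L2 M (g n)" "\<And>n. sqnorm M (g n) \<le> 1"
    and F: "\<And>u. (\<lambda>n. coef (g n) u) \<longlonglongrightarrow> F u"
  shows "L2 M (\<lambda>x. LINT u|N. e u x * F u)"
    and "(\<lambda>n. sqnorm M (\<lambda>x. op (g n) x - (LINT u|N. e u x * F u))) \<longlonglongrightarrow> 0"
proof -
  define C where "C = sqrt (measure M S)"
  have C: "0 \<le> C" by (simp add: C_def)
  have [measurable]: "coef (g n) \<in> borel_measurable N" for n
    by (rule coef_meas[OF L2_measurable[OF g(1)]])
  have gC: "cmod (coef (g n) u) \<le> C" for n u
    using cmod_coef_le[OF g(1), of n 1 u] g(2)[of n] by (simp add: C_def)
  have Fm [measurable]: "F \<in> borel_measurable N"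
    by (rule borel_measurable_LIMSEQ_metric[of "\<lambda>n. coef (g n)"]) (auto intro: F)
  have FC: "cmod (F u) \<le> C" for u
    by (rule LIMSEQ_le_const2[OF tendsto_norm[OF F]]) (use gC in auto)
  define h where "h x = (LINT u|N. e u x * F u)" for x
  show hL2: "L2 M (\<lambda>x. LINT u|N. e u x * F u)"
    by (rule synthesis_L2[OF Fm FC C])
  have [measurable]: "h \<in> borel_measurable M" "op (g n) \<in> borel_measurable M" for n
    using L2_measurable[OF hL2] L2_measurable[OF op_L2[OF g(1)]] by (auto simp: h_def[abs_def])
  define B where "B = C * measure N (space N)"
  have ptw: "(\<lambda>n. op (g n) x) \<longlonglongrightarrow> h x" if x: "x \<in> space M" for x
    unfolding op_def h_def
  proof (rule integral_dominated_convergence)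
    show "integrable N (\<lambda>u. C)" by simp
    show "AE u in N. (\<lambda>n. e u x * coef (g n) u) \<longlonglongrightarrow> e u x * F u"
      by (intro always_eventually allI tendsto_intros F)
    have "cmod (e u x * coef (g n) u) \<le> 1 * C" for u n
      unfolding norm_mult
      using e_bound[of u x] by (intro mult_mono gC) (auto split: split_indicator_asm)
    then show "AE u in N. norm (e u x * coef (g n) u) \<le> C" for n by simp
  qed (use x in measurable)
  have "(\<lambda>n. LINT x|M. (cmod (op (g n) x - h x))\<^sup>2) \<longlonglongrightarrow> (LINT x|M. 0)"
  proof (rule integral_dominated_convergence)
    show "integrable M (\<lambda>x. (2 * B)\<^sup>2 * indicator S x :: real)"
      using integrable_indicator_S by simp
    have "(\<lambda>n. (cmod (op (g n) x - h x))\<^sup>2) \<longlonglongrightarrow> (cmod (h x - h x))\<^sup>2" if "x \<in> space M" for x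
      by (intro tendsto_intros ptw that)
    then show "AE x in M. (\<lambda>n. (cmod (op (g n) x - h x))\<^sup>2) \<longlonglongrightarrow> 0" by simp
    have "(cmod (op (g n) x - h x))\<^sup>2 \<le> (2 * B)\<^sup>2 * indicator S x" for n x
    proof -
      have "cmod (op (g n) x) \<le> indicator S x * B"
        unfolding op_def B_def by (rule cmod_synthesis_le) (auto intro: gC C)
      moreover have "cmod (h x) \<le> indicator S x * B"
        unfolding h_def B_def by (rule cmod_synthesis_le) (auto intro: FC C)
      ultimately have "cmod (op (g n) x - h x) \<le> 2 * B * indicator S x"
        using norm_triangle_ineq4[of "op (g n) x" "h x"] by (simp add: mult.commute mult.left_commute)
      then have "(cmod (op (g n) x - h x))\<^sup>2 \<le> (2 * B * indicator S x)\<^sup>2"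
        by (rule power_mono) simp
      then show ?thesis by (simp split: split_indicator_asm)
    qed
    then show "AE x in M. norm ((cmod (op (g n) x - h x))\<^sup>2) \<le> (2 * B)\<^sup>2 * indicator S x" for n
      by simp
  qed measurable
  then show "(\<lambda>n. sqnorm M (\<lambda>x. op (g n) x - (LINT u|N. e u x * F u))) \<longlonglongrightarrow> 0"
    by (simp add: sqnorm_def h_def)
qed

lemma ip_tendsto:
  assumes "\<And>n. L2 M (g n)" "L2 M f" "L2 M h" and lim: "(\<lambda>n. sqnorm M (\<lambda>x. g n x - f x)) \<longlonglongrightarrow> 0"
  shows "(\<lambda>n. ip M (g n) h) \<longlonglongrightarrow> ip M f h"
proof -
  have "(\<lambda>n. (cmod (ip M (g n) h - ip M f h))\<^sup>2) \<longlonglongrightarrow> 0"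
  proof (rule tendsto_sandwich[OF _ _ tendsto_const])
    show "(\<lambda>n. sqnorm M (\<lambda>x. g n x - f x) * sqnorm M h) \<longlonglongrightarrow> 0"
      using tendsto_mult_right[OF lim, of "sqnorm M h"] by simp
    have "(cmod (ip M (g n) h - ip M f h))\<^sup>2 \<le> sqnorm M (\<lambda>x. g n x - f x) * sqnorm M h" for n
      using cmod_ip_square_le[OF L2_diff[OF assms(1,2)] assms(3), of n] by (simp add: ip_diff_left assms)
    then show "\<forall>\<^sub>F n in sequentially. (cmod (ip M (g n) h - ip M f h))\<^sup>2 \<le> sqnorm M (\<lambda>x. g n x - f x) * sqnorm M h"
      by simp
  qed simp
  from tendsto_real_sqrt[OF this] have "(\<lambda>n. cmod (ip M (g n) h - ip M f h)) \<longlonglongrightarrow> 0" by simp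
  then show ?thesis by (simp add: LIM_zero_iff tendsto_norm_zero_iff)
qed

text \<open>If the form exceeded \<open>\<epsilon>\<close> on the orthogonal complement of the \<open>\<phi> i\<close>, a maximising sequence
  would converge to an eigenfunction there with an eigenvalue above \<open>\<epsilon>\<close>.\<close>

lemma sqnorm_coef_le_on_complement:
  assumes \<phi>: "\<And>i. i \<in> I \<Longrightarrow> eigen (\<mu> i) (\<phi> i)" and \<epsilon>: "0 < \<epsilon>"
    and maximal: "\<And>s f. \<epsilon> \<le> s \<Longrightarrow> eigen s f \<Longrightarrow> (\<And>i. i \<in> I \<Longrightarrow> ip M f (\<phi> i) = 0) \<Longrightarrow> sqnorm M f = 0"
    and g0: "L2 M g0" "\<And>i. i \<in> I \<Longrightarrow> ip M g0 (\<phi> i) = 0"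
  shows "sqnorm N (coef g0) \<le> \<epsilon> * sqnorm M g0"
proof (rule ccontr)
  define V where "V = {g. L2 M g \<and> (\<forall>i\<in>I. ip M g (\<phi> i) = 0)}"
  define Z where "Z = (\<lambda>g. sqnorm N (coef g)) ` {g \<in> V. sqnorm M g \<le> 1}"
  \<comment> \<open>The supremum of the Rayleigh quotient on the complement V. The rest shows that s
    > \<epsilon> would make it an eigenvalue with an eigenfunction in V.\<close>
  define s where "s = Sup Z"
  have VL2: "L2 M g" if "g \<in> V" for g using that by (simp add: V_def)
  have scale: "(\<lambda>x. c * g x) \<in> V" if "g \<in> V" for c g
    using that by (auto simp: V_def L2_mult_left ip_mult_left)
  have sqcoef: "sqnorm N (coef (\<lambda>x. c * g x)) = (cmod c)\<^sup>2 * sqnorm N (coef g)" for c g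
    by (simp add: coef_mult[abs_def] sqnorm_mult)
  have bdd: "bdd_above Z"
    unfolding Z_def by (intro bdd_aboveI[of _ 1]) (use sqnorm_coef_le VL2 in fastforce)
  have le_s: "sqnorm N (coef g) \<le> s * sqnorm M g" if g: "g \<in> V" for g
  proof (cases "sqnorm M g = 0")
    case True
    then show ?thesis using sqnorm_coef_le[OF VL2[OF g]] by simp
  next
    case False
    then have pos: "0 < sqnorm M g" using sqnorm_nonneg[of M g] by linarith
    define c where "c = complex_of_real (1 / sqrt (sqnorm M g))"
    have c2: "(cmod c)\<^sup>2 = 1 / sqnorm M g"
      using pos by (simp add: c_def norm_divide power_divide)
    have "sqnorm N (coef (\<lambda>x. c * g x)) \<in> Z"
      unfolding Z_def using scale[OF g, of c] pos by (intro imageI) (simp add: sqnorm_mult c2)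
    then have "sqnorm N (coef (\<lambda>x. c * g x)) \<le> s"
      unfolding s_def by (rule cSup_upper[OF _ bdd])
    then show ?thesis using pos by (simp add: sqcoef c2 field_simps)
  qed
  assume "\<not> sqnorm N (coef g0) \<le> \<epsilon> * sqnorm M g0"
  then have gt: "\<epsilon> * sqnorm M g0 < sqnorm N (coef g0)" by simp
  have "g0 \<in> V" using g0 by (simp add: V_def)
  have "sqnorm M g0 \<noteq> 0"
    using gt sqnorm_coef_le[OF g0(1)] by auto
  then have "0 < sqnorm M g0" using sqnorm_nonneg[of M g0] by linarith
  moreover have "\<epsilon> * sqnorm M g0 < s * sqnorm M g0"
    using gt le_s[OF \<open>g0 \<in> V\<close>] by linarith
  ultimately have s: "\<epsilon> < s" by simp
  then have s0: "0 < s" using \<epsilon> by simp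
  have "(\<lambda>x. 0) \<in> {g \<in> V. sqnorm M g \<le> 1}"
    by (auto simp: V_def ip_def sqnorm_def)
  then have "Z \<noteq> {}" unfolding Z_def by blast
  then have "\<exists>g. g \<in> V \<and> sqnorm M g \<le> 1 \<and> s - 1 / real (Suc n) < sqnorm N (coef g)" for n
    using less_cSupD[of Z "s - 1 / real (Suc n)"] by (auto simp: Z_def s_def)
  then obtain g where g: "\<And>n. g n \<in> V" "\<And>n. sqnorm M (g n) \<le> 1"
      "\<And>n. s - 1 / real (Suc n) < sqnorm N (coef (g n))"
    by metis
  obtain k F where k: "strict_mono k" and F: "\<And>u. (\<lambda>n. coef (g (k n)) u) \<longlonglongrightarrow> F u"
    using coef_convergent_subsequence[of g] g(1,2) VL2 by metis
  define f where "f n = g (k n)" for n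
  have fV: "f n \<in> V" and fL2: "L2 M (f n)" and f1: "sqnorm M (f n) \<le> 1" for n
    using g VL2 by (auto simp: f_def)
  have lim_q: "(\<lambda>n. sqnorm N (coef (f n))) \<longlonglongrightarrow> s"
  proof (rule tendsto_sandwich[OF _ _ _ tendsto_const])
    have "(\<lambda>n. s - 1 / real (Suc n)) \<longlonglongrightarrow> s - 0"
      by (intro tendsto_diff tendsto_const LIMSEQ_Suc[OF lim_1_over_n])
    then show "(\<lambda>n. s - 1 / real (Suc (k n))) \<longlonglongrightarrow> s"
      using LIMSEQ_subseq_LIMSEQ[OF _ k] by (force simp: comp_def)
    show "\<forall>\<^sub>F n in sequentially. s - 1 / real (Suc (k n)) \<le> sqnorm N (coef (f n))"
      using g(3) by (auto simp: f_def less_imp_le)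
    have "sqnorm N (coef (f n)) \<le> s" for n
      using le_s[OF fV[of n]] mult_left_mono[OF f1[of n] less_imp_le[OF s0]] by simp
    then show "\<forall>\<^sub>F n in sequentially. sqnorm N (coef (f n)) \<le> s" by simp
  qed
  \<comment> \<open>V is invariant under \<open>op\<close> because the \<phi> i are eigenfunctions,
    so \<open>le_s\<close> applies to \<open>op g\<close>. With n the square norm of
    \<open>op g\<close>, Cauchy-Schwarz for coefficients gives n^2 \<le> q (s n), where q is the
    form at g; cancel one n.\<close>
  have op_le: "sqnorm M (op g) \<le> s * sqnorm N (coef g)" if gV: "g \<in> V" for g
  proof -
    have gL2: "L2 M g" by (rule VL2[OF gV])
    have "ip M (op g) (\<phi> i) = 0" if i: "i \<in> I" for i
    proof -
      have "ip M (op g) (\<phi> i) = cnj (ip N (coef (\<phi> i)) (coef g))"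
        using ip_op[OF gL2 eigen_L2[OF \<phi>[OF i]]] ip_commute by metis
      also have "\<dots> = cnj (of_real (\<mu> i) * cnj (ip M g (\<phi> i)))"
        using ip_coef_eigen[OF \<phi>[OF i] gL2] ip_commute by metis
      also have "\<dots> = 0" using gV i by (simp add: V_def)
      finally show ?thesis .
    qed
    then have opV: "op g \<in> V" using op_L2[OF gL2] by (simp add: V_def)
    define n where "n = sqnorm M (op g)"
    have "complex_of_real n = ip N (coef g) (coef (op g))"
      using ip_op[OF gL2 op_L2[OF gL2]] by (simp add: ip_self n_def)
    then have "n\<^sup>2 = (cmod (ip N (coef g) (coef (op g))))\<^sup>2"
      by (metis norm_of_real power2_abs)
    also have "\<dots> \<le> sqnorm N (coef g) * sqnorm N (coef (op g))"
      by (rule cmod_ip_square_le[OF coef_L2[OF gL2] coef_L2[OF op_L2[OF gL2]]])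
    also have "\<dots> \<le> sqnorm N (coef g) * (s * n)"
      unfolding n_def by (intro mult_left_mono le_s opV) simp
    finally have "n * n \<le> (s * sqnorm N (coef g)) * n"
      by (simp add: power2_eq_square mult_ac)
    moreover have "0 \<le> n" "0 \<le> s * sqnorm N (coef g)" using s0 by (simp_all add: n_def)
    ultimately show ?thesis unfolding n_def[symmetric]
      by (metis mult_right_le_imp_le order_le_less)
  qed
  \<comment> \<open>The maximising functions are approximate eigenfunctions: expanding the square
    and using \<open>op_le\<close> leaves s q - 2 s q + s^2 = s (s - q), which tends to 0.\<close>
  have res: "sqnorm M (\<lambda>x. op (f n) x - of_real s * f n x) \<le> s * (s - sqnorm N (coef (f n)))" for n
  proof -
    define q where "q = sqnorm N (coef (f n))"
    have "ip M (op (f n)) (\<lambda>x. of_real s * f n x) = cnj (of_real s * ip M (f n) (op (f n)))"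
      using ip_commute[of M "op (f n)"] ip_mult_left by metis
    also have "ip M (f n) (op (f n)) = cnj (ip N (coef (f n)) (coef (f n)))"
      using ip_op[OF fL2 fL2, of n n] ip_commute by metis
    finally have "Re (ip M (op (f n)) (\<lambda>x. of_real s * f n x)) = s * q"
      by (simp add: ip_self q_def)
    then have "sqnorm M (\<lambda>x. op (f n) x - of_real s * f n x) = sqnorm M (op (f n)) - 2 * (s * q) + s\<^sup>2 * sqnorm M (f n)"
      using sqnorm_diff[OF op_L2[OF fL2] L2_mult_left[OF fL2], of n "of_real s" n] by (simp add: sqnorm_mult)
    also have "\<dots> \<le> s * q - 2 * (s * q) + s\<^sup>2 * 1"
      using op_le[OF fV[of n]] mult_left_mono[OF f1[of n], of "s\<^sup>2"] unfolding q_def by auto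
    finally show ?thesis by (simp add: q_def power2_eq_square algebra_simps)
  qed
  define h where "h x = (LINT u|N. e u x * F u)" for x
  have h: "L2 M h" and lim_h: "(\<lambda>n. sqnorm M (\<lambda>x. op (f n) x - h x)) \<longlonglongrightarrow> 0"
    using op_tendsto_L2[of f F] fL2 f1 F by (auto simp: f_def h_def[abs_def])
  \<comment> \<open>Since \<open>op (f n)\<close> tends to h and \<open>op (f n)\<close> minus s
    times \<open>f n\<close> tends to 0, the only possible limit of \<open>f n\<close> is h /
    s.\<close>
  define w where "w x = of_real (1 / s) * h x" for x
  have w: "L2 M w" unfolding w_def by (rule L2_mult_left[OF h])
  have lim_w: "(\<lambda>n. sqnorm M (\<lambda>x. f n x - w x)) \<longlonglongrightarrow> 0"
  proof (rule tendsto_sandwich[OF _ _ tendsto_const])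
    have "(\<lambda>n. (1 / s)\<^sup>2 * (2 * sqnorm M (\<lambda>x. op (f n) x - h x) + 2 * (s * (s - sqnorm N (coef (f n)))))) \<longlonglongrightarrow>
      (1 / s)\<^sup>2 * (2 * 0 + 2 * (s * (s - s)))"
      by (intro tendsto_intros lim_h lim_q)
    then show "(\<lambda>n. (1 / s)\<^sup>2 * (2 * sqnorm M (\<lambda>x. op (f n) x - h x) + 2 * (s * (s - sqnorm N (coef (f n)))))) \<longlonglongrightarrow> 0"
      by simp
    have "sqnorm M (\<lambda>x. f n x - w x) \<le> (1 / s)\<^sup>2 * (2 * sqnorm M (\<lambda>x. op (f n) x - h x) + 2 * (s * (s - sqnorm N (coef (f n)))))" for n
    proof -
      have eq: "(\<lambda>x. f n x - w x) = (\<lambda>x. of_real (1 / s) * ((op (f n) x - h x) - (op (f n) x - of_real s * f n x)))"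
        using s0 by (auto simp: fun_eq_iff w_def field_simps)
      have "sqnorm M (\<lambda>x. f n x - w x) = (1 / s)\<^sup>2 * sqnorm M (\<lambda>x. (op (f n) x - h x) - (op (f n) x - of_real s * f n x))"
        unfolding eq sqnorm_mult by (simp add: norm_divide power_divide)
      also have "sqnorm M (\<lambda>x. (op (f n) x - h x) - (op (f n) x - of_real s * f n x)) \<le>
         2 * sqnorm M (\<lambda>x. op (f n) x - h x) + 2 * sqnorm M (\<lambda>x. op (f n) x - of_real s * f n x)"
        by (intro sqnorm_diff_le L2_diff L2_mult_left op_L2 fL2 h)
      also have "\<dots> \<le> 2 * sqnorm M (\<lambda>x. op (f n) x - h x) + 2 * (s * (s - sqnorm N (coef (f n))))"
        using res[of n] by simp
      finally show ?thesis by (simp add: mult_left_mono)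
    qed
    then show "\<forall>\<^sub>F n in sequentially. sqnorm M (\<lambda>x. f n x - w x) \<le> (1 / s)\<^sup>2 * (2 * sqnorm M (\<lambda>x. op (f n) x - h x) + 2 * (s * (s - sqnorm N (coef (f n)))))"
      by simp
  qed simp
  \<comment> \<open>Norm convergence of \<open>f n\<close> to w identifies F as the coefficient
    function of w. Hence h is \<open>op w\<close>, and the definition of w becomes the eigenvalue
    equation.\<close>
  have "coef w u = F u" for u
    using LIMSEQ_unique[OF F[of u]] ip_tendsto[OF fL2 w e_L2 lim_w, of u] by (simp add: coef_def f_def)
  then have "op w x = of_real s * w x" for x
    using s0 by (simp add: op_def w_def h_def)
  then have "eigen s w" using w by (simp add: eigen_def)
  moreover have "ip M w (\<phi> i) = 0" if i: "i \<in> I" for i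
    using LIMSEQ_unique[OF ip_tendsto[OF fL2 w eigen_L2[OF \<phi>[OF i]] lim_w]] fV i by (simp add: V_def)
  ultimately have w0: "sqnorm M w = 0" using s by (intro maximal[of s w]) auto
  \<comment> \<open>Maximality made w vanish, so \<open>f n\<close> tends to 0 in norm and so do the
    form values. But these tend to s > 0.\<close>
  have "sqnorm N (coef (f n)) \<le> 2 * sqnorm M (\<lambda>x. f n x - w x)" for n
  proof -
    have "sqnorm M (f n) = sqnorm M (\<lambda>x. (f n x - w x) - (-1) * w x)" by simp
    also have "\<dots> \<le> 2 * sqnorm M (\<lambda>x. f n x - w x) + 2 * sqnorm M (\<lambda>x. (-1) * w x)"
      by (intro sqnorm_diff_le L2_diff L2_mult_left w fL2)
    also have "sqnorm M (\<lambda>x. (-1) * w x) = 0" unfolding sqnorm_mult w0 by simp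
    finally show ?thesis using sqnorm_coef_le[OF fL2, of n] by simp
  qed
  then have "s \<le> 2 * 0"
    by (intro LIMSEQ_le[OF lim_q tendsto_mult_left[OF lim_w]]) auto
  then show False using s0 by simp
qed

section \<open>Traces as integrals over frequencies\<close>

definition trace :: real where
  "trace = (LINT u|N. sqnorm M (e u))"

text \<open>The double integral of the squared moduli of the inner products of \<open>e u\<close>
  and \<open>e v\<close>, that is, the trace of the square of \<open>op\<close>. No eigenbasis
  enters.\<close>

definition trace_sq :: real where
  "trace_sq = (LINT u|N. sqnorm N (coef (e u)))"

lemma integrable_sqnorm_e: "integrable N (\<lambda>u. sqnorm M (e u))"
proof (rule N.integrable_const_bound)
  show "AE u in N. norm (sqnorm M (e u)) \<le> measure M S"
    using sqnorm_e_le by simp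
qed (unfold sqnorm_def, measurable)

lemma integrable_sqnorm_coef_e: "integrable N (\<lambda>u. sqnorm N (coef (e u)))"
proof (rule N.integrable_const_bound)
  show "AE u in N. norm (sqnorm N (coef (e u))) \<le> measure M S"
    using sqnorm_coef_le[OF e_L2] sqnorm_e_le by (auto intro: order_trans)
qed (unfold sqnorm_def coef_def ip_def, measurable)

context
  fixes I :: "'i set" and \<mu> :: "'i \<Rightarrow> real" and \<phi> :: "'i \<Rightarrow> 'a \<Rightarrow> complex"
  assumes fin: "finite I" and eig: "\<And>i. i \<in> I \<Longrightarrow> eigen (\<mu> i) (\<phi> i)"
    and orthonormal: "\<And>i j. i \<in> I \<Longrightarrow> j \<in> I \<Longrightarrow> ip M (\<phi> i) (\<phi> j) = (if i = j then 1 else 0)"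
begin

lemma sqnorm_eigenvector: "i \<in> I \<Longrightarrow> sqnorm M (\<phi> i) = 1"
  using orthonormal[of i i] by (simp add: ip_self)

lemma eigenvalue_le_1: "i \<in> I \<Longrightarrow> \<mu> i \<le> 1"
  using sqnorm_coef_eigen[OF eig] sqnorm_coef_le[OF eigen_L2[OF eig]] sqnorm_eigenvector by force

lemma integral_cmod_coef: "i \<in> I \<Longrightarrow> (LINT u|N. (cmod (coef (\<phi> i) u))\<^sup>2) = \<mu> i"
  using sqnorm_coef_eigen[OF eig] sqnorm_eigenvector by (simp add: sqnorm_def)

lemma sqnorm_e_minus_projection:
  "sqnorm M (\<lambda>x. e u x - (\<Sum>i\<in>I. cnj (coef (\<phi> i) u) * \<phi> i x)) =
     sqnorm M (e u) - (\<Sum>i\<in>I. (cmod (coef (\<phi> i) u))\<^sup>2)"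
proof -
  have "sqnorm M (\<lambda>x. e u x - (\<Sum>i\<in>I. cnj (coef (\<phi> i) u) * \<phi> i x)) =
     sqnorm M (e u) - (\<Sum>i\<in>I. 1 * (cmod (cnj (coef (\<phi> i) u)))\<^sup>2)"
    by (rule sqnorm_minus_projection[OF fin _ e_L2])
       (auto simp: orthonormal coef_def ip_commute[of M "e u"] intro: eigen_L2 eig)
  then show ?thesis by simp
qed

text \<open>By the eigenvalue equation, passing to coefficients turns the orthonormal family into an
  orthogonal one with square norms \<mu> i, and \<open>e u\<close> keeps the same expansion
  coefficients. So the projection formula applies again in the frequency space.\<close>

lemma sqnorm_coef_e_minus_projection:
  "sqnorm N (coef (\<lambda>x. e u x - (\<Sum>i\<in>I. cnj (coef (\<phi> i) u) * \<phi> i x))) =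
     sqnorm N (coef (e u)) - (\<Sum>i\<in>I. \<mu> i * (cmod (coef (\<phi> i) u))\<^sup>2)"
proof -
  have L: "L2 M (\<phi> i)" if "i \<in> I" for i using eigen_L2[OF eig[OF that]] .
  have "coef (\<lambda>x. e u x - (\<Sum>i\<in>I. cnj (coef (\<phi> i) u) * \<phi> i x)) =
      (\<lambda>v. coef (e u) v - (\<Sum>i\<in>I. cnj (coef (\<phi> i) u) * coef (\<phi> i) v))"
    by (rule ext) (simp add: coef_diff coef_sum L e_L2 L2_sum L2_mult_left)
  moreover have "sqnorm N \<dots> = sqnorm N (coef (e u)) - (\<Sum>i\<in>I. \<mu> i * (cmod (cnj (coef (\<phi> i) u)))\<^sup>2)"
  proof (rule sqnorm_minus_projection[OF fin coef_L2[OF L] coef_L2[OF e_L2]])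
    fix i j assume i: "i \<in> I" and j: "j \<in> I"
    show "ip N (coef (\<phi> i)) (coef (\<phi> j)) = (if i = j then complex_of_real (\<mu> i) else 0)"
      using ip_coef_eigen[OF eig[OF i] L[OF j]] orthonormal[OF i j] by simp
  next
    fix i assume i: "i \<in> I"
    have "ip N (coef (e u)) (coef (\<phi> i)) = cnj (of_real (\<mu> i) * ip M (\<phi> i) (e u))"
      using ip_coef_eigen[OF eig[OF i] e_L2] ip_commute by metis
    then show "ip N (coef (e u)) (coef (\<phi> i)) = of_real (\<mu> i) * cnj (coef (\<phi> i) u)"
      by (simp add: coef_def)
  qed
  ultimately show ?thesis by simp
qed

lemma integrable_cmod_coef: "i \<in> I \<Longrightarrow> integrable N (\<lambda>u. (cmod (coef (\<phi> i) u))\<^sup>2)"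
  by (intro L2_integrable_square coef_L2 eigen_L2[OF eig])

text \<open>Bessel's inequality for each \<open>e u\<close>, integrated over u; the squared
  coefficients of \<phi> i integrate to \<mu> i.\<close>

lemma sum_eigenvalues_le_trace: "(\<Sum>i\<in>I. \<mu> i) \<le> trace"
proof -
  have "(\<Sum>i\<in>I. \<mu> i) = (LINT u|N. (\<Sum>i\<in>I. (cmod (coef (\<phi> i) u))\<^sup>2))"
    by (simp add: integrable_cmod_coef integral_cmod_coef)
  also have "\<dots> \<le> trace"
    unfolding trace_def
  proof (intro integral_mono integrable_sqnorm_e Bochner_Integration.integrable_sum integrable_cmod_coef)
    fix u
    show "(\<Sum>i\<in>I. (cmod (coef (\<phi> i) u))\<^sup>2) \<le> sqnorm M (e u)"
      using sqnorm_e_minus_projection[of u]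
        sqnorm_nonneg[of M "\<lambda>x. e u x - (\<Sum>i\<in>I. cnj (coef (\<phi> i) u) * \<phi> i x)"] by linarith
  qed
  finally show ?thesis .
qed

text \<open>With d the sum of 1 - \<mu> i and r the part of the trace not captured by the family,
  the difference to be estimated is d - r with d, r \<ge> 0. So it suffices to bound each of them by
  a multiple of \<open>trace - trace_sq\<close>.\<close>

lemma card_eigenfunctions_near_trace:
  assumes \<epsilon>: "0 < \<epsilon>" "\<epsilon> < 1" and ge: "\<And>i. i \<in> I \<Longrightarrow> \<epsilon> \<le> \<mu> i"
    and maximal: "\<And>s f. \<epsilon> \<le> s \<Longrightarrow> eigen s f \<Longrightarrow> (\<And>i. i \<in> I \<Longrightarrow> ip M f (\<phi> i) = 0) \<Longrightarrow> sqnorm M f = 0"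
  shows "\<bar>real (card I) - trace\<bar> \<le> (1 / \<epsilon> + 1 / (1 - \<epsilon>)) * (trace - trace_sq)"
proof -
  define r where "r = trace - (\<Sum>i\<in>I. \<mu> i)"
  define d where "d = (\<Sum>i\<in>I. 1 - \<mu> i)"
  have r0: "0 \<le> r" using sum_eigenvalues_le_trace by (simp add: r_def)
  have d0: "0 \<le> d" unfolding d_def using eigenvalue_le_1 by (intro sum_nonneg) simp
  have L: "L2 M (\<phi> i)" if "i \<in> I" for i using eigen_L2[OF eig[OF that]] .
  \<comment> \<open>The form bound is applied, for each u, to the component of \<open>e u\<close>
    orthogonal to the family. Integrated, it says that the uncaptured part of
    \<open>trace_sq\<close> is at most \<epsilon> r.\<close>
  have "(LINT u|N. sqnorm N (coef (e u)) - (\<Sum>i\<in>I. \<mu> i * (cmod (coef (\<phi> i) u))\<^sup>2))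
      \<le> (LINT u|N. \<epsilon> * (sqnorm M (e u) - (\<Sum>i\<in>I. (cmod (coef (\<phi> i) u))\<^sup>2)))"
  proof (rule integral_mono)
    fix u
    define p where "p = (\<lambda>x. e u x - (\<Sum>i\<in>I. cnj (coef (\<phi> i) u) * \<phi> i x))"
    have "sqnorm N (coef p) \<le> \<epsilon> * sqnorm M p"
    proof (rule sqnorm_coef_le_on_complement[OF eig \<epsilon>(1) maximal])
      show "L2 M p" unfolding p_def by (intro L2_diff e_L2 L2_sum L2_mult_left L)
      fix i assume i: "i \<in> I"
      have "ip M p (\<phi> i) = ip M (e u) (\<phi> i) - (\<Sum>j\<in>I. cnj (coef (\<phi> j) u) * ip M (\<phi> j) (\<phi> i))"
        unfolding p_def using i by (simp add: ip_diff_left ip_sum_left e_L2 L L2_sum L2_mult_left)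
      also have "(\<Sum>j\<in>I. cnj (coef (\<phi> j) u) * ip M (\<phi> j) (\<phi> i)) = (\<Sum>j\<in>I. if j = i then cnj (coef (\<phi> i) u) else 0)"
        using i by (intro sum.cong) (auto simp: orthonormal)
      also have "\<dots> = ip M (e u) (\<phi> i)"
        using fin i by (simp add: coef_def ip_commute[of M "e u"])
      finally show "ip M p (\<phi> i) = 0" by simp
    qed
    then show "sqnorm N (coef (e u)) - (\<Sum>i\<in>I. \<mu> i * (cmod (coef (\<phi> i) u))\<^sup>2)
      \<le> \<epsilon> * (sqnorm M (e u) - (\<Sum>i\<in>I. (cmod (coef (\<phi> i) u))\<^sup>2))"
      unfolding p_def sqnorm_e_minus_projection sqnorm_coef_e_minus_projection .
  qed (intro Bochner_Integration.integrable_diff Bochner_Integration.integrable_sum integrable_mult_right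
      integrable_sqnorm_e integrable_sqnorm_coef_e integrable_cmod_coef; assumption)+
  then have "trace_sq - (\<Sum>i\<in>I. \<mu> i * \<mu> i) \<le> \<epsilon> * r"
    by (simp add: integrable_sqnorm_e integrable_sqnorm_coef_e integrable_cmod_coef
        integral_cmod_coef trace_def trace_sq_def r_def)
  moreover have "\<epsilon> * d \<le> (\<Sum>i\<in>I. \<mu> i * (1 - \<mu> i))"
    unfolding d_def sum_distrib_left using ge eigenvalue_le_1
    by (intro sum_mono mult_right_mono) auto
  moreover have "(\<Sum>i\<in>I. \<mu> i * (1 - \<mu> i)) = (\<Sum>i\<in>I. \<mu> i) - (\<Sum>i\<in>I. \<mu> i * \<mu> i)"
    by (simp add: right_diff_distrib sum_subtractf)
  \<comment> \<open>\<open>trace - trace_sq\<close> is r plus the sum of \<mu> i (1 - \<mu> i) minus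
    the uncaptured part of \<open>trace_sq\<close>; the sum is at least \<epsilon> d and the last
    part at most \<epsilon> r.\<close>
  ultimately have key: "\<epsilon> * d + (1 - \<epsilon>) * r \<le> trace - trace_sq"
    by (simp add: r_def algebra_simps)
  have "\<epsilon> * d \<le> trace - trace_sq" "(1 - \<epsilon>) * r \<le> trace - trace_sq"
    using key \<epsilon> r0 d0 mult_nonneg_nonneg[of \<epsilon> d] mult_nonneg_nonneg[of "1 - \<epsilon>" r] by linarith+
  then have "d \<le> 1 / \<epsilon> * (trace - trace_sq)" "r \<le> 1 / (1 - \<epsilon>) * (trace - trace_sq)"
    using \<epsilon> by (simp_all add: field_simps)
  moreover have "real (card I) - trace = d - r"
    by (simp add: d_def r_def sum_subtractf)
  ultimately show ?thesis using r0 d0 by (simp add: distrib_right)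
qed

end

end

section \<open>From orthonormal families to the eigenvalue count\<close>

lemma sq_integrable_eq_L2: "sq_integrable = L2 lebesgue"
  by (simp add: fun_eq_iff sq_integrable_def L2_def)

lemma l2_inner_eq_ip: "l2_inner = ip lebesgue"
  by (simp add: fun_eq_iff l2_inner_def ip_def)

lemma sqnorm_eq_0_iff:
  assumes "L2 M f"
  shows "sqnorm M f = 0 \<longleftrightarrow> (AE x in M. f x = 0)"
  unfolding sqnorm_def using integral_nonneg_eq_0_iff_AE[OF L2_integrable_square[OF assms]] by simp

lemma (in bessel_kernel) eigen_mult:
  assumes "eigen s f" shows "eigen s (\<lambda>x. c * f x)"
proof -
  have "op (\<lambda>x. c * f x) x = c * op f x" for x
    unfolding op_def coef_mult by (subst integral_mult_right_zero[symmetric]) (simp add: mult_ac)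
  then show ?thesis using assms by (auto simp: eigen_def L2_mult_left)
qed

lemma (in bessel_kernel) eigen_normalize:
  assumes "eigen s f" "sqnorm M f \<noteq> 0"
  obtains c where "eigen s (\<lambda>x. c * f x)" "ip M (\<lambda>x. c * f x) (\<lambda>x. c * f x) = 1"
proof
  show "eigen s (\<lambda>x. complex_of_real (1 / sqrt (sqnorm M f)) * f x)" by (rule eigen_mult[OF assms(1)])
  have "0 < sqnorm M f" using assms(2) sqnorm_nonneg[of M f] by linarith
  then show "ip M (\<lambda>x. complex_of_real (1 / sqrt (sqnorm M f)) * f x) (\<lambda>x. complex_of_real (1 / sqrt (sqnorm M f)) * f x) = 1"
    unfolding ip_self sqnorm_mult by (simp add: norm_divide power_divide)
qed

text \<open>\<open>eig_count\<close> is a sum over a set of reals of suprema of sets of naturals,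
  and both are meaningful only when finite. Finiteness comes from the trace; then maximal families
  in the eigenspaces combine to a family that no eigenfunction with eigenvalue at least \<epsilon>
  can extend. Almost everywhere agreement of K with \<open>op\<close> suffices, since eigenspaces
  see no more.\<close>

lemma eig_count_near_trace:
  fixes S :: "(real^'n) set" and N :: "'b::euclidean_space measure"
  assumes "bessel_kernel lebesgue N S e"
    and K: "\<And>f. L2 lebesgue f \<Longrightarrow> AE x in lebesgue. K f x = bessel_kernel.op lebesgue N e f x"
    and \<epsilon>: "0 < \<epsilon>" "\<epsilon> < 1"
  shows "\<bar>real (eig_count K \<epsilon>) - bessel_kernel.trace lebesgue N e\<bar> \<le>
    (1 / \<epsilon> + 1 / (1 - \<epsilon>)) * (bessel_kernel.trace lebesgue N e - bessel_kernel.trace_sq lebesgue N e)"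
proof -
  interpret bessel_kernel lebesgue N S e by fact
  have eigenspace: "eigenspace_L2 K lam = {f. eigen lam f}" for lam
  proof -
    have "(AE x in lebesgue. K f x = complex_of_real lam * f x) \<longleftrightarrow>
       (AE x in lebesgue. op f x = complex_of_real lam * f x)" if "L2 lebesgue f" for f
      using K[OF that] by (intro iffI; elim AE_mp) (auto elim!: AE_mp)
    then show ?thesis
      unfolding eigenspace_L2_def eigen_def sq_integrable_eq_L2 by blast
  qed
  define \<Lambda> where "\<Lambda> = {lam. \<epsilon> \<le> lam \<and> is_eigenvalue_L2 K lam}"
  \<comment> \<open>Each member contributes at least \<epsilon> to a sum of eigenvalues that is at
    most the trace. Used for a single eigenspace and for unit vectors of distinct
    eigenvalues.\<close>
  have card_le: "card I \<le> nat \<lfloor>trace / \<epsilon>\<rfloor>"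
    if "finite I" "\<And>i. i \<in> I \<Longrightarrow> eigen (\<mu> i) (\<phi> i)" "\<And>i. i \<in> I \<Longrightarrow> \<epsilon> \<le> \<mu> i"
      "\<And>i j. i \<in> I \<Longrightarrow> j \<in> I \<Longrightarrow> ip lebesgue (\<phi> i) (\<phi> j) = (if i = j then 1 else 0)"
    for I :: "'c set" and \<mu> \<phi>
  proof -
    have "real (card I) * \<epsilon> \<le> (\<Sum>i\<in>I. \<mu> i)"
      using sum_mono[of I "\<lambda>_. \<epsilon>" \<mu>] that(3) by simp
    also have "\<dots> \<le> trace"
      by (rule sum_eigenvalues_le_trace[OF that(1,2,4)])
    finally have "real (card I) \<le> trace / \<epsilon>" using \<epsilon> by (simp add: field_simps)
    then show ?thesis by (simp add: le_nat_iff le_floor_iff)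
  qed
  define C where "C lam = {card F | F. finite F \<and> F \<subseteq> eigenspace_L2 K lam \<and> l2_orthonormal F}" for lam
  have C_le: "n \<le> nat \<lfloor>trace / \<epsilon>\<rfloor>" if n: "n \<in> C lam" and lam: "\<epsilon> \<le> lam" for n lam
  proof -
    obtain F where F: "n = card F" "finite F" "F \<subseteq> eigenspace_L2 K lam" "l2_orthonormal F"
      using n by (auto simp: C_def)
    show ?thesis
      unfolding F(1) using F lam
      by (intro card_le[of F "\<lambda>_. lam" "\<lambda>f. f"]) (auto simp: eigenspace l2_orthonormal_def l2_inner_eq_ip)
  qed
  have C0: "0 \<in> C lam" for lam
    unfolding C_def by (rule CollectI, rule exI[of _ "{}"]) (simp add: l2_orthonormal_def)
  have Cfin: "finite (C lam)" if "\<epsilon> \<le> lam" for lam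
    using C_le[OF _ that] by (intro finite_subset[of "C lam" "{..nat \<lfloor>trace / \<epsilon>\<rfloor>}"]) auto
  \<comment> \<open>\<open>Sup\<close> of a nonempty set of naturals is its \<open>Max\<close>; the
    empty family puts 0 into the set. That the maximum is attained rests on
    \<open>Cfin\<close>.\<close>
  have mult_max: "multiplicity_L2 K lam = Max (C lam)" for lam
    using C0[of lam] by (auto simp: multiplicity_L2_def C_def Sup_nat_def)
  have "\<exists>F. finite F \<and> F \<subseteq> eigenspace_L2 K lam \<and> l2_orthonormal F \<and> card F = multiplicity_L2 K lam" if "\<epsilon> \<le> lam" for lam
  proof -
    have "Max (C lam) \<in> C lam" using Max_in[OF Cfin[OF that]] C0[of lam] by blast
    then show ?thesis unfolding mult_max by (auto simp: C_def)
  qed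
  then obtain B where B: "finite (B lam)" "B lam \<subseteq> eigenspace_L2 K lam" "l2_orthonormal (B lam)"
      "card (B lam) = multiplicity_L2 K lam" if "\<epsilon> \<le> lam" for lam
    by metis
  have "\<exists>f. eigen lam f \<and> ip lebesgue f f = 1" if lam: "lam \<in> \<Lambda>" for lam
  proof -
    obtain f where "eigen lam f" "\<not> (AE x in lebesgue. f x = 0)"
      using lam by (auto simp: \<Lambda>_def is_eigenvalue_L2_def eigenspace)
    then have "sqnorm lebesgue f \<noteq> 0" using sqnorm_eq_0_iff eigen_L2 by blast
    with \<open>eigen lam f\<close> show ?thesis by (blast intro: eigen_normalize)
  qed
  then obtain u where u: "eigen lam (u lam)" "ip lebesgue (u lam) (u lam) = 1" if "lam \<in> \<Lambda>" for lam
    by metis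
  have \<Lambda>_fin: "finite \<Lambda>"
  proof (rule ccontr)
    assume "infinite \<Lambda>"
    then obtain I where I: "finite I" "card I = Suc (nat \<lfloor>trace / \<epsilon>\<rfloor>)" "I \<subseteq> \<Lambda>"
      using infinite_arbitrarily_large by blast
    have "card I \<le> nat \<lfloor>trace / \<epsilon>\<rfloor>"
      using I u by (intro card_le[of I "\<lambda>s. s" u]) (auto simp: \<Lambda>_def intro: eigen_orthogonal)
    then show False using I(2) by simp
  qed
  \<comment> \<open>Indexing by pairs of eigenvalue and eigenfunction makes the cardinality the sum
    of the multiplicities.\<close>
  define I where "I = Sigma \<Lambda> B"
  have I: "\<epsilon> \<le> fst i" "fst i \<in> \<Lambda>" "snd i \<in> B (fst i)" "eigen (fst i) (snd i)" if "i \<in> I" for i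
    using that B(2)[of "fst i"] by (auto simp: I_def \<Lambda>_def eigenspace)
  have "card I = (\<Sum>lam\<in>\<Lambda>. card (B lam))"
    unfolding I_def by (rule card_SigmaI[OF \<Lambda>_fin]) (auto simp: \<Lambda>_def intro: B)
  also have "\<dots> = eig_count K \<epsilon>"
    unfolding eig_count_def \<Lambda>_def by (intro sum.cong) (auto intro: B)
  finally have card_I: "card I = eig_count K \<epsilon>" .
  have "\<bar>real (card I) - trace\<bar> \<le> (1 / \<epsilon> + 1 / (1 - \<epsilon>)) * (trace - trace_sq)"
  proof (rule card_eigenfunctions_near_trace[where \<mu> = fst and \<phi> = snd])
    show "finite I" unfolding I_def by (intro finite_SigmaI \<Lambda>_fin B) (auto simp: \<Lambda>_def)
    show "ip lebesgue (snd i) (snd j) = (if i = j then 1 else 0)" if ij: "i \<in> I" "j \<in> I" for i j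
    proof (cases "fst i = fst j")
      case True
      then show ?thesis
        using I(1,3)[OF ij(1)] I(1,3)[OF ij(2)] B(3)[of "fst i"]
        by (auto simp: l2_orthonormal_def l2_inner_eq_ip prod_eq_iff)
    next
      case False
      then show ?thesis using eigen_orthogonal[OF I(4)[OF ij(1)] I(4)[OF ij(2)]] by auto
    qed
    show "sqnorm lebesgue f = 0" if s: "\<epsilon> \<le> s" and f: "eigen s f" and orth: "\<And>i. i \<in> I \<Longrightarrow> ip lebesgue f (snd i) = 0" for s f
    proof (rule ccontr)
      assume f0: "sqnorm lebesgue f \<noteq> 0"
      then have s\<Lambda>: "s \<in> \<Lambda>"
        using s f sqnorm_eq_0_iff[OF eigen_L2[OF f]] by (auto simp: \<Lambda>_def is_eigenvalue_L2_def eigenspace)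
      \<comment> \<open>Normalising f would give a unit vector orthogonal to the family
        \<open>B s\<close>, and adding it would exceed the multiplicity of s.\<close>
      obtain c where c: "eigen s (\<lambda>x. c * f x)" "ip lebesgue (\<lambda>x. c * f x) (\<lambda>x. c * f x) = 1"
        using eigen_normalize[OF f f0] by blast
      define h where "h = (\<lambda>x. c * f x)"
      have hB: "ip lebesgue h b = 0" if "b \<in> B s" for b
        using orth[of "(s, b)"] that s\<Lambda> by (simp add: h_def ip_mult_left I_def)
      then have Bh: "ip lebesgue b h = 0" if "b \<in> B s" for b
        using that ip_commute[of lebesgue b h] by simp
      have hh: "ip lebesgue h h = 1" using c(2) by (simp add: h_def)
      have notin: "h \<notin> B s" using hB hh by auto
      have "l2_orthonormal (insert h (B s))"
        using B(3)[OF s] hB Bh hh notin by (auto simp: l2_orthonormal_def l2_inner_eq_ip)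
      moreover have "insert h (B s) \<subseteq> eigenspace_L2 K s"
        using B(2)[OF s] c(1) by (simp add: eigenspace h_def)
      ultimately have "card (insert h (B s)) \<in> C s"
        using B(1)[OF s] by (auto simp: C_def)
      then have "card (insert h (B s)) \<le> multiplicity_L2 K s"
        unfolding mult_max by (rule Max_ge[OF Cfin[OF s]])
      then show False using B(1,4)[OF s] notin by simp
    qed
  qed (use I \<epsilon> in auto)
  then show ?thesis by (simp add: card_I)
qed

section \<open>The Gaussian and Plancherel's theorem\<close>

lemma integral_lborel_prod:
  fixes f :: "'a::euclidean_space \<Rightarrow> real \<Rightarrow> 'b::{real_normed_field,banach,second_countable_topology}"
  assumes f: "\<And>b. b \<in> Basis \<Longrightarrow> integrable lborel (f b)"
  shows "(LINT x|lborel. (\<Prod>b\<in>Basis. f b (x \<bullet> b))) = (\<Prod>b\<in>Basis. LINT y|lborel. f b y)"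
    and "integrable lborel (\<lambda>x. \<Prod>b\<in>Basis. f b (x \<bullet> b))"
proof -
  interpret product_sigma_finite "\<lambda>_::'a. lborel :: real measure" ..
  have [measurable]: "b \<in> Basis \<Longrightarrow> f b \<in> borel_measurable borel" for b
    using borel_measurable_integrable[OF f] by simp
  have [measurable]: "(\<lambda>g. \<Sum>b\<in>Basis. g b *\<^sub>R b) \<in> (\<Pi>\<^sub>M b\<in>(Basis::'a set). lborel) \<rightarrow>\<^sub>M borel"
    by measurable
  show "(LINT x|lborel. (\<Prod>b\<in>Basis. f b (x \<bullet> b))) = (\<Prod>b\<in>Basis. LINT y|lborel. f b y)"
    by (subst lborel_eq, subst integral_distr) (simp_all add: product_integral_prod f)
  show "integrable lborel (\<lambda>x. \<Prod>b\<in>Basis. f b (x \<bullet> b))"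
    using product_integrable_prod[OF finite_Basis f]
    by (subst lborel_eq, subst integrable_distr_eq) (auto cong: prod.cong)
qed

text \<open>The characteristic function of the standard normal distribution at -z, freed of the
  normalising factor of the density.\<close>

lemma fourier_std_gaussian_real:
  "(LINT y|lborel. exp (- (\<i> * complex_of_real (y * z))) * complex_of_real (exp (- (y\<^sup>2) / 2))) =
     complex_of_real (sqrt (2 * pi) * exp (- (z\<^sup>2) / 2))"
proof -
  have "complex_of_real (exp (- (z\<^sup>2) / 2)) = (LINT y|std_normal_distribution. iexp (- z * y))"
    using fun_cong[OF char_std_normal_distribution, of "- z"] by (simp add: char_def)
  also have "\<dots> = (LINT y|lborel. std_normal_density y *\<^sub>R iexp (- z * y))"
    by (rule integral_density) (auto simp: normal_density_nonneg)
  also have "\<dots> = (LINT y|lborel. complex_of_real (1 / sqrt (2 * pi)) *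
      (exp (- (\<i> * complex_of_real (y * z))) * complex_of_real (exp (- (y\<^sup>2) / 2))))"
    by (intro Bochner_Integration.integral_cong) (auto simp: std_normal_density_def scaleR_conv_of_real mult_ac)
  finally show ?thesis by (simp add: field_simps flip: of_real_mult)
qed

lemma integrable_gaussian_real:
  assumes "\<delta> > 0"
  shows "integrable lborel (\<lambda>y. exp (- (\<delta>\<^sup>2 * y\<^sup>2) / 2) :: real)"
proof -
  have "integrable lborel (\<lambda>y. sqrt (2 * pi) * std_normal_density (0 + \<delta> * y))"
    using assms by (intro integrable_mult_right lborel_integrable_real_affine) auto
  then show ?thesis by (simp add: std_normal_density_def power_mult_distrib)
qed

lemma fourier_gaussian_real:
  assumes "\<delta> > 0"
  shows "(LINT y|lborel. exp (- (\<i> * complex_of_real (y * z))) * complex_of_real (exp (- (\<delta>\<^sup>2 * y\<^sup>2) / 2))) =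
     complex_of_real (sqrt (2 * pi) / \<delta> * exp (- ((1 / \<delta>)\<^sup>2 * z\<^sup>2) / 2))"
  using assms fourier_std_gaussian_real[of "z / \<delta>"]
  by (subst lborel_integral_real_affine[of "1 / \<delta>" _ 0])
     (simp_all add: power_divide power_mult_distrib scaleR_conv_of_real)

definition gauss :: "real \<Rightarrow> 'a::euclidean_space \<Rightarrow> real" where
  "gauss \<delta> u = exp (- (\<delta>\<^sup>2 * (norm u)\<^sup>2) / 2)"

lemma gauss_prod: "gauss \<delta> u = (\<Prod>b\<in>Basis. exp (- (\<delta>\<^sup>2 * (u \<bullet> b)\<^sup>2) / 2))"
proof -
  have "(norm u)\<^sup>2 = (\<Sum>b\<in>Basis. (u \<bullet> b)\<^sup>2)"
    unfolding power2_norm_eq_inner by (subst euclidean_inner) (simp add: power2_eq_square)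
  then show ?thesis
    by (simp add: gauss_def exp_sum[symmetric] sum_distrib_left sum_negf sum_divide_distrib)
qed

lemma gauss_measurable [measurable]: "gauss \<delta> \<in> borel_measurable borel"
  unfolding gauss_def[abs_def] by measurable

lemma gauss_pos [simp]: "0 < gauss \<delta> u" "0 \<le> gauss \<delta> u"
  by (simp_all add: gauss_def)

lemma gauss_le_1: "gauss \<delta> u \<le> 1"
  by (simp add: gauss_def)

lemma integrable_gauss:
  "\<delta> > 0 \<Longrightarrow> integrable lborel (gauss \<delta> :: 'a::euclidean_space \<Rightarrow> real)"
  unfolding gauss_prod[abs_def] by (intro integral_lborel_prod(2) integrable_gaussian_real)

text \<open>The Fourier transform of \<open>gauss\<close> \<delta> in closed form: an approximate
  identity as \<delta> tends to 0, with total mass (2 pi)^DIM instead of 1.\<close>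

definition gauss_ft :: "real \<Rightarrow> 'a::euclidean_space \<Rightarrow> real" where
  "gauss_ft \<delta> z = (sqrt (2 * pi) / \<delta>) ^ DIM('a) * gauss (1 / \<delta>) z"

lemma fourier_gauss:
  fixes z :: "'a::euclidean_space"
  assumes "\<delta> > 0"
  shows "(LINT u|lborel. exp (- (\<i> * complex_of_real (u \<bullet> z))) * complex_of_real (gauss \<delta> u)) =
     complex_of_real (gauss_ft \<delta> z)"
proof -
  define f where "f b y = exp (- (\<i> * complex_of_real (y * (z \<bullet> b)))) * complex_of_real (exp (- (\<delta>\<^sup>2 * y\<^sup>2) / 2))"
    for b :: 'a and y
  have [measurable]: "f b \<in> borel_measurable borel" for b
    unfolding f_def by measurable
  have f: "integrable lborel (f b)" for b
    by (rule Bochner_Integration.integrable_bound[OF integrable_gaussian_real[OF assms]])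
       (auto simp: f_def norm_mult)
  have eq: "exp (- (\<i> * complex_of_real (u \<bullet> z))) * complex_of_real (gauss \<delta> u) = (\<Prod>b\<in>Basis. f b (u \<bullet> b))" for u
  proof -
    have "exp (- (\<i> * complex_of_real (u \<bullet> z))) = (\<Prod>b\<in>Basis. exp (- (\<i> * complex_of_real ((u \<bullet> b) * (z \<bullet> b)))))"
      by (subst euclidean_inner) (simp add: exp_sum[symmetric] sum_distrib_left sum_negf)
    then show ?thesis by (simp add: f_def prod.distrib gauss_prod)
  qed
  have "(LINT u|lborel. (\<Prod>b\<in>Basis. f b (u \<bullet> b))) = (\<Prod>b\<in>Basis. LINT y|lborel. f b y)"
    by (rule integral_lborel_prod(1)[OF f])
  also have "\<dots> = (\<Prod>b\<in>Basis. complex_of_real (sqrt (2 * pi) / \<delta> * exp (- ((1 / \<delta>)\<^sup>2 * (z \<bullet> b)\<^sup>2) / 2)))"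
    unfolding f_def fourier_gaussian_real[OF assms] ..
  also have "\<dots> = complex_of_real (gauss_ft \<delta> z)"
    unfolding gauss_ft_def gauss_prod of_real_prod[symmetric] of_real_eq_iff prod.distrib prod_constant ..
  finally show ?thesis unfolding eq .
qed

lemma gauss_ft_measurable [measurable]: "gauss_ft \<delta> \<in> borel_measurable borel"
  unfolding gauss_ft_def[abs_def] by measurable

lemma gauss_ft_nonneg: "\<delta> > 0 \<Longrightarrow> 0 \<le> gauss_ft \<delta> z"
  by (simp add: gauss_ft_def)

lemma integrable_gauss_ft: "\<delta> > 0 \<Longrightarrow> integrable lborel (gauss_ft \<delta>)"
  unfolding gauss_ft_def[abs_def] by (intro integrable_mult_right integrable_gauss) simp

text \<open>Up to a factor, \<open>gauss_ft\<close> \<delta> is \<open>gauss (1 /\<close>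
  \<delta>\<open>)\<close>, whose integral is its Fourier transform at 0. The powers of \<delta>
  cancel.\<close>

lemma integral_gauss_ft:
  assumes "\<delta> > 0"
  shows "(LINT z|lborel. gauss_ft \<delta> (z::'a::euclidean_space)) = (2 * pi) ^ DIM('a)"
proof -
  have "complex_of_real (LINT z|lborel. gauss (1 / \<delta>) (z::'a)) = complex_of_real (gauss_ft (1 / \<delta>) (0::'a))"
    using fourier_gauss[of "1 / \<delta>" "0::'a"] assms by simp
  then have "(LINT z|lborel. gauss (1 / \<delta>) (z::'a)) = (sqrt (2 * pi) * \<delta>) ^ DIM('a)"
    unfolding of_real_eq_iff by (simp add: gauss_ft_def gauss_def[of _ 0])
  then have "(LINT z|lborel. gauss_ft \<delta> (z::'a)) = ((sqrt (2 * pi) / \<delta>) * (sqrt (2 * pi) * \<delta>)) ^ DIM('a)"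
    unfolding gauss_ft_def power_mult_distrib by simp
  also have "(sqrt (2 * pi) / \<delta>) * (sqrt (2 * pi) * \<delta>) = 2 * pi"
    using assms by simp
  finally show ?thesis .
qed

lemma nn_integral_gauss_ft:
  assumes "\<delta> > 0"
  shows "(\<integral>\<^sup>+ z. ennreal (gauss_ft \<delta> (z::'a::euclidean_space)) \<partial>lborel) = ennreal ((2 * pi) ^ DIM('a))"
  unfolding integral_gauss_ft[OF assms, where 'a = 'a, symmetric]
  by (rule nn_integral_eq_integral[OF integrable_gauss_ft[OF assms]]) (simp add: gauss_ft_nonneg assms)

text \<open>The formula of \<open>fourier\<close> over the Borel version of Lebesgue measure, where
  product measurability and Fubini are available. The two are matched by
  \<open>integral_completion\<close>.\<close>

definition ft :: "('a::euclidean_space \<Rightarrow> complex) \<Rightarrow> 'a \<Rightarrow> complex" where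
  "ft f u = (LINT x|lborel. f x * exp (- (\<i> * complex_of_real (x \<bullet> u))))"

lemma ft_measurable [measurable]:
  assumes [measurable]: "f \<in> borel_measurable borel"
  shows "ft f \<in> borel_measurable borel"
  unfolding ft_def[abs_def] by measurable

lemma cmod_ft_le:
  assumes "integrable lborel f"
  shows "cmod (ft f u) \<le> (LINT x|lborel. cmod (f x))"
  unfolding ft_def using integral_norm_bound[of lborel "\<lambda>x. f x * exp (- (\<i> * complex_of_real (x \<bullet> u)))"]
  by (simp add: norm_mult)

lemma (in pair_sigma_finite) integrable_mult_bound:
  fixes f :: "'a \<Rightarrow> 'b \<Rightarrow> complex"
  assumes [measurable]: "(\<lambda>p. f (fst p) (snd p)) \<in> borel_measurable (M1 \<Otimes>\<^sub>M M2)"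
    and a: "integrable M1 a" and b: "integrable M2 b"
    and le: "\<And>x y. cmod (f x y) \<le> a x * b y"
  shows "integrable (M1 \<Otimes>\<^sub>M M2) (\<lambda>p. f (fst p) (snd p))"
proof (rule Fubini_integrable)
  have int: "integrable M2 (\<lambda>y. f x y)" if "x \<in> space M1" for x
  proof (rule Bochner_Integration.integrable_bound)
    show "integrable M2 (\<lambda>y. a x * b y)" using b by simp
    show "AE y in M2. norm (f x y) \<le> norm (a x * b y)"
      using le by (intro always_eventually allI) (metis abs_ge_self order_trans real_norm_def)
    show "f x \<in> borel_measurable M2"
      using measurable_compose[OF measurable_Pair1'[OF that] assms(1)] by simp
  qed
  show "integrable M1 (\<lambda>x. LINT y|M2. norm (f (fst (x, y)) (snd (x, y))))"
  proof (rule Bochner_Integration.integrable_bound)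
    show "integrable M1 (\<lambda>x. a x * (LINT y|M2. b y))" using a by simp
    show "AE x in M1. norm (LINT y|M2. norm (f (fst (x, y)) (snd (x, y)))) \<le> norm (a x * (LINT y|M2. b y))"
    proof (rule AE_I2)
      fix x assume x: "x \<in> space M1"
      have "(LINT y|M2. norm (f x y)) \<le> (LINT y|M2. a x * b y)"
        using le by (intro integral_mono integrable_norm int x integrable_mult_right b) auto
      then show "norm (LINT y|M2. norm (f (fst (x, y)) (snd (x, y)))) \<le> norm (a x * (LINT y|M2. b y))"
        by (simp add: abs_le_iff)
    qed
  qed measurable
  show "AE x in M1. integrable M2 (\<lambda>y. f (fst (x, y)) (snd (x, y)))"
    using int by auto
qed (use assms in measurable)

text \<open>The Gaussian weight makes the integral over u absolutely convergent, so the squared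
  modulus may be expanded and Fubini applied for every integrable h. Integrating u out turns the
  weight into the convolution kernel \<open>gauss_ft\<close>.\<close>

lemma ft_gauss_identity:
  fixes h :: "'a::euclidean_space \<Rightarrow> complex"
  assumes h: "integrable lborel h" and \<delta>: "\<delta> > 0"
  shows "(LINT u|lborel. complex_of_real (gauss \<delta> u * (cmod (ft h u))\<^sup>2)) =
    (LINT x|lborel. h x * cnj (LINT y|lborel. h y * complex_of_real (gauss_ft \<delta> (y - x))))"
proof -
  have [measurable]: "h \<in> borel_measurable borel"
    using borel_measurable_integrable[OF h] by simp
  define C where "C = (LINT x|lborel. cmod (h x))"
  have ftC: "cmod (ft h u) \<le> C" for u unfolding C_def by (rule cmod_ft_le[OF h])
  have C0: "0 \<le> C" by (simp add: C_def)
  have inner: "(LINT u|lborel. complex_of_real (gauss \<delta> u) * ft h u * exp (\<i> * complex_of_real (x \<bullet> u))) =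
      (LINT y|lborel. h y * complex_of_real (gauss_ft \<delta> (y - x)))" for x
  proof -
    define k where "k u y = complex_of_real (gauss \<delta> u) * h y * exp (- (\<i> * complex_of_real (u \<bullet> (y - x))))" for u y
    have "integrable (lborel \<Otimes>\<^sub>M lborel) (\<lambda>p. k (fst p) (snd p))"
    proof (rule lborel_pair.integrable_mult_bound)
      show "integrable lborel (gauss \<delta> :: 'a \<Rightarrow> real)" by (rule integrable_gauss[OF \<delta>])
      show "integrable lborel (\<lambda>y. cmod (h y))" using h by simp
      show "cmod (k u y) \<le> gauss \<delta> u * cmod (h y)" for u y by (simp add: k_def norm_mult)
    qed (unfold k_def, measurable)
    then have "(LINT y|lborel. LINT u|lborel. k u y) = (LINT u|lborel. LINT y|lborel. k u y)"
      by (intro lborel_pair.Fubini_integral) (simp add: split_beta')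
    moreover have "(LINT u|lborel. k u y) = h y * complex_of_real (gauss_ft \<delta> (y - x))" for y
      unfolding fourier_gauss[OF \<delta>, symmetric] k_def
      by (subst integral_mult_right_zero[symmetric]) (simp add: mult_ac)
    moreover have "(LINT y|lborel. k u y) = complex_of_real (gauss \<delta> u) * ft h u * exp (\<i> * complex_of_real (x \<bullet> u))" for u
    proof -
      have "k u y = (complex_of_real (gauss \<delta> u) * exp (\<i> * complex_of_real (x \<bullet> u))) * (h y * exp (- (\<i> * complex_of_real (y \<bullet> u))))" for y
        by (simp add: k_def inner_diff_right inner_commute algebra_simps flip: exp_add)
      then have "(LINT y|lborel. k u y) = (complex_of_real (gauss \<delta> u) * exp (\<i> * complex_of_real (x \<bullet> u))) * ft h u"
        by (simp add: ft_def)
      then show ?thesis by (simp add: mult_ac)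
    qed
    ultimately show ?thesis by simp
  qed
  define k where "k u x = complex_of_real (gauss \<delta> u) * cnj (ft h u) * (h x * exp (- (\<i> * complex_of_real (x \<bullet> u))))" for u x
  have "integrable (lborel \<Otimes>\<^sub>M lborel) (\<lambda>p. k (fst p) (snd p))"
  proof (rule lborel_pair.integrable_mult_bound)
    show "integrable lborel (\<lambda>u::'a. C * gauss \<delta> u)" by (intro integrable_mult_right integrable_gauss \<delta>)
    show "integrable lborel (\<lambda>y. cmod (h y))" using h by simp
    show "cmod (k u y) \<le> C * gauss \<delta> u * cmod (h y)" for u y
      using ftC[of u] by (simp add: k_def norm_mult mult.commute mult_left_mono mult_right_mono)
  qed (unfold k_def, measurable)
  then have "(LINT x|lborel. LINT u|lborel. k u x) = (LINT u|lborel. LINT x|lborel. k u x)"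
    by (intro lborel_pair.Fubini_integral) (simp add: split_beta')
  moreover have "(LINT x|lborel. k u x) = complex_of_real (gauss \<delta> u * (cmod (ft h u))\<^sup>2)" for u
  proof -
    have "(LINT x|lborel. k u x) = complex_of_real (gauss \<delta> u) * cnj (ft h u) * ft h u"
      by (simp add: k_def ft_def)
    then show ?thesis using complex_norm_square[of "ft h u"] by (simp add: mult_ac)
  qed
  moreover have "(LINT u|lborel. k u x) = h x * cnj (LINT y|lborel. h y * complex_of_real (gauss_ft \<delta> (y - x)))" for x
    unfolding inner[symmetric] Bochner_Integration.integral_cnj[symmetric] k_def
    by (subst integral_mult_right_zero[symmetric]) (simp add: mult_ac exp_cnj)
  ultimately show ?thesis by simp
qed

text \<open>For a non-integrable f the Bochner integral is 0 by convention, so the bound is trivial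
  there.\<close>

lemma norm_integral_le_nn_integral:
  fixes f :: "'a \<Rightarrow> complex"
  shows "ennreal (norm (LINT x|M. f x)) \<le> (\<integral>\<^sup>+ x. ennreal (norm (f x)) \<partial>M)"
  by (cases "integrable M f") (auto simp: integral_norm_bound_ennreal not_integrable_integral_eq)

lemma nn_integral_lborel_shift:
  fixes f :: "'a::euclidean_space \<Rightarrow> ennreal"
  assumes [measurable]: "f \<in> borel_measurable borel"
  shows "(\<integral>\<^sup>+ y. f (y - x) \<partial>lborel) = (\<integral>\<^sup>+ y. f y \<partial>lborel)"
proof -
  have "(\<integral>\<^sup>+ y. f y \<partial>lborel) = (\<integral>\<^sup>+ y. f y \<partial>distr lborel borel ((+) (- x)))"
    by (simp add: lborel_distr_plus)
  also have "\<dots> = (\<integral>\<^sup>+ y. f (y - x) \<partial>lborel)"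
    by (subst nn_integral_distr) auto
  finally show ?thesis by simp
qed

lemma gauss_ft_commute: "gauss_ft \<delta> (y - x) = gauss_ft \<delta> (x - y)"
  by (simp add: gauss_ft_def gauss_def norm_minus_commute)

lemma nn_integral_gauss_ft_shift:
  assumes "\<delta> > 0"
  shows "(\<integral>\<^sup>+ y. ennreal (gauss_ft \<delta> (y - x :: 'a::euclidean_space)) \<partial>lborel) = ennreal ((2 * pi) ^ DIM('a))"
  using nn_integral_lborel_shift[of "\<lambda>z. ennreal (gauss_ft \<delta> z)" x] nn_integral_gauss_ft[OF assms, where 'a = 'a]
  by simp

lemma integrable_gauss_ft_square:
  fixes h :: "'a::euclidean_space \<Rightarrow> complex"
  assumes h: "integrable lborel h" and \<delta>: "\<delta> > 0"
  shows "integrable lborel (\<lambda>u. gauss \<delta> u * (cmod (ft h u))\<^sup>2)"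
proof (rule Bochner_Integration.integrable_bound)
  have [measurable]: "h \<in> borel_measurable borel"
    using borel_measurable_integrable[OF h] by simp
  define C where "C = (LINT x|lborel. cmod (h x))"
  show "integrable lborel (\<lambda>u::'a. gauss \<delta> u * C\<^sup>2)"
    by (intro integrable_mult_left integrable_gauss \<delta>)
  show "(\<lambda>u. gauss \<delta> u * (cmod (ft h u))\<^sup>2) \<in> borel_measurable lborel" by measurable
  have "(cmod (ft h u))\<^sup>2 \<le> C\<^sup>2" for u
    unfolding C_def by (intro power_mono cmod_ft_le[OF h]) simp
  then show "AE u in lborel. norm (gauss \<delta> u * (cmod (ft h u))\<^sup>2) \<le> norm (gauss \<delta> u * C\<^sup>2)"
    by (auto intro!: mult_left_mono)
qed

text \<open>Schur's test: the kernel in \<open>ft_gauss_identity\<close> is nonnegative and has mass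
  (2 pi)^DIM in each variable, and |h x| |h y| is at most half the sum of the squares. Extended
  nonnegative integrals cover the case of an infinite right-hand side.\<close>

lemma plancherel_gauss_le:
  fixes h :: "'a::euclidean_space \<Rightarrow> complex"
  assumes h: "integrable lborel h" and \<delta>: "\<delta> > 0"
  shows "(\<integral>\<^sup>+ u. ennreal (gauss \<delta> u * (cmod (ft h u))\<^sup>2) \<partial>lborel) \<le>
    ennreal ((2 * pi) ^ DIM('a)) * (\<integral>\<^sup>+ x. ennreal ((cmod (h x))\<^sup>2) \<partial>lborel)"
proof -
  have [measurable]: "h \<in> borel_measurable borel"
    using borel_measurable_integrable[OF h] by simp
  define c where "c = ennreal ((2 * pi) ^ DIM('a))"
  define n where "n = (\<integral>\<^sup>+ x. ennreal ((cmod (h x))\<^sup>2) \<partial>lborel)"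
  define G where "G = (gauss_ft \<delta> :: 'a \<Rightarrow> real)"
  have [measurable]: "G \<in> borel_measurable borel" by (simp add: G_def)
  have G0: "0 \<le> G z" for z by (simp add: G_def gauss_ft_nonneg \<delta>)
  have Gx: "(\<integral>\<^sup>+ y. ennreal (G (y - x)) \<partial>lborel) = c" for x
    unfolding G_def c_def by (rule nn_integral_gauss_ft_shift[OF \<delta>])
  have Gy: "(\<integral>\<^sup>+ x. ennreal (G (y - x)) \<partial>lborel) = c" for y
    using Gx[of y] unfolding G_def by (subst gauss_ft_commute)
  have half: "(\<integral>\<^sup>+ x. ennreal (1/2 * (cmod (h x))\<^sup>2) * c \<partial>lborel) = ennreal (1/2) * n * c"
  proof -
    have "(\<integral>\<^sup>+ x. ennreal (1/2 * (cmod (h x))\<^sup>2) * c \<partial>lborel) =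
        (\<integral>\<^sup>+ x. ennreal (1/2) * ennreal ((cmod (h x))\<^sup>2) * c \<partial>lborel)"
      by (intro nn_integral_cong) (subst ennreal_mult'[of "1/2"], auto)
    also have "\<dots> = ennreal (1/2) * n * c"
      unfolding n_def by (subst nn_integral_multc, measurable, subst nn_integral_cmult, measurable)
    finally show ?thesis .
  qed
  have "(\<integral>\<^sup>+ u. ennreal (gauss \<delta> u * (cmod (ft h u))\<^sup>2) \<partial>lborel) =
      ennreal (LINT u|lborel. gauss \<delta> u * (cmod (ft h u))\<^sup>2)"
    by (rule nn_integral_eq_integral[OF integrable_gauss_ft_square[OF h \<delta>]]) simp
  also have "(LINT u|lborel. gauss \<delta> u * (cmod (ft h u))\<^sup>2) =
      cmod (LINT u|lborel. complex_of_real (gauss \<delta> u * (cmod (ft h u))\<^sup>2))"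
    unfolding integral_complex_of_real norm_of_real by (intro abs_of_nonneg[symmetric] Bochner_Integration.integral_nonneg) simp
  also have "\<dots> = cmod (LINT x|lborel. h x * cnj (LINT y|lborel. h y * complex_of_real (G (y - x))))"
    unfolding ft_gauss_identity[OF h \<delta>] G_def ..
  also have "ennreal \<dots> \<le> (\<integral>\<^sup>+ x. ennreal (cmod (h x * cnj (LINT y|lborel. h y * complex_of_real (G (y - x))))) \<partial>lborel)"
    by (rule norm_integral_le_nn_integral)
  also have "\<dots> \<le> (\<integral>\<^sup>+ x. \<integral>\<^sup>+ y. ennreal (1/2 * (cmod (h x))\<^sup>2 * G (y - x)) + ennreal (1/2 * (cmod (h y))\<^sup>2 * G (y - x)) \<partial>lborel \<partial>lborel)"
  proof (rule nn_integral_mono)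
    fix x
    have "ennreal (cmod (h x * cnj (LINT y|lborel. h y * complex_of_real (G (y - x))))) =
        ennreal (cmod (LINT y|lborel. h x * cnj (h y * complex_of_real (G (y - x)))))"
      by (simp only: integral_mult_right_zero Bochner_Integration.integral_cnj)
    also have "\<dots> \<le> (\<integral>\<^sup>+ y. ennreal (cmod (h x * cnj (h y * complex_of_real (G (y - x))))) \<partial>lborel)"
      by (rule norm_integral_le_nn_integral)
    also have "\<dots> \<le> (\<integral>\<^sup>+ y. ennreal (1/2 * (cmod (h x))\<^sup>2 * G (y - x)) + ennreal (1/2 * (cmod (h y))\<^sup>2 * G (y - x)) \<partial>lborel)"
    proof (rule nn_integral_mono)
      fix y
      have "cmod (h x) * cmod (h y) \<le> 1/2 * (cmod (h x))\<^sup>2 + 1/2 * (cmod (h y))\<^sup>2"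
        using sum_squares_bound[of "cmod (h x)" "cmod (h y)"] by simp
      from mult_right_mono[OF this G0[of "y - x"]]
      show "ennreal (cmod (h x * cnj (h y * complex_of_real (G (y - x))))) \<le>
          ennreal (1/2 * (cmod (h x))\<^sup>2 * G (y - x)) + ennreal (1/2 * (cmod (h y))\<^sup>2 * G (y - x))"
        using G0[of "y - x"]
        by (simp add: norm_mult abs_of_nonneg ring_distribs mult.assoc ennreal_plus[symmetric] del: ennreal_plus)
    qed
    finally show "ennreal (cmod (h x * cnj (LINT y|lborel. h y * complex_of_real (G (y - x))))) \<le>
      (\<integral>\<^sup>+ y. ennreal (1/2 * (cmod (h x))\<^sup>2 * G (y - x)) + ennreal (1/2 * (cmod (h y))\<^sup>2 * G (y - x)) \<partial>lborel)" .
  qed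
  also have "\<dots> = (\<integral>\<^sup>+ x. \<integral>\<^sup>+ y. ennreal (1/2 * (cmod (h x))\<^sup>2 * G (y - x)) \<partial>lborel \<partial>lborel) +
      (\<integral>\<^sup>+ x. \<integral>\<^sup>+ y. ennreal (1/2 * (cmod (h y))\<^sup>2 * G (y - x)) \<partial>lborel \<partial>lborel)"
    by (simp add: nn_integral_add)
  also have "(\<integral>\<^sup>+ x. \<integral>\<^sup>+ y. ennreal (1/2 * (cmod (h x))\<^sup>2 * G (y - x)) \<partial>lborel \<partial>lborel) =
      (\<integral>\<^sup>+ x. ennreal (1/2 * (cmod (h x))\<^sup>2) * c \<partial>lborel)"
    by (simp only: ennreal_mult''[OF G0]) (simp add: nn_integral_cmult Gx)
  also have "\<dots> = ennreal (1/2) * n * c"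
    by (rule half)
  also have "(\<integral>\<^sup>+ x. \<integral>\<^sup>+ y. ennreal (1/2 * (cmod (h y))\<^sup>2 * G (y - x)) \<partial>lborel \<partial>lborel) =
      (\<integral>\<^sup>+ y. \<integral>\<^sup>+ x. ennreal (1/2 * (cmod (h y))\<^sup>2 * G (y - x)) \<partial>lborel \<partial>lborel)"
    by (rule lborel_pair.Fubini'[symmetric]) measurable
  also have "\<dots> = (\<integral>\<^sup>+ x. ennreal (1/2 * (cmod (h x))\<^sup>2) * c \<partial>lborel)"
    by (simp only: ennreal_mult''[OF G0]) (simp add: nn_integral_cmult Gy)
  also have "\<dots> = ennreal (1/2) * n * c"
    by (rule half)
  also have "ennreal (1/2) * n * c + ennreal (1/2) * n * c = c * n"
  proof -
    have "ennreal (1/2) * n * c + ennreal (1/2) * n * c = (ennreal (1/2) + ennreal (1/2)) * (c * n)"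
      by (simp only: distrib_left distrib_right mult_ac)
    also have "ennreal (1/2) + ennreal (1/2) = 1"
      by (subst ennreal_plus[symmetric]) auto
    finally show ?thesis by simp
  qed
  finally show ?thesis by (simp add: c_def n_def)
qed

text \<open>The Gaussian weight tends to 1 as \<delta> tends to 0; Fatou's lemma removes it from the
  weighted bound.\<close>

lemma plancherel_le:
  fixes h :: "'a::euclidean_space \<Rightarrow> complex"
  assumes h: "integrable lborel h"
  shows "(\<integral>\<^sup>+ u. ennreal ((cmod (ft h u))\<^sup>2) \<partial>lborel) \<le>
    ennreal ((2 * pi) ^ DIM('a)) * (\<integral>\<^sup>+ x. ennreal ((cmod (h x))\<^sup>2) \<partial>lborel)" (is "_ \<le> ?C")
proof -
  have [measurable]: "h \<in> borel_measurable borel"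
    using borel_measurable_integrable[OF h] by simp
  define \<delta> where "\<delta> n = 1 / real (Suc n)" for n
  have \<delta>0: "\<delta> \<longlonglongrightarrow> 0" unfolding \<delta>_def by (rule LIMSEQ_Suc[OF lim_1_over_n])
  have lim: "liminf (\<lambda>n. ennreal (gauss (\<delta> n) u * (cmod (ft h u))\<^sup>2)) = ennreal ((cmod (ft h u))\<^sup>2)" for u
  proof -
    have "(\<lambda>n. gauss (\<delta> n) u * (cmod (ft h u))\<^sup>2) \<longlonglongrightarrow> exp (- (0\<^sup>2 * (norm u)\<^sup>2) / 2) * (cmod (ft h u))\<^sup>2"
      unfolding gauss_def by (intro tendsto_intros \<delta>0) simp
    then have "(\<lambda>n. ennreal (gauss (\<delta> n) u * (cmod (ft h u))\<^sup>2)) \<longlonglongrightarrow> ennreal ((cmod (ft h u))\<^sup>2)"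
      by (intro tendsto_ennrealI) simp
    then show ?thesis by (intro lim_imp_Liminf) auto
  qed
  have "(\<integral>\<^sup>+ u. ennreal ((cmod (ft h u))\<^sup>2) \<partial>lborel) \<le>
      liminf (\<lambda>n. \<integral>\<^sup>+ u. ennreal (gauss (\<delta> n) u * (cmod (ft h u))\<^sup>2) \<partial>lborel)"
    unfolding lim[symmetric] by (rule nn_integral_liminf) measurable
  also have "\<dots> \<le> liminf (\<lambda>n. ?C)"
    by (intro Liminf_mono always_eventually allI plancherel_gauss_le[OF h]) (simp add: \<delta>_def)
  also have "\<dots> = ?C" by (simp add: Liminf_const)
  finally show ?thesis .
qed

text \<open>A point of an open Q stays in Q under small displacements, so the integrand is
  eventually at least its limit; Fatou's lemma is applied in each variable. Used with the
  displacements \<delta> w for Plancherel's lower bound and with linear maps shrinking to 0 for the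
  trace of the square.\<close>

lemma nn_integral_translates_liminf:
  fixes Q :: "'a::euclidean_space set" and h :: "'a \<Rightarrow> ennreal"
  assumes Q: "open Q" and [measurable]: "h \<in> borel_measurable borel" "\<And>n. W n \<in> borel_measurable borel"
    and W: "\<And>w. (\<lambda>n. W n w) \<longlonglongrightarrow> 0"
  shows "emeasure lborel Q * (\<integral>\<^sup>+ w. h w \<partial>lborel) \<le>
    liminf (\<lambda>n. \<integral>\<^sup>+ u. \<integral>\<^sup>+ w. indicator Q u * indicator Q (u + W n w) * h w \<partial>lborel \<partial>lborel)"
proof -
  have [measurable]: "Q \<in> sets borel" using Q by simp
  have ptw: "indicator Q u * h w \<le> liminf (\<lambda>n. indicator Q u * indicator Q (u + W n w) * h w)" for u w
  proof (cases "u \<in> Q")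
    case True
    have "(\<lambda>n. u + W n w) \<longlonglongrightarrow> u + 0" by (intro tendsto_intros W)
    then have "\<forall>\<^sub>F n in sequentially. u + W n w \<in> Q"
      using topological_tendstoD[OF _ Q] True by simp
    then have "\<forall>\<^sub>F n in sequentially. indicator Q u * h w \<le> indicator Q u * indicator Q (u + W n w) * h w"
      by (rule eventually_mono) simp
    then show ?thesis by (rule Liminf_bounded)
  qed simp
  have "emeasure lborel Q * (\<integral>\<^sup>+ w. h w \<partial>lborel) = (\<integral>\<^sup>+ u. \<integral>\<^sup>+ w. indicator Q u * h w \<partial>lborel \<partial>lborel)"
    by (simp add: nn_integral_cmult nn_integral_multc)
  also have "\<dots> \<le> (\<integral>\<^sup>+ u. \<integral>\<^sup>+ w. liminf (\<lambda>n. indicator Q u * indicator Q (u + W n w) * h w) \<partial>lborel \<partial>lborel)"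
    by (intro nn_integral_mono ptw)
  also have "\<dots> \<le> (\<integral>\<^sup>+ u. liminf (\<lambda>n. \<integral>\<^sup>+ w. indicator Q u * indicator Q (u + W n w) * h w \<partial>lborel) \<partial>lborel)"
    by (intro nn_integral_mono nn_integral_liminf) measurable
  also have "\<dots> \<le> liminf (\<lambda>n. \<integral>\<^sup>+ u. \<integral>\<^sup>+ w. indicator Q u * indicator Q (u + W n w) * h w \<partial>lborel \<partial>lborel)"
    by (intro nn_integral_liminf) measurable
  finally show ?thesis .
qed

text \<open>Brings the convolution with a narrowing kernel into the form of a fixed kernel and
  shrinking displacements, by substituting y = x + \<delta> w.\<close>

lemma plancherel_gauss_indicator:
  fixes P :: "'a::euclidean_space set"
  assumes [measurable]: "P \<in> sets borel" and fin: "emeasure lborel P < \<infinity>" and \<delta>: "\<delta> > 0"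
  shows "(\<integral>\<^sup>+ x. \<integral>\<^sup>+ w. indicator P x * indicator P (x + \<delta> *\<^sub>R w) * ennreal (gauss_ft 1 w) \<partial>lborel \<partial>lborel) =
    (\<integral>\<^sup>+ u. ennreal (gauss \<delta> u * (cmod (ft (indicator P) u))\<^sup>2) \<partial>lborel)"
proof -
  have h: "integrable lborel (indicator P :: 'a \<Rightarrow> complex)"
    using integrable_of_real[OF integrable_real_indicator[of P lborel], where 'a = complex] fin
    by (simp add: of_real_indicator)
  define G where "G = (gauss_ft \<delta> :: 'a \<Rightarrow> real)"
  have [measurable]: "G \<in> borel_measurable borel" by (simp add: G_def)
  have G0: "0 \<le> G z" for z by (simp add: G_def gauss_ft_nonneg \<delta>)
  \<comment> \<open>The smoothed indicator. It is bounded by the mass of the kernel, which makes its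
    integral over P finite and lets Bochner and nonnegative integrals be exchanged.\<close>
  define I where "I x = (LINT y|lborel. indicator P y * G (y - x))" for x
  have [measurable]: "I \<in> borel_measurable borel" unfolding I_def[abs_def] by measurable
  have I_nn: "ennreal (I x) = (\<integral>\<^sup>+ y. ennreal (indicator P y * G (y - x)) \<partial>lborel)"
    and I_le: "I x \<le> (2 * pi) ^ DIM('a)" for x
  proof -
    have le: "(\<integral>\<^sup>+ y. ennreal (indicator P y * G (y - x)) \<partial>lborel) \<le> ennreal ((2 * pi) ^ DIM('a))"
      unfolding nn_integral_gauss_ft_shift[OF \<delta>, of x, symmetric] G_def[symmetric]
      by (intro nn_integral_mono ennreal_leI) (use G0 in \<open>auto split: split_indicator\<close>)
    have "integrable lborel (\<lambda>y. indicator P y * G (y - x))"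
      by (rule integrableI_nonneg) (use G0 le_less_trans[OF le ennreal_less_top] in auto)
    then show eq: "ennreal (I x) = (\<integral>\<^sup>+ y. ennreal (indicator P y * G (y - x)) \<partial>lborel)"
      unfolding I_def by (intro nn_integral_eq_integral[symmetric]) (auto simp: G0)
    show "I x \<le> (2 * pi) ^ DIM('a)"
      using le unfolding eq[symmetric] by (subst (asm) ennreal_le_iff) auto
  qed
  have I0: "0 \<le> I x" for x unfolding I_def by (intro Bochner_Integration.integral_nonneg) (simp add: G0)
  have PI: "integrable lborel (\<lambda>x. indicator P x * I x)"
  proof (rule Bochner_Integration.integrable_bound)
    show "integrable lborel (\<lambda>x. indicator P x * (2 * pi) ^ DIM('a) :: real)"
      using fin by (intro integrable_mult_left integrable_real_indicator) auto
    show "AE x in lborel. norm (indicator P x * I x) \<le> norm (indicator P x * (2 * pi) ^ DIM('a) :: real)"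
      using I_le I0 by (auto split: split_indicator)
  qed measurable
  have "complex_of_real (LINT u|lborel. gauss \<delta> u * (cmod (ft (indicator P) u))\<^sup>2) =
      (LINT x|lborel. indicator P x * cnj (LINT y|lborel. indicator P y * complex_of_real (G (y - x))))"
    using ft_gauss_identity[OF h \<delta>] unfolding integral_complex_of_real G_def .
  also have "(\<lambda>x. (LINT y|lborel. indicator P y * complex_of_real (G (y - x)))) = (\<lambda>x. complex_of_real (I x))"
    unfolding I_def integral_complex_of_real[symmetric] by (simp add: of_real_indicator)
  also have "(LINT x|lborel. indicator P x * cnj (complex_of_real (I x))) = complex_of_real (LINT x|lborel. indicator P x * I x)"
    unfolding integral_complex_of_real[symmetric] by (simp add: of_real_indicator)
  finally have eq: "(LINT u|lborel. gauss \<delta> u * (cmod (ft (indicator P) u))\<^sup>2) = (LINT x|lborel. indicator P x * I x)"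
    unfolding of_real_eq_iff .
  have sub: "(\<integral>\<^sup>+ w. indicator P (x + \<delta> *\<^sub>R w) * ennreal (gauss_ft 1 w) \<partial>lborel) = ennreal (I x)" for x
  proof -
    \<comment> \<open>The Jacobian of the substitution exactly cancels the scaling of the
      kernel.\<close>
    have G\<delta>: "\<delta> ^ DIM('a) * G (\<delta> *\<^sub>R w) = gauss_ft 1 w" for w
      using \<delta> by (simp add: G_def gauss_ft_def gauss_def power_divide power_mult_distrib)
    have "ennreal (I x) = (\<integral>\<^sup>+ y. ennreal (indicator P y * G (y - x)) \<partial>lborel)" by (rule I_nn)
    also have "\<dots> = ennreal (\<delta> ^ DIM('a)) * (\<integral>\<^sup>+ w. ennreal (indicator P (x + \<delta> *\<^sub>R w) * G (\<delta> *\<^sub>R w)) \<partial>lborel)"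
      using \<delta> by (subst lborel_affine[of \<delta> x])
        (simp_all add: nn_integral_density nn_integral_distr nn_integral_cmult abs_of_pos ennreal_power)
    also have "\<dots> = (\<integral>\<^sup>+ w. ennreal (\<delta> ^ DIM('a) * (indicator P (x + \<delta> *\<^sub>R w) * G (\<delta> *\<^sub>R w))) \<partial>lborel)"
      using \<delta> by (subst nn_integral_cmult[symmetric]) (auto simp: ennreal_mult')
    also have "\<dots> = (\<integral>\<^sup>+ w. indicator P (x + \<delta> *\<^sub>R w) * ennreal (gauss_ft 1 w) \<partial>lborel)"
      unfolding G\<delta>[symmetric] by (intro nn_integral_cong) (auto split: split_indicator)
    finally show ?thesis by simp
  qed
  have "(\<integral>\<^sup>+ x. \<integral>\<^sup>+ w. indicator P x * indicator P (x + \<delta> *\<^sub>R w) * ennreal (gauss_ft 1 w) \<partial>lborel \<partial>lborel) =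
      (\<integral>\<^sup>+ x. indicator P x * ennreal (I x) \<partial>lborel)"
    unfolding sub[symmetric] mult.assoc by (simp add: nn_integral_cmult)
  also have "\<dots> = (\<integral>\<^sup>+ x. ennreal (indicator P x * I x) \<partial>lborel)"
    by (intro nn_integral_cong) (auto split: split_indicator)
  also have "\<dots> = ennreal (LINT x|lborel. indicator P x * I x)"
    by (rule nn_integral_eq_integral[OF PI]) (simp add: I0)
  also have "\<dots> = (\<integral>\<^sup>+ u. ennreal (gauss \<delta> u * (cmod (ft (indicator P) u))\<^sup>2) \<partial>lborel)"
    unfolding eq[symmetric] by (rule nn_integral_eq_integral[OF integrable_gauss_ft_square[OF h \<delta>], symmetric]) simp
  finally show ?thesis .
qed

text \<open>The lower half of Plancherel's identity for an indicator: the smoothed correlations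
  recover the measure of P by Fatou's lemma, while the Gaussian weight never exceeds 1.\<close>

lemma plancherel_indicator_ge:
  fixes P :: "'a::euclidean_space set"
  assumes P: "open P" and fin: "emeasure lborel P < \<infinity>"
  shows "emeasure lborel P * ennreal ((2 * pi) ^ DIM('a)) \<le> (\<integral>\<^sup>+ u. ennreal ((cmod (ft (indicator P) u))\<^sup>2) \<partial>lborel)"
proof -
  have [measurable]: "P \<in> sets borel" using P by simp
  define \<delta> where "\<delta> n = 1 / real (Suc n)" for n
  have \<delta>0: "\<delta> \<longlonglongrightarrow> 0" unfolding \<delta>_def by (rule LIMSEQ_Suc[OF lim_1_over_n])
  let ?J = "\<integral>\<^sup>+ u. ennreal ((cmod (ft (indicator P) u))\<^sup>2) \<partial>lborel"
  have "emeasure lborel P * ennreal ((2 * pi) ^ DIM('a)) = emeasure lborel P * (\<integral>\<^sup>+ w. ennreal (gauss_ft 1 (w::'a)) \<partial>lborel)"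
    by (simp add: nn_integral_gauss_ft)
  also have "\<dots> \<le> liminf (\<lambda>n. \<integral>\<^sup>+ x. \<integral>\<^sup>+ w. indicator P x * indicator P (x + \<delta> n *\<^sub>R w) * ennreal (gauss_ft 1 w) \<partial>lborel \<partial>lborel)"
  proof (rule nn_integral_translates_liminf[OF P])
    fix w :: 'a
    show "(\<lambda>n. \<delta> n *\<^sub>R w) \<longlonglongrightarrow> 0" using tendsto_scaleR[OF \<delta>0 tendsto_const, of w] by simp
  qed measurable
  also have "\<dots> = liminf (\<lambda>n. \<integral>\<^sup>+ u. ennreal (gauss (\<delta> n) u * (cmod (ft (indicator P) u))\<^sup>2) \<partial>lborel)"
    by (simp only: plancherel_gauss_indicator[OF \<open>P \<in> sets borel\<close> fin] \<delta>_def of_nat_0_less_iff zero_less_Suc zero_less_divide_1_iff)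
  also have "\<dots> \<le> liminf (\<lambda>n. ?J)"
    by (intro Liminf_mono always_eventually allI nn_integral_mono ennreal_leI)
       (simp add: gauss_le_1 mult_left_le_one_le)
  also have "\<dots> = ?J" by (simp add: Liminf_const)
  finally show ?thesis .
qed

section \<open>Linear substitution\<close>

text \<open>Lebesgue measure is determined by its values on boxes. The image measure under the
  inverse of f, divided by k, has the right values, so it is Lebesgue measure.\<close>

lemma nn_integral_linear_of_image_measure:
  fixes f :: "'a::euclidean_space \<Rightarrow> 'a"
  assumes f: "linear f" "inj f" and k: "0 < k"
    and im: "\<And>a b. measure lebesgue (f ` cbox a b) = k * measure lebesgue (cbox a b)"
    and [measurable]: "g \<in> borel_measurable borel"
  shows "(\<integral>\<^sup>+ x. g x \<partial>lborel) = ennreal k * (\<integral>\<^sup>+ x. g (f x) \<partial>lborel)"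
proof -
  have surj: "surj f" using f by (simp add: linear_injective_imp_surjective)
  define W where "W = inv f"
  have Wf: "W (f x) = x" and fW: "f (W x) = x" for x
    using f(2) surj by (auto simp: W_def surj_f_inv_f)
  have "linear W" unfolding W_def by (rule inj_linear_imp_inv_linear[OF f(1) f(2)])
  then have [measurable]: "W \<in> borel_measurable borel" "f \<in> borel_measurable borel"
    using f(1) by (auto intro!: borel_measurable_continuous_onI linear_continuous_on linear_conv_bounded_linear[THEN iffD1])
  have "lborel = density (distr lborel borel W) (\<lambda>_. ennreal (1 / k))"
  proof (rule lborel_eqI)
    fix l u :: 'a assume lu: "\<And>b. b \<in> Basis \<Longrightarrow> l \<bullet> b \<le> u \<bullet> b"
    have vim: "W -` box l u = f ` box l u"
      using Wf fW by (auto simp: image_iff) metis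
    have box: "box l u \<in> lmeasurable" by simp
    have "f ` box l u \<in> lmeasurable \<and> k * measure lebesgue (box l u) = measure lebesgue (f ` box l u)"
      by (rule measure_linear_sufficient[OF f(1) box im])
    then have "emeasure lebesgue (f ` box l u) = ennreal (k * measure lebesgue (box l u))"
      by (simp add: emeasure_eq_measure2)
    moreover have "f ` box l u \<in> sets borel"
      unfolding vim[symmetric] using measurable_sets[of W borel borel "box l u"] by simp
    ultimately have eq: "emeasure lborel (f ` box l u) = ennreal (k * measure lborel (box l u))"
      by simp
    have "emeasure (density (distr lborel borel W) (\<lambda>_. ennreal (1 / k))) (box l u) =
        ennreal (1 / k) * emeasure lborel (f ` box l u)"
      by (simp add: emeasure_density nn_integral_cmult emeasure_distr vim)
    also have "\<dots> = ennreal (measure lborel (box l u))"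
      unfolding eq using k by (simp add: ennreal_mult'[symmetric])
    finally show "emeasure (density (distr lborel borel W) (\<lambda>_. ennreal (1 / k))) (box l u) = (\<Prod>b\<in>Basis. (u - l) \<bullet> b)"
      using lu by (simp add: measure_lborel_box_eq)
  qed simp
  then have "(\<integral>\<^sup>+ x. g (f x) \<partial>lborel) = (\<integral>\<^sup>+ x. g (f x) \<partial>density (distr lborel borel W) (\<lambda>_. ennreal (1 / k)))"
    by simp
  also have "\<dots> = ennreal (1 / k) * (\<integral>\<^sup>+ x. g x \<partial>lborel)"
    by (simp add: nn_integral_density nn_integral_distr nn_integral_cmult fW)
  finally have "ennreal k * (\<integral>\<^sup>+ x. g (f x) \<partial>lborel) = (ennreal k * ennreal (1 / k)) * (\<integral>\<^sup>+ x. g x \<partial>lborel)"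
    by (simp add: mult.assoc)
  also have "ennreal k * ennreal (1 / k) = 1"
    using k by (simp add: ennreal_mult'[symmetric])
  finally show ?thesis by simp
qed

lemma measure_shear_cbox:
  fixes a b :: "real^'n"
  assumes "m \<noteq> n"
  shows "measure lebesgue ((\<lambda>x. \<chi> i. if i = m then x$m + x$n else x$i) ` cbox a b) = measure lebesgue (cbox a b)"
    (is "measure lebesgue (?h ` _) = _")
proof (cases "cbox a b = {}")
  case False
  have lin: "linear ?h" by (rule linearI) (auto simp: vec_eq_iff algebra_simps)
  \<comment> \<open>\<open>measure_shear_interval\<close> wants the lower corner nonnegative in
    coordinate n, so the box is translated to have its lower corner at 0.\<close>
  have eq: "cbox a b = (+) a ` cbox 0 (b - a)"
    using cbox_translation[of a 0 "b - a"] by simp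
  then have ne: "cbox 0 (b - a) \<noteq> {}" using False by auto
  have "?h ` cbox a b = (+) (?h a) ` ?h ` cbox 0 (b - a)"
    unfolding eq image_image linear_add[OF lin] ..
  then have "measure lebesgue (?h ` cbox a b) = measure lebesgue (?h ` cbox 0 (b - a))"
    by (simp only: measure_translation)
  also have "\<dots> = measure lebesgue (cbox 0 (b - a))"
    by (rule measure_shear_interval[OF assms ne]) simp
  also have "\<dots> = measure lebesgue (cbox a b)"
    unfolding eq by (simp only: measure_translation)
  finally show ?thesis .
qed simp

lemma measure_swap_cbox:
  fixes a b :: "real^'n"
  shows "measure lebesgue ((\<lambda>x. \<chi> i. x $ Transposition.transpose m n i) ` cbox a b) = measure lebesgue (cbox a b)"
    (is "measure lebesgue (?h ` _) = _")
proof (cases "cbox a b = {}")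
  case False
  have inv: "?h (?h x) = x" for x :: "real^'n" by (simp add: vec_eq_iff)
  have mem: "?h x \<in> cbox (?h a) (?h b) \<longleftrightarrow> x \<in> cbox a b" for x a b :: "real^'n"
    unfolding mem_box_cart vec_lambda_beta by (metis transpose_involutory)
  have im: "?h ` cbox a b = cbox (?h a) (?h b)"
  proof
    show "?h ` cbox a b \<subseteq> cbox (?h a) (?h b)" using mem by blast
    show "cbox (?h a) (?h b) \<subseteq> ?h ` cbox a b"
    proof
      fix y assume "y \<in> cbox (?h a) (?h b)"
      then have "?h y \<in> cbox a b" using mem[of "?h y" a b] inv[of y] by (simp only:)
      then show "y \<in> ?h ` cbox a b" using imageI[of "?h y" "cbox a b" ?h] unfolding inv[of y] by simp
    qed
  qed
  have ne: "cbox (?h a) (?h b) \<noteq> {}" using False im by blast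
  have "measure lebesgue (?h ` cbox a b) = (\<Prod>i\<in>UNIV. (?h b)$i - (?h a)$i)"
    unfolding im using content_cbox_cart[OF ne] by simp
  also have "\<dots> = (\<Prod>i\<in>UNIV. b$i - a$i)"
    unfolding vec_lambda_beta
    by (rule prod.reindex_bij_betw[where h = "Transposition.transpose m n" and g = "\<lambda>i. b$i - a$i"]) simp
  also have "\<dots> = measure lebesgue (cbox a b)" using False by (simp add: content_cbox_cart)
  finally show ?thesis .
qed simp

text \<open>The swap is an involution, so its determinant squares to 1; the sign is irrelevant for
  volumes.\<close>

lemma det_matrix_swap:
  assumes "m \<noteq> (n::'n::finite)"
  shows "\<bar>det (matrix (\<lambda>x::real^'n. \<chi> i. x $ Transposition.transpose m n i))\<bar> = 1"
proof -
  let ?h = "\<lambda>x::real^'n. \<chi> i. x $ Transposition.transpose m n i"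
  have lin: "linear ?h" by (rule linearI) (auto simp: vec_eq_iff)
  have hh: "?h \<circ> ?h = (\<lambda>x. x)" by (auto simp: fun_eq_iff vec_eq_iff)
  have "matrix ?h ** matrix ?h = mat 1"
    unfolding matrix_compose[OF lin lin, symmetric] hh by (rule matrix_id_mat_1[unfolded id_def])
  then have "det (matrix ?h) * det (matrix ?h) = 1"
    by (metis det_I det_mul)
  then have "(det (matrix ?h))\<^sup>2 = 1" by (simp only: power2_eq_square)
  then show ?thesis by (simp only: abs_square_eq_1)
qed

lemma det_matrix_shear:
  assumes "m \<noteq> (n::'n::finite)"
  shows "det (matrix (\<lambda>x::real^'n. \<chi> i. if i = m then x$m + x$n else x$i)) = 1"
proof -
  have "matrix (\<lambda>x::real^'n. \<chi> i. if i = m then x$m + x$n else x$i) =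
      (\<chi> k. if k = m then row m (mat 1) + 1 *s row n (mat 1) else row k (mat 1))"
    by (auto simp: matrix_def vec_eq_iff row_def mat_def axis_def)
  then show ?thesis using det_row_operation[OF assms, of "mat 1" 1] by simp
qed

text \<open>The library's \<open>measure_linear_image\<close> is restricted to well-ordered index types, hence this
  separate induction over elementary maps.\<close>

lemma nn_integral_linear:
  fixes f :: "real^'n \<Rightarrow> real^'n"
  assumes "linear f" "det (matrix f) \<noteq> 0" "g \<in> borel_measurable borel"
  shows "(\<integral>\<^sup>+ x. g x \<partial>lborel) = ennreal \<bar>det (matrix f)\<bar> * (\<integral>\<^sup>+ x. g (f x) \<partial>lborel)"
proof -
  have "det (matrix f) \<noteq> 0 \<longrightarrow> (\<forall>g. g \<in> borel_measurable borel \<longrightarrow>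
    (\<integral>\<^sup>+ x. g x \<partial>lborel) = ennreal \<bar>det (matrix f)\<bar> * (\<integral>\<^sup>+ x. g (f x) \<partial>lborel))" (is "?R f")
  proof (rule induct_linear_elementary[OF assms(1), of ?R])
    fix f g :: "real^'n \<Rightarrow> real^'n" assume lin: "linear f" "linear g" and R: "?R f" "?R g"
    show "?R (f \<circ> g)"
    proof (intro impI allI)
      fix h :: "real^'n \<Rightarrow> ennreal" assume h [measurable]: "h \<in> borel_measurable borel"
        and nz: "det (matrix (f \<circ> g)) \<noteq> 0"
      have [measurable]: "f \<in> borel_measurable borel"
        using lin(1) by (auto intro!: borel_measurable_continuous_onI linear_continuous_on linear_conv_bounded_linear[THEN iffD1])
      have det: "det (matrix (f \<circ> g)) = det (matrix f) * det (matrix g)"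
        by (simp add: matrix_compose[OF lin(2,1)] det_mul)
      have "(\<integral>\<^sup>+ x. h x \<partial>lborel) = ennreal \<bar>det (matrix f)\<bar> * (\<integral>\<^sup>+ x. h (f x) \<partial>lborel)"
        by (rule R(1)[rule_format]) (use nz det in auto)
      also have "(\<integral>\<^sup>+ x. h (f x) \<partial>lborel) = ennreal \<bar>det (matrix g)\<bar> * (\<integral>\<^sup>+ x. h (f (g x)) \<partial>lborel)"
        by (rule R(2)[rule_format, of "\<lambda>x. h (f x)"]) (use nz det in auto)
      finally show "(\<integral>\<^sup>+ x. h x \<partial>lborel) = ennreal \<bar>det (matrix (f \<circ> g))\<bar> * (\<integral>\<^sup>+ x. h ((f \<circ> g) x) \<partial>lborel)"
        by (simp add: det abs_mult ennreal_mult' mult.assoc)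
    qed
  next
    fix f :: "real^'n \<Rightarrow> real^'n" and i assume lin: "linear f" and 0: "\<And>x. f x $ i = 0"
    \<comment> \<open>A map with a vanishing coordinate has determinant 0, so the claim is vacuous
      for it.\<close>
    have "\<not> surj f"
    proof
      assume "surj f"
      then obtain x where "f x = axis i 1" by (metis surjD)
      then show False using 0[of x] by (simp add: axis_def)
    qed
    then have "det (matrix f) = 0"
      using det_nz_iff_inj[OF lin] linear_injective_imp_surjective[of f] lin by auto
    then show "?R f" by simp
  next
    fix c :: "'n \<Rightarrow> real"
    let ?h = "\<lambda>x::real^'n. \<chi> i. c i * x$i"
    have lin: "linear ?h" by (rule linearI) (auto simp: vec_eq_iff algebra_simps)
    have det: "det (matrix ?h) = prod c UNIV"
      by (subst det_diagonal) (auto simp: matrix_def axis_def)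
    show "?R ?h"
    proof (intro impI allI)
      fix h :: "real^'n \<Rightarrow> ennreal" assume "h \<in> borel_measurable borel" and nz: "det (matrix ?h) \<noteq> 0"
      then show "(\<integral>\<^sup>+ x. h x \<partial>lborel) = ennreal \<bar>det (matrix ?h)\<bar> * (\<integral>\<^sup>+ x. h (?h x) \<partial>lborel)"
        using det_nz_iff_inj[OF lin] measure_stretch[OF lmeasurable_cbox, of c]
        by (intro nn_integral_linear_of_image_measure[OF lin]) (simp_all add: det)
    qed
  next
    fix m n :: 'n assume mn: "m \<noteq> n"
    let ?h = "\<lambda>x::real^'n. \<chi> i. x $ Transposition.transpose m n i"
    have lin: "linear ?h" by (rule linearI) (auto simp: vec_eq_iff)
    have inj: "inj ?h" using det_nz_iff_inj[OF lin] det_matrix_swap[OF mn] by auto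
    show "?R ?h"
    proof (intro impI allI)
      fix h :: "real^'n \<Rightarrow> ennreal" assume "h \<in> borel_measurable borel"
      then show "(\<integral>\<^sup>+ x. h x \<partial>lborel) = ennreal \<bar>det (matrix ?h)\<bar> * (\<integral>\<^sup>+ x. h (?h x) \<partial>lborel)"
        by (intro nn_integral_linear_of_image_measure[OF lin inj]) (simp_all only: det_matrix_swap[OF mn] measure_swap_cbox abs_one mult_1 zero_less_one)
    qed
  next
    fix m n :: 'n assume mn: "m \<noteq> n"
    let ?h = "\<lambda>x::real^'n. \<chi> i. if i = m then x$m + x$n else x$i"
    have lin: "linear ?h" by (rule linearI) (auto simp: vec_eq_iff algebra_simps)
    have inj: "inj ?h" using det_nz_iff_inj[OF lin] det_matrix_shear[OF mn] by auto
    show "?R ?h"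
    proof (intro impI allI)
      fix h :: "real^'n \<Rightarrow> ennreal" assume "h \<in> borel_measurable borel"
      then show "(\<integral>\<^sup>+ x. h x \<partial>lborel) = ennreal \<bar>det (matrix ?h)\<bar> * (\<integral>\<^sup>+ x. h (?h x) \<partial>lborel)"
        by (intro nn_integral_linear_of_image_measure[OF lin inj]) (simp_all only: det_matrix_shear[OF mn] measure_shear_cbox[OF mn] abs_one mult_1 zero_less_one)
    qed
  qed
  then show ?thesis using assms by blast
qed

lemma matrix_vector_measurable [measurable (raw)]:
  fixes A :: "real^'n^'m"
  shows "g \<in> borel_measurable M \<Longrightarrow> (\<lambda>x. A *v g x) \<in> borel_measurable M"
  by (rule measurable_compose[OF _ borel_measurable_continuous_onI])
     (auto intro: linear_continuous_on linear_conv_bounded_linear[THEN iffD1])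

lemma nn_integral_matrix:
  fixes A :: "real^'n^'n"
  assumes "invertible A" "g \<in> borel_measurable borel"
  shows "(\<integral>\<^sup>+ x. g x \<partial>lborel) = ennreal \<bar>det A\<bar> * (\<integral>\<^sup>+ x. g (A *v x) \<partial>lborel)"
  using nn_integral_linear[of "(*v) A" g] assms by (simp add: invertible_det_nz)

text \<open>The substitution rule as an equation between measures, so that it carries over to
  complex integrals.\<close>

lemma lborel_eq_density_matrix:
  fixes A :: "real^'n^'n"
  assumes "invertible A"
  shows "lborel = density (distr lborel borel ((*v) A)) (\<lambda>_. ennreal \<bar>det A\<bar>)"
proof (rule measure_eqI)
  fix X :: "(real^'n) set" assume "X \<in> sets lborel"
  then have [measurable]: "X \<in> sets borel" by simp
  have "emeasure lborel X = ennreal \<bar>det A\<bar> * (\<integral>\<^sup>+ x. indicator X (A *v x) \<partial>lborel)"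
    using nn_integral_matrix[OF assms, of "indicator X"] by simp
  then show "emeasure lborel X = emeasure (density (distr lborel borel ((*v) A)) (\<lambda>_. ennreal \<bar>det A\<bar>)) X"
    by (simp add: emeasure_density nn_integral_cmult nn_integral_distr del: nn_integral_indicator)
qed simp

lemma integral_matrix:
  fixes A :: "real^'n^'n" and g :: "real^'n \<Rightarrow> complex"
  assumes "invertible A" and [measurable]: "g \<in> borel_measurable borel"
  shows "(LINT x|lborel. g x) = \<bar>det A\<bar> * (LINT x|lborel. g (A *v x))"
  by (subst lborel_eq_density_matrix[OF assms(1)])
     (simp add: integral_density integral_distr scaleR_conv_of_real)

lemma matrix_image_indicator:
  fixes A :: "real^'n^'n"
  assumes "invertible A"
  shows "indicator ((*v) A ` P) (A *v x) = indicator P x"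
  using inj_matrix_vector_mult[OF assms] by (auto simp: indicator_def inj_image_mem_iff)

lemma open_matrix_image:
  fixes A :: "real^'n^'n"
  assumes "invertible A" "open P"
  shows "open ((*v) A ` P)"
  using linear_injective_imp_surjective[OF matrix_vector_mul_linear inj_matrix_vector_mult[OF assms(1)]]
  by (intro open_surjective_linear_image assms) auto

lemma emeasure_matrix_image:
  fixes A :: "real^'n^'n"
  assumes "invertible A" "open P"
  shows "emeasure lborel ((*v) A ` P) = ennreal \<bar>det A\<bar> * emeasure lborel P"
  using nn_integral_matrix[OF assms(1), of "indicator ((*v) A ` P)"] open_matrix_image[OF assms] assms(2)
  by (simp add: matrix_image_indicator[OF assms(1)])

section \<open>Time and band limiting\<close>

lemma sigma_finite_lebesgue: "sigma_finite_measure (lebesgue :: 'a::euclidean_space measure)"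
proof
  obtain A :: "'a set set" where "countable A" "A \<subseteq> sets lborel" "\<Union>A = space lborel" "\<forall>a\<in>A. emeasure lborel a \<noteq> \<infinity>"
    using lborel.sigma_finite_countable by blast
  then show "\<exists>A::'a set set. countable A \<and> A \<subseteq> sets lebesgue \<and> \<Union>A = space lebesgue \<and> (\<forall>a\<in>A. emeasure lebesgue a \<noteq> \<infinity>)"
    by (intro exI[of _ A]) (auto simp: subset_iff)
qed

lemma lebesgue_ex_borel_complex:
  fixes f :: "'a::euclidean_space \<Rightarrow> complex"
  assumes [measurable]: "f \<in> borel_measurable lebesgue"
  obtains g where "g \<in> borel_measurable borel" "AE x in lebesgue. f x = g x"
proof -
  obtain a where a: "a \<in> borel_measurable lborel" "AE x in lborel. Re (f x) = a x"
    using completion_ex_borel_measurable_real[of "\<lambda>x. Re (f x)" lborel] by auto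
  obtain b where b: "b \<in> borel_measurable lborel" "AE x in lborel. Im (f x) = b x"
    using completion_ex_borel_measurable_real[of "\<lambda>x. Im (f x)" lborel] by auto
  show thesis
  proof
    show "(\<lambda>x. Complex (a x) (b x)) \<in> borel_measurable borel"
      using a(1) b(1) by (simp add: Complex_eq)
    have "AE x in lborel. f x = Complex (a x) (b x)"
      using a(2) b(2) by eventually_elim (simp add: complex_eq_iff)
    then show "AE x in lebesgue. f x = Complex (a x) (b x)" by (rule AE_completion)
  qed
qed

definition spec_measure :: "(real^'n) set \<Rightarrow> (real^'n) measure" where
  "spec_measure T = density lborel (\<lambda>u. ennreal (1 / (2 * pi) ^ CARD('n) * indicator T u))"

definition wave :: "(real^'n) set \<Rightarrow> real^'n \<Rightarrow> real^'n \<Rightarrow> complex" where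
  "wave S u x = indicator S x * exp (\<i> * complex_of_real (x \<bullet> u))"

lemma sets_spec_measure [simp, measurable_cong]: "sets (spec_measure T) = sets borel"
  by (simp add: spec_measure_def)

lemma nn_integral_spec_measure:
  fixes T :: "(real^'n) set"
  assumes [measurable]: "T \<in> sets borel" "g \<in> borel_measurable borel"
  shows "(\<integral>\<^sup>+ u. g u \<partial>spec_measure T) =
    ennreal (1 / (2 * pi) ^ CARD('n)) * (\<integral>\<^sup>+ u. indicator T u * g u \<partial>lborel)"
proof -
  have "(\<integral>\<^sup>+ u. g u \<partial>spec_measure T) =
      (\<integral>\<^sup>+ u. ennreal (1 / (2 * pi) ^ CARD('n)) * (indicator T u * g u) \<partial>lborel)"
    unfolding spec_measure_def
    by (subst nn_integral_density) (auto intro!: nn_integral_cong split: split_indicator)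
  then show ?thesis by (simp add: nn_integral_cmult)
qed

lemma integral_spec_measure:
  fixes T :: "(real^'n) set" and g :: "real^'n \<Rightarrow> complex"
  assumes [measurable]: "T \<in> sets borel" "g \<in> borel_measurable borel"
  shows "(LINT u|spec_measure T. g u) =
    complex_of_real (1 / (2 * pi) ^ CARD('n)) * (LINT u|lborel. indicator T u * g u)"
proof -
  have "(LINT u|spec_measure T. g u) =
      (LINT u|lborel. complex_of_real (1 / (2 * pi) ^ CARD('n)) * (indicator T u * g u))"
    unfolding spec_measure_def
    by (subst integral_density)
       (auto intro!: Bochner_Integration.integral_cong simp: scaleR_conv_of_real of_real_indicator)
  then show ?thesis by simp
qed

lemma emeasure_space_spec_measure:
  fixes T :: "(real^'n) set"
  assumes "T \<in> sets borel"
  shows "emeasure (spec_measure T) (space (spec_measure T)) = ennreal (1 / (2 * pi) ^ CARD('n)) * emeasure lborel T"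
  using nn_integral_spec_measure[OF assms, of "\<lambda>_. 1"] assms by simp

lemma cmod_wave: "cmod (wave S u x) = indicator S x"
  by (simp add: wave_def norm_mult split: split_indicator)

lemma wave_measurable2:
  assumes [measurable]: "S \<in> sets borel"
  shows "(\<lambda>p. wave S (fst p) (snd p)) \<in> borel_measurable (borel \<Otimes>\<^sub>M borel)"
  unfolding wave_def by measurable

text \<open>The coefficients of f are the Fourier transform of f cut off to S, which is integrable
  because S has finite measure. Plancherel's inequality then gives the contraction, since cutting
  off to S and to T only lowers norms.\<close>

lemma bessel_kernel_wave:
  fixes S T :: "(real^'n) set"
  assumes S: "open S" "emeasure lborel S < \<infinity>" and T: "open T" "emeasure lborel T < \<infinity>"
  shows "bessel_kernel lebesgue (spec_measure T) S (wave S)"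
proof -
  have [measurable]: "S \<in> sets borel" "T \<in> sets borel" using S T by auto
  interpret sigma_finite_measure "lebesgue :: (real^'n) measure" by (rule sigma_finite_lebesgue)
  interpret N: finite_measure "spec_measure T"
    by (rule finite_measureI) (use T in \<open>auto simp: emeasure_space_spec_measure ennreal_mult_eq_top_iff\<close>)
  show ?thesis
  proof
    show "S \<in> sets lebesgue" by simp
    show "emeasure lebesgue S < \<infinity>" using S(2) by simp
    have "(\<lambda>p. p) \<in> spec_measure T \<Otimes>\<^sub>M lebesgue \<rightarrow>\<^sub>M borel \<Otimes>\<^sub>M borel"
      by (intro measurable_pair) (auto simp: comp_def intro!: measurable_compose[OF measurable_snd] measurable_completion)
    from measurable_compose[OF this wave_measurable2[of S]]
    show "(\<lambda>p. wave S (fst p) (snd p)) \<in> borel_measurable (spec_measure T \<Otimes>\<^sub>M lebesgue)" by simp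
    show "cmod (wave S u x) \<le> indicator S x" for u x by (simp add: cmod_wave)
    show "continuous_on UNIV (\<lambda>u. wave S u x)" for x
      unfolding wave_def by (intro continuous_intros)
  next
    fix f :: "real^'n \<Rightarrow> complex" assume f: "L2 lebesgue f"
    have fm [measurable]: "f \<in> borel_measurable lebesgue" by (rule L2_measurable[OF f])
    \<comment> \<open>The Fourier lemmas require Borel functions; f is replaced by a Borel
      representative, which changes neither coefficients nor norm.\<close>
    obtain g where g [measurable]: "g \<in> borel_measurable borel" and fg: "AE x in lebesgue. f x = g x"
      using lebesgue_ex_borel_complex[OF fm] .
    have gl [measurable]: "g \<in> borel_measurable lebesgue" using g by (simp add: measurable_completion)
    define h where "h x = indicator S x * g x" for x
    have [measurable]: "h \<in> borel_measurable borel" unfolding h_def by measurable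
    have "integrable lebesgue (\<lambda>x. (cmod (g x))\<^sup>2)"
      using L2_integrable_square[OF f] fg
      by (subst integrable_cong_AE[where g = "\<lambda>x. (cmod (f x))\<^sup>2"]) (auto elim!: AE_mp)
    then have gL2: "L2 lborel g" by (simp add: L2_def integrable_completion)
    have "L2 lborel (indicator S)"
    proof -
      have "(\<lambda>x. (cmod (indicator S x))\<^sup>2) = (indicator S :: real^'n \<Rightarrow> real)"
        by (auto simp: fun_eq_iff split: split_indicator)
      then show ?thesis using S by (simp add: L2_def)
    qed
    moreover have "h = (\<lambda>x. g x * cnj (indicator S x))"
      by (auto simp: fun_eq_iff h_def split: split_indicator)
    ultimately have hint: "integrable lborel h"
      using integrable_L2_mult[OF gL2] by simp
    have coef: "ip lebesgue f (wave S u) = ft h u" for u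
    proof -
      have [measurable]: "wave S u \<in> borel_measurable lebesgue"
        unfolding wave_def by (intro measurable_completion) measurable
      have "ip lebesgue f (wave S u) = (LINT x|lebesgue. h x * exp (- (\<i> * complex_of_real (x \<bullet> u))))"
        unfolding ip_def
      proof (rule integral_cong_AE)
        show "(\<lambda>x. h x * exp (- (\<i> * complex_of_real (x \<bullet> u)))) \<in> borel_measurable lebesgue"
          by (intro measurable_completion) measurable
        show "AE x in lebesgue. f x * cnj (wave S u x) = h x * exp (- (\<i> * complex_of_real (x \<bullet> u)))"
          using fg by eventually_elim (simp add: wave_def h_def exp_cnj split: split_indicator)
      qed measurable
      also have "\<dots> = ft h u"
        unfolding ft_def by (rule integral_completion) measurable
      finally show ?thesis .
    qed
    have "(\<integral>\<^sup>+ u. ennreal ((cmod (ft h u))\<^sup>2) \<partial>spec_measure T) =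
        ennreal (1 / (2 * pi) ^ CARD('n)) * (\<integral>\<^sup>+ u. indicator T u * ennreal ((cmod (ft h u))\<^sup>2) \<partial>lborel)"
      by (rule nn_integral_spec_measure) measurable
    also have "\<dots> \<le> ennreal (1 / (2 * pi) ^ CARD('n)) * (\<integral>\<^sup>+ u. ennreal ((cmod (ft h u))\<^sup>2) \<partial>lborel)"
      by (intro mult_left_mono nn_integral_mono) (auto split: split_indicator)
    \<comment> \<open>Plancherel's factor (2 pi)^N cancels the normalisation built into
      \<open>spec_measure\<close>.\<close>
    also have "\<dots> \<le> ennreal (1 / (2 * pi) ^ CARD('n)) * (ennreal ((2 * pi) ^ CARD('n)) * (\<integral>\<^sup>+ x. ennreal ((cmod (h x))\<^sup>2) \<partial>lborel))"
      using plancherel_le[OF hint] by (intro mult_left_mono) auto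
    also have "\<dots> = (\<integral>\<^sup>+ x. ennreal ((cmod (h x))\<^sup>2) \<partial>lborel)"
      by (simp add: mult.assoc[symmetric] ennreal_mult'[symmetric] del: power_mult_distrib)
    also have "\<dots> \<le> (\<integral>\<^sup>+ x. ennreal ((cmod (g x))\<^sup>2) \<partial>lborel)"
      by (intro nn_integral_mono) (auto simp: h_def split: split_indicator)
    also have "\<dots> = (\<integral>\<^sup>+ x. ennreal ((cmod (f x))\<^sup>2) \<partial>lebesgue)"
      unfolding nn_integral_completion[of lborel "\<lambda>x. ennreal ((cmod (g x))\<^sup>2)", symmetric]
      using fg by (intro nn_integral_cong_AE) (auto elim!: AE_mp)
    also have "\<dots> = ennreal (sqnorm lebesgue f)"
      unfolding sqnorm_def by (rule nn_integral_eq_integral[OF L2_integrable_square[OF f]]) simp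
    finally have le: "(\<integral>\<^sup>+ u. ennreal ((cmod (ft h u))\<^sup>2) \<partial>spec_measure T) \<le> ennreal (sqnorm lebesgue f)" .
    show "sqnorm (spec_measure T) (\<lambda>u. ip lebesgue f (wave S u)) \<le> sqnorm lebesgue f"
      unfolding coef sqnorm_def[of "spec_measure T"]
      by (subst integral_eq_nn_integral) (use le in \<open>auto intro: enn2real_leI\<close>)
  qed simp_all
qed

lemma coef_wave:
  fixes S T :: "(real^'n) set"
  assumes "bessel_kernel lebesgue (spec_measure T) S (wave S)"
  shows "bessel_kernel.coef lebesgue (wave S) f u = fourier (\<lambda>y. indicator S y * f y) u"
proof -
  interpret bessel_kernel lebesgue "spec_measure T" S "wave S" by fact
  show ?thesis
    unfolding coef_def ip_def fourier_def
    by (intro Bochner_Integration.integral_cong) (auto simp: wave_def exp_cnj split: split_indicator)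
qed

lemma op_wave:
  fixes S T :: "(real^'n) set"
  assumes "bessel_kernel lebesgue (spec_measure T) S (wave S)" and [measurable]: "S \<in> sets borel" "T \<in> sets borel"
    and f: "L2 lebesgue f"
  shows "bessel_kernel.op lebesgue (spec_measure T) (wave S) f x = TBT S T f x"
proof -
  interpret bessel_kernel lebesgue "spec_measure T" S "wave S" by fact
  have [measurable]: "coef f \<in> borel_measurable borel"
    using coef_meas[OF L2_measurable[OF f]] by (simp cong: measurable_cong_sets)
  have [measurable]: "(\<lambda>u. wave S u x) \<in> borel_measurable borel"
    unfolding wave_def by measurable
  have m: "(\<lambda>u. wave S u x * coef f u) \<in> borel_measurable borel" by measurable
  define c where "c = complex_of_real (1 / (2 * pi) ^ CARD('n))"
  have "op f x = c * (LINT u|lborel. indicator T u * (wave S u x * coef f u))"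
    unfolding op_def c_def by (rule integral_spec_measure[OF _ m]) simp
  also have "(LINT u|lborel. indicator T u * (wave S u x * coef f u)) =
      (LINT u|lborel. indicator S x * (indicator T u * coef f u * exp (\<i> * complex_of_real (x \<bullet> u))))"
    by (intro Bochner_Integration.integral_cong) (auto simp: wave_def)
  also have "\<dots> = indicator S x * (LINT u|lborel. indicator T u * coef f u * exp (\<i> * complex_of_real (x \<bullet> u)))"
    by simp
  also have "(LINT u|lborel. indicator T u * coef f u * exp (\<i> * complex_of_real (x \<bullet> u))) =
      (LINT u|lebesgue. indicator T u * coef f u * exp (\<i> * complex_of_real (x \<bullet> u)))"
    by (rule integral_completion[symmetric]) measurable
  finally show ?thesis
    by (simp add: TBT_def inv_fourier_def coef_wave[OF assms(1)] c_def)
qed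

section \<open>The two traces for waves and their behaviour under linear maps\<close>

lemma trace_wave:
  fixes S T :: "(real^'n) set"
  assumes "bessel_kernel lebesgue (spec_measure T) S (wave S)" and "S \<in> sets borel" "T \<in> sets borel"
  shows "bessel_kernel.trace lebesgue (spec_measure T) (wave S) =
    1 / (2 * pi) ^ CARD('n) * measure lborel S * measure lborel T"
proof -
  interpret bessel_kernel lebesgue "spec_measure T" S "wave S" by fact
  have "(\<lambda>x. (cmod (wave S u x))\<^sup>2) = indicator S" for u
    by (auto simp: fun_eq_iff cmod_wave split: split_indicator)
  then have "sqnorm lebesgue (wave S u) = measure lborel S" for u
    using assms(2) by (simp add: sqnorm_def)
  moreover have "measure (spec_measure T) (space (spec_measure T)) = 1 / (2 * pi) ^ CARD('n) * measure lborel T"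
    unfolding measure_def emeasure_space_spec_measure[OF assms(3)] by (simp add: enn2real_mult)
  ultimately show ?thesis by (simp add: trace_def)
qed

lemma ip_wave:
  assumes [measurable]: "S \<in> sets borel"
  shows "ip lebesgue (wave S u) (wave S v) = ft (indicator S) (v - u)"
proof -
  have "wave S u x * cnj (wave S v x) = indicator S x * exp (- (\<i> * complex_of_real (x \<bullet> (v - u))))" for x
    by (auto simp: wave_def exp_cnj inner_diff_right algebra_simps simp flip: exp_add split: split_indicator)
  then have "ip lebesgue (wave S u) (wave S v) = (LINT x|lebesgue. indicator S x * exp (- (\<i> * complex_of_real (x \<bullet> (v - u)))))"
    by (simp add: ip_def)
  also have "\<dots> = ft (indicator S) (v - u)"
    unfolding ft_def by (rule integral_completion) measurable
  finally show ?thesis .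
qed

lemma trace_sq_wave:
  fixes S T :: "(real^'n) set"
  assumes "bessel_kernel lebesgue (spec_measure T) S (wave S)" and [measurable]: "S \<in> sets borel" "T \<in> sets borel"
  shows "ennreal (bessel_kernel.trace_sq lebesgue (spec_measure T) (wave S)) =
    ennreal ((1 / (2 * pi) ^ CARD('n))\<^sup>2) *
      (\<integral>\<^sup>+ u. indicator T u * (\<integral>\<^sup>+ v. indicator T v * ennreal ((cmod (ft (indicator S) (v - u)))\<^sup>2) \<partial>lborel) \<partial>lborel)"
proof -
  interpret bessel_kernel lebesgue "spec_measure T" S "wave S" by fact
  define c where "c = ennreal (1 / (2 * pi) ^ CARD('n))"
  have coef: "coef (wave S u) v = ft (indicator S) (v - u)" for u v
    unfolding coef_def by (rule ip_wave) simp
  have "ennreal trace_sq = (\<integral>\<^sup>+ u. ennreal (sqnorm (spec_measure T) (coef (wave S u))) \<partial>spec_measure T)"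
    unfolding trace_sq_def by (rule nn_integral_eq_integral[OF integrable_sqnorm_coef_e, symmetric]) simp
  also have "\<dots> = (\<integral>\<^sup>+ u. \<integral>\<^sup>+ v. ennreal ((cmod (coef (wave S u) v))\<^sup>2) \<partial>spec_measure T \<partial>spec_measure T)"
    unfolding sqnorm_def
    by (intro nn_integral_cong nn_integral_eq_integral[symmetric] L2_integrable_square coef_L2 e_L2) simp
  also have "\<dots> = (\<integral>\<^sup>+ u. c * (\<integral>\<^sup>+ v. indicator T v * ennreal ((cmod (ft (indicator S) (v - u)))\<^sup>2) \<partial>lborel) \<partial>spec_measure T)"
    unfolding coef c_def by (intro nn_integral_cong nn_integral_spec_measure) measurable
  also have "\<dots> = c * (\<integral>\<^sup>+ u. indicator T u * (c * (\<integral>\<^sup>+ v. indicator T v * ennreal ((cmod (ft (indicator S) (v - u)))\<^sup>2) \<partial>lborel)) \<partial>lborel)"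
    unfolding c_def by (intro nn_integral_spec_measure) measurable
  also have "\<dots> = c * (c * (\<integral>\<^sup>+ u. indicator T u * (\<integral>\<^sup>+ v. indicator T v * ennreal ((cmod (ft (indicator S) (v - u)))\<^sup>2) \<partial>lborel) \<partial>lborel))"
    unfolding mult.left_commute[of "indicator T _" c] by (subst nn_integral_cmult) auto
  also have "\<dots> = ennreal ((1 / (2 * pi) ^ CARD('n))\<^sup>2) * (\<integral>\<^sup>+ u. indicator T u * (\<integral>\<^sup>+ v. indicator T v * ennreal ((cmod (ft (indicator S) (v - u)))\<^sup>2) \<partial>lborel) \<partial>lborel)"
    unfolding c_def power2_eq_square by (subst ennreal_mult) (auto simp: mult.assoc)
  finally show ?thesis .
qed

lemma ft_matrix_image:
  fixes A :: "real^'n^'n"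
  assumes A: "invertible A" and P: "open P"
  shows "ft (indicator ((*v) A ` P)) w = \<bar>det A\<bar> * ft (indicator P) (transpose A *v w)"
proof -
  have [measurable]: "(*v) A ` P \<in> sets borel" using open_matrix_image[OF A P] by simp
  have "ft (indicator ((*v) A ` P)) w =
      \<bar>det A\<bar> * (LINT x|lborel. indicator ((*v) A ` P) (A *v x) * exp (- (\<i> * complex_of_real ((A *v x) \<bullet> w))))"
    unfolding ft_def by (rule integral_matrix[OF A]) measurable
  moreover have "(A *v x) \<bullet> w = x \<bullet> (transpose A *v w)" for x
    by (simp add: dot_lmul_matrix[symmetric] inner_commute)
  ultimately show ?thesis by (simp add: matrix_image_indicator[OF A] ft_def)
qed

text \<open>How much of Q still meets its translates by \<open>W *v w\<close>, weighted by the
  energy of the indicator of P at frequency w. All dependence of the normalised trace of the square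
  on the matrices is concentrated in W.\<close>

definition overlap :: "(real^'n) set \<Rightarrow> (real^'n) set \<Rightarrow> real^'n^'n \<Rightarrow> ennreal" where
  "overlap P Q W = (\<integral>\<^sup>+ u. \<integral>\<^sup>+ w. indicator Q u * indicator Q (u + W *v w) *
      ennreal ((cmod (ft (indicator P) w))\<^sup>2) \<partial>lborel \<partial>lborel)"

lemma trace_sq_integral_eq_overlap:
  fixes A B W :: "real^'n^'n"
  assumes A: "invertible A" and B: "invertible B" and P: "open P" and Q: "open Q"
    and W: "invertible W" and CW: "transpose A ** B ** W = mat 1"
  shows "(\<integral>\<^sup>+ u. indicator ((*v) B ` Q) u * (\<integral>\<^sup>+ v. indicator ((*v) B ` Q) v *
      ennreal ((cmod (ft (indicator ((*v) A ` P)) (v - u)))\<^sup>2) \<partial>lborel) \<partial>lborel) =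
    ennreal (\<bar>det A\<bar> * \<bar>det B\<bar>) * overlap P Q W"
proof -
  have [measurable]: "P \<in> sets borel" "Q \<in> sets borel" "(*v) A ` P \<in> sets borel" "(*v) B ` Q \<in> sets borel"
    using P Q open_matrix_image[OF A P] open_matrix_image[OF B Q] by auto
  define a b where "a = \<bar>det A\<bar>" and "b = \<bar>det B\<bar>"
  have pos: "0 < a" "0 < b" using A B by (auto simp: a_def b_def invertible_det_nz)
  have "det A * det B * det W = 1"
    using arg_cong[OF CW, of det] by (simp add: det_mul)
  then have detW: "\<bar>det W\<bar> = 1 / (a * b)"
    using pos unfolding a_def b_def by (metis abs_mult abs_one mult.commute nonzero_eq_divide_eq mult_eq_0_iff zero_neq_one)
  define F where "F w = ennreal ((cmod (ft (indicator P) w))\<^sup>2)" for w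
  have [measurable]: "F \<in> borel_measurable borel" unfolding F_def by measurable
  have FA: "ennreal ((cmod (ft (indicator ((*v) A ` P)) w))\<^sup>2) = ennreal (a\<^sup>2) * F (transpose A *v w)" for w
    unfolding ft_matrix_image[OF A P] F_def
    by (simp add: norm_mult power_mult_distrib a_def ennreal_mult')
  have CWw: "(transpose A ** B) *v (W *v w) = w" for w
    unfolding matrix_vector_mul_assoc CW by simp
  \<comment> \<open>The factor b comes from v = B v', a^2 from the transform of the image of P, and
    1/(a b) from z = W w. The outer substitution adds another b, so a b remains.\<close>
  have inner: "(\<integral>\<^sup>+ v. indicator ((*v) B ` Q) v * ennreal ((cmod (ft (indicator ((*v) A ` P)) (v - B *v u)))\<^sup>2) \<partial>lborel) =
      ennreal (b * a\<^sup>2 * (1 / (a * b))) * (\<integral>\<^sup>+ w. indicator Q (u + W *v w) * F w \<partial>lborel)" for u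
  proof -
    have "(\<integral>\<^sup>+ v. indicator ((*v) B ` Q) v * ennreal ((cmod (ft (indicator ((*v) A ` P)) (v - B *v u)))\<^sup>2) \<partial>lborel) =
      ennreal b * (\<integral>\<^sup>+ v. indicator ((*v) B ` Q) (B *v v) * ennreal ((cmod (ft (indicator ((*v) A ` P)) (B *v v - B *v u)))\<^sup>2) \<partial>lborel)"
      unfolding b_def by (rule nn_integral_matrix[OF B]) measurable
    also have "\<dots> = ennreal b * (\<integral>\<^sup>+ v. ennreal (a\<^sup>2) * (indicator Q v * F ((transpose A ** B) *v (v - u))) \<partial>lborel)"
      unfolding FA matrix_image_indicator[OF B] matrix_vector_mult_diff_distrib[symmetric] matrix_vector_mul_assoc
      by (simp add: mult_ac)
    also have "\<dots> = ennreal b * (ennreal (a\<^sup>2) * (\<integral>\<^sup>+ v. indicator Q v * F ((transpose A ** B) *v (v - u)) \<partial>lborel))"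
      by (subst nn_integral_cmult) auto
    also have "(\<integral>\<^sup>+ v. indicator Q v * F ((transpose A ** B) *v (v - u)) \<partial>lborel) =
        (\<integral>\<^sup>+ z. indicator Q (u + z) * F ((transpose A ** B) *v z) \<partial>lborel)"
      using nn_integral_lborel_shift[of "\<lambda>z. indicator Q (u + z) * F ((transpose A ** B) *v z)" u] by simp
    also have "\<dots> = ennreal (1 / (a * b)) * (\<integral>\<^sup>+ w. indicator Q (u + W *v w) * F ((transpose A ** B) *v (W *v w)) \<partial>lborel)"
      unfolding detW[symmetric] by (rule nn_integral_matrix[OF W]) measurable
    finally have "(\<integral>\<^sup>+ v. indicator ((*v) B ` Q) v * ennreal ((cmod (ft (indicator ((*v) A ` P)) (v - B *v u)))\<^sup>2) \<partial>lborel) =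
      ennreal b * (ennreal (a\<^sup>2) * (ennreal (1 / (a * b)) * (\<integral>\<^sup>+ w. indicator Q (u + W *v w) * F ((transpose A ** B) *v (W *v w)) \<partial>lborel)))" .
    moreover have "ennreal (b * a\<^sup>2 * (1 / (a * b))) = ennreal b * ennreal (a\<^sup>2) * ennreal (1 / (a * b))"
      using pos by (simp add: ennreal_mult[symmetric])
    ultimately show ?thesis by (simp only: CWw mult.assoc)
  qed
  have "(\<integral>\<^sup>+ u. indicator ((*v) B ` Q) u * (\<integral>\<^sup>+ v. indicator ((*v) B ` Q) v *
      ennreal ((cmod (ft (indicator ((*v) A ` P)) (v - u)))\<^sup>2) \<partial>lborel) \<partial>lborel) =
     ennreal b * (\<integral>\<^sup>+ u. indicator ((*v) B ` Q) (B *v u) * (\<integral>\<^sup>+ v. indicator ((*v) B ` Q) v *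
      ennreal ((cmod (ft (indicator ((*v) A ` P)) (v - B *v u)))\<^sup>2) \<partial>lborel) \<partial>lborel)"
    unfolding b_def by (rule nn_integral_matrix[OF B]) measurable
  also have "\<dots> = ennreal b * (\<integral>\<^sup>+ u. ennreal (b * a\<^sup>2 * (1 / (a * b))) * (\<integral>\<^sup>+ w. indicator Q u * indicator Q (u + W *v w) * F w \<partial>lborel) \<partial>lborel)"
    unfolding inner matrix_image_indicator[OF B] mult.assoc[of "indicator Q _"]
    by (simp add: nn_integral_cmult mult.left_commute)
  also have "\<dots> = ennreal b * (ennreal (b * a\<^sup>2 * (1 / (a * b))) * overlap P Q W)"
    unfolding overlap_def F_def[symmetric] by (subst nn_integral_cmult) auto
  also have "\<dots> = ennreal (b * (b * a\<^sup>2 * (1 / (a * b)))) * overlap P Q W"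
    by (subst ennreal_mult[of b]) (use pos in \<open>simp_all add: mult.assoc\<close>)
  also have "b * (b * a\<^sup>2 * (1 / (a * b))) = a * b"
    using pos by (simp add: power2_eq_square)
  finally show ?thesis by (simp add: a_def b_def)
qed

text \<open>A failure for every R = n + 1 would give maps \<open>W n\<close> tending to 0 pointwise
  with overlaps below the bound, contradicting Fatou's lemma together with Plancherel's lower bound
  for P.\<close>

lemma overlap_lower_bound:
  fixes P Q :: "(real^'n) set"
  assumes P: "open P" "emeasure lborel P < \<infinity>" and Q: "open Q" "emeasure lborel Q < \<infinity>" and e: "0 < e"
  shows "\<exists>R>0. \<forall>W. (\<forall>w. norm (W *v w) \<le> norm w / R) \<longrightarrow>
    ennreal ((2 * pi) ^ CARD('n) * measure lborel P * measure lborel Q - e) \<le> overlap P Q W"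
proof (rule ccontr)
  define c where "c = (2 * pi) ^ CARD('n) * measure lborel P * measure lborel Q"
  assume "\<not> ?thesis"
  then have "\<exists>W. (\<forall>w. norm (W *v w) \<le> norm w / real (Suc n)) \<and> overlap P Q W < ennreal (c - e)" for n
    unfolding c_def by (metis not_less of_nat_0_less_iff zero_less_Suc)
  then obtain W where W: "\<And>n w. norm (W n *v w) \<le> norm w / real (Suc n)"
    and small: "\<And>n. overlap P Q (W n) < ennreal (c - e)"
    by metis
  have [measurable]: "P \<in> sets borel" using P by simp
  have Wlim: "(\<lambda>n. W n *v w) \<longlonglongrightarrow> 0" for w
  proof (rule Lim_null_comparison)
    show "\<forall>\<^sub>F n in sequentially. norm (W n *v w) \<le> norm w * (1 / real (Suc n))" using W by simp
    show "(\<lambda>n. norm w * (1 / real (Suc n))) \<longlonglongrightarrow> 0"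
      using tendsto_mult_left[OF LIMSEQ_Suc[OF lim_1_over_n], of "norm w"] by simp
  qed
  have "ennreal c = emeasure lborel Q * (emeasure lborel P * ennreal ((2 * pi) ^ CARD('n)))"
    using P Q by (simp add: c_def emeasure_eq_ennreal_measure ennreal_mult' mult_ac flip: top.not_eq_extremum)
  also have "\<dots> \<le> emeasure lborel Q * (\<integral>\<^sup>+ u. ennreal ((cmod (ft (indicator P) u))\<^sup>2) \<partial>lborel)"
    using plancherel_indicator_ge[OF P] by (intro mult_left_mono) auto
  also have "\<dots> \<le> liminf (\<lambda>n. overlap P Q (W n))"
    unfolding overlap_def by (rule nn_integral_translates_liminf[OF Q(1) _ _ Wlim]) measurable
  also have "\<dots> \<le> liminf (\<lambda>n. ennreal (c - e))"
    by (intro Liminf_mono always_eventually allI less_imp_le small)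
  finally have "ennreal c \<le> ennreal (c - e)" by (simp add: Liminf_const)
  \<comment> \<open>Negative reals are sent to 0 by \<open>ennreal\<close>, so positivity is needed
    to read the inequality as one between reals.\<close>
  moreover have "0 < ennreal (c - e)" using small[of 0] by (rule le_less_trans[OF zero_le])
  ultimately show False using e by (simp add: ennreal_le_iff2)
qed

text \<open>Duality: the point of norm R in direction z is M x with x in the unit ball, so R times
  the norm of z is the inner product of \<open>transpose M *v z\<close> and x. It converts the
  hypothesis on images of the unit ball into a bound for the inverse of the transpose.\<close>

lemma expanding_transpose:
  fixes M :: "real^'n^'n"
  assumes R: "0 < R" and sub: "cball 0 R \<subseteq> (*v) M ` cball 0 1"
  shows "R * norm z \<le> norm (transpose M *v z)"
proof (cases "z = 0")
  case False
  define y where "y = (R / norm z) *\<^sub>R z"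
  have "y \<in> cball 0 R" using R False by (simp add: y_def)
  then obtain x where x: "y = M *v x" "norm x \<le> 1" using sub by auto
  have "R * norm z = z \<bullet> y"
    using False by (simp add: y_def power2_norm_eq_inner[symmetric] power2_eq_square)
  also have "\<dots> = (transpose M *v z) \<bullet> x"
    unfolding x(1) by (simp add: dot_lmul_matrix[symmetric])
  also have "\<dots> \<le> norm (transpose M *v z) * norm x" by (rule norm_cauchy_schwarz)
  also have "\<dots> \<le> norm (transpose M *v z) * 1" by (intro mult_left_mono x) simp
  finally show ?thesis by simp
qed simp

text \<open>A set differs from its interior only inside its frontier, and linear maps of the space
  into itself preserve null sets.\<close>

lemma frontier_null_AE_interior:
  fixes P :: "'a::euclidean_space set" and f :: "'a \<Rightarrow> 'a"
  assumes "frontier P \<in> null_sets lebesgue" "linear f"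
  shows "AE x in lebesgue. x \<in> f ` P \<longleftrightarrow> x \<in> f ` interior P"
proof (rule AE_I')
  show "f ` frontier P \<in> null_sets lebesgue"
    using negligible_differentiable_image_negligible[OF order_refl, of "frontier P" f] assms(1,2)
    by (simp add: negligible_iff_null_sets linear_imp_differentiable_on)
  have "P \<subseteq> interior P \<union> frontier P" using closure_subset by (auto simp: frontier_def)
  then show "{x \<in> space lebesgue. \<not> (x \<in> f ` P \<longleftrightarrow> x \<in> f ` interior P)} \<subseteq> f ` frontier P"
    using interior_subset[of P] by auto
qed

lemma measure_interior_of_null_frontier:
  fixes P :: "'a::euclidean_space set"
  assumes "frontier P \<in> null_sets lebesgue" "P \<in> sets lebesgue"
  shows "emeasure lborel (interior P) = emeasure lebesgue P" "measure lborel (interior P) = measure lebesgue P"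
proof -
  have "AE x in lebesgue. x \<in> P \<longleftrightarrow> x \<in> interior P"
    using frontier_null_AE_interior[OF assms(1) linear_id] by simp
  then have "emeasure lebesgue P = emeasure lebesgue (interior P)"
    using assms(2) by (intro emeasure_eq_AE) auto
  then show "emeasure lborel (interior P) = emeasure lebesgue P" by simp
  then show "measure lborel (interior P) = measure lebesgue P" by (simp add: measure_def)
qed

lemma lebesgue_sets_AE_eq:
  fixes S S' :: "'a::euclidean_space set"
  assumes "AE x in lebesgue. x \<in> S \<longleftrightarrow> x \<in> S'" "S' \<in> sets lebesgue"
  shows "S \<in> sets lebesgue"
proof -
  obtain Z where "Z \<in> null_sets lebesgue" "{x \<in> space lebesgue. \<not> (x \<in> S \<longleftrightarrow> x \<in> S')} \<subseteq> Z"
    using assms(1) unfolding eventually_ae_filter by blast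
  then have "S - S' \<in> null_sets lebesgue" "S' - S \<in> null_sets lebesgue"
    by (auto intro!: completion.complete2[of _ Z])
  moreover have "S = (S' \<union> (S - S')) - (S' - S)" by auto
  ultimately show ?thesis using assms(2) by (metis null_setsD2 sets.Diff sets.Un)
qed

text \<open>Null changes of S and T do not affect the two integrals at any point; they show only
  through the outermost indicator. This justifies working with images of interiors.\<close>

lemma TBT_cong_AE:
  fixes S T S' T' :: "(real^'n) set"
  assumes ker: "bessel_kernel lebesgue (spec_measure T') S' (wave S')"
    and S: "AE x in lebesgue. x \<in> S \<longleftrightarrow> x \<in> S'" and T: "AE x in lebesgue. x \<in> T \<longleftrightarrow> x \<in> T'"
    and [measurable]: "S' \<in> sets borel" "T' \<in> sets borel" and f: "L2 lebesgue f"
  shows "AE x in lebesgue. TBT S T f x = TBT S' T' f x"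
proof -
  interpret bessel_kernel lebesgue "spec_measure T'" S' "wave S'" by fact
  have [measurable]: "f \<in> borel_measurable lebesgue" by (rule L2_measurable[OF f])
  have [measurable]: "S' \<in> sets lebesgue" "T' \<in> sets lebesgue" by auto
  have [measurable]: "S \<in> sets lebesgue" "T \<in> sets lebesgue"
    using lebesgue_sets_AE_eq[OF S] lebesgue_sets_AE_eq[OF T] by auto
  have [measurable]: "(\<lambda>x. exp (c * complex_of_real (x \<bullet> u))) \<in> borel_measurable lebesgue"
    "(\<lambda>x. exp (c * complex_of_real (u \<bullet> x))) \<in> borel_measurable lebesgue"
    "(\<lambda>x. exp (- (c * complex_of_real (x \<bullet> u)))) \<in> borel_measurable lebesgue" for u :: "real^'n" and c
    by (intro measurable_completion; measurable)+
  have four: "fourier (\<lambda>y. indicator S y * f y) u = fourier (\<lambda>y. indicator S' y * f y) u" for u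
    unfolding fourier_def
    by (intro integral_cong_AE) (measurable, use S in \<open>auto elim!: AE_mp split: split_indicator\<close>)
  have "fourier (\<lambda>y. indicator S' y * f y) = coef f"
    using coef_wave[OF ker] by (simp add: fun_eq_iff)
  moreover have "coef f \<in> borel_measurable lborel"
    using coef_meas[OF L2_measurable[OF f]] by (simp cong: measurable_cong_sets)
  ultimately have [measurable]: "fourier (\<lambda>y. indicator S' y * f y) \<in> borel_measurable lebesgue"
    by (simp add: measurable_completion)
  have "inv_fourier (\<lambda>u. indicator T u * fourier (\<lambda>y. indicator S' y * f y) u) x =
      inv_fourier (\<lambda>u. indicator T' u * fourier (\<lambda>y. indicator S' y * f y) u) x" for x
    unfolding inv_fourier_def
    by (intro arg_cong2[where f = "(*)"] refl integral_cong_AE)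
       (measurable, use T in \<open>auto elim!: AE_mp split: split_indicator\<close>)
  then show ?thesis
    unfolding TBT_def four using S by (auto elim!: AE_mp split: split_indicator)
qed

text \<open>R depends on P, Q, \<epsilon> and the tolerance, but not on the matrices, so the limit
  along any parameter filter follows at once.\<close>

lemma eig_count_asymptotics:
  fixes P Q :: "(real^'n) set"
  assumes P: "P \<in> sets lebesgue" "emeasure lebesgue P < \<infinity>" "frontier P \<in> null_sets lebesgue"
    and Q: "Q \<in> sets lebesgue" "emeasure lebesgue Q < \<infinity>" "frontier Q \<in> null_sets lebesgue"
    and \<epsilon>: "0 < \<epsilon>" "\<epsilon> < 1" and e: "0 < e"
  shows "\<exists>R>0. \<forall>A B. invertible A \<longrightarrow> invertible B \<longrightarrow>
    cball 0 R \<subseteq> mat_image (transpose B ** A) (cball 0 1) \<longrightarrow>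
    \<bar>real (eig_count (TBT (mat_image A P) (mat_image B Q)) \<epsilon>) / (\<bar>det A\<bar> * \<bar>det B\<bar>)
      - 1 / (2 * pi) ^ CARD('n) * measure lebesgue P * measure lebesgue Q\<bar> < e"
proof -
  define P' Q' where "P' = interior P" and "Q' = interior Q"
  have P': "open P'" "emeasure lborel P' < \<infinity>" "measure lborel P' = measure lebesgue P"
    and Q': "open Q'" "emeasure lborel Q' < \<infinity>" "measure lborel Q' = measure lebesgue Q"
    using measure_interior_of_null_frontier[OF P(3,1)] measure_interior_of_null_frontier[OF Q(3,1)] P(2) Q(2)
    by (auto simp: P'_def Q'_def)
  define k where "k = 1 / (2 * pi) ^ CARD('n)"
  have k: "0 < k" by (simp add: k_def)
  define C where "C = 1 / \<epsilon> + 1 / (1 - \<epsilon>)"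
  have C: "0 < C" using \<epsilon> by (simp add: C_def add_pos_pos)
  \<comment> \<open>Chosen so that the final error C k^2 e' equals e / 2.\<close>
  define e' where "e' = e / (2 * C * k\<^sup>2)"
  have e': "0 < e'" using e C k by (simp add: e'_def)
  obtain R where R: "0 < R" and low: "\<And>W. (\<And>w. norm (W *v w) \<le> norm w / R) \<Longrightarrow>
      ennreal ((2 * pi) ^ CARD('n) * measure lborel P' * measure lborel Q' - e') \<le> overlap P' Q' W"
    using overlap_lower_bound[OF P'(1,2) Q'(1,2) e'] by metis
  have "\<bar>real (eig_count (TBT (mat_image A P) (mat_image B Q)) \<epsilon>) / (\<bar>det A\<bar> * \<bar>det B\<bar>)
      - k * measure lebesgue P * measure lebesgue Q\<bar> < e"
    if A: "invertible A" and B: "invertible B"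
      and sub: "cball 0 R \<subseteq> mat_image (transpose B ** A) (cball 0 1)" for A B
  proof -
    define S T where "S = (*v) A ` P'" and "T = (*v) B ` Q'"
    define d where "d = \<bar>det A\<bar> * \<bar>det B\<bar>"
    have d: "0 < d" using A B by (simp add: d_def invertible_det_nz)
    have S: "open S" "emeasure lborel S = ennreal \<bar>det A\<bar> * emeasure lborel P'"
      and T: "open T" "emeasure lborel T = ennreal \<bar>det B\<bar> * emeasure lborel Q'"
      unfolding S_def T_def using open_matrix_image emeasure_matrix_image A B P'(1) Q'(1) by auto
    have fin: "emeasure lborel S < \<infinity>" "emeasure lborel T < \<infinity>"
      using P'(2) Q'(2) by (auto simp: S T ennreal_mult_less_top)
    have "measure lborel S = \<bar>det A\<bar> * measure lborel P'" "measure lborel T = \<bar>det B\<bar> * measure lborel Q'"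
      unfolding measure_def S(2) T(2) by (simp_all add: enn2real_mult)
    note meas = this[unfolded P'(3) Q'(3)]
    have ST: "S \<in> sets borel" "T \<in> sets borel" using S T by auto
    have ker: "bessel_kernel lebesgue (spec_measure T) S (wave S)"
      by (rule bessel_kernel_wave[OF S(1) fin(1) T(1) fin(2)])
    interpret bessel_kernel lebesgue "spec_measure T" S "wave S" by (rule ker)
    have "AE x in lebesgue. TBT (mat_image A P) (mat_image B Q) f x = op f x" if f: "L2 lebesgue f" for f
    proof -
      have "AE x in lebesgue. TBT (mat_image A P) (mat_image B Q) f x = TBT S T f x"
      proof (rule TBT_cong_AE[OF ker _ _ ST f])
        show "AE x in lebesgue. x \<in> mat_image A P \<longleftrightarrow> x \<in> S"
          unfolding mat_image_def S_def P'_def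
          by (rule frontier_null_AE_interior[OF P(3) matrix_vector_mul_linear])
        show "AE x in lebesgue. x \<in> mat_image B Q \<longleftrightarrow> x \<in> T"
          unfolding mat_image_def T_def Q'_def
          by (rule frontier_null_AE_interior[OF Q(3) matrix_vector_mul_linear])
      qed
      then show ?thesis by (simp add: op_wave[OF ker ST f])
    qed
    from eig_count_near_trace[OF ker this \<epsilon>]
    have near: "\<bar>real (eig_count (TBT (mat_image A P) (mat_image B Q)) \<epsilon>) - trace\<bar> \<le> C * (trace - trace_sq)"
      unfolding C_def .
    \<comment> \<open>Divided by d, the trace is exactly the claimed limit; the whole error lies in
      \<open>trace - trace_sq\<close>.\<close>
    have trace: "trace = d * (k * measure lebesgue P * measure lebesgue Q)"
      using trace_wave[OF ker ST] by (simp add: meas d_def k_def)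
    have "invertible (transpose A ** B)"
      using A B by (simp add: invertible_det_nz det_mul)
    then obtain W where W: "transpose A ** B ** W = mat 1" "W ** (transpose A ** B) = mat 1"
      by (auto simp: invertible_def)
    have Winv: "invertible W" using W by (auto simp: invertible_def)
    have "norm (W *v w) \<le> norm w / R" for w
    proof -
      have "R * norm (W *v w) \<le> norm (transpose (transpose B ** A) *v (W *v w))"
        using expanding_transpose[OF R] sub by (simp add: mat_image_def)
      also have "transpose (transpose B ** A) *v (W *v w) = w"
        using W(1) by (simp add: matrix_transpose_mul matrix_vector_mul_assoc)
      finally show ?thesis using R by (simp add: field_simps)
    qed
    from low[OF this] have lowW: "ennreal (measure lebesgue P * measure lebesgue Q / k - e') \<le> overlap P' Q' W"
      by (simp add: k_def P' Q' mult_ac)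
    have "ennreal trace_sq = ennreal (k\<^sup>2) * (ennreal d * overlap P' Q' W)"
      using trace_sq_wave[OF ker ST] trace_sq_integral_eq_overlap[OF A B P'(1) Q'(1) Winv W(1)]
      unfolding S_def T_def d_def k_def by simp
    also have "\<dots> \<ge> ennreal (k\<^sup>2) * (ennreal d * ennreal (measure lebesgue P * measure lebesgue Q / k - e'))"
      by (intro mult_left_mono lowW) auto
    finally have "ennreal (k\<^sup>2 * (d * (measure lebesgue P * measure lebesgue Q / k - e'))) \<le> ennreal trace_sq"
      using d by (simp add: ennreal_mult')
    moreover have "0 \<le> trace_sq" unfolding trace_sq_def by (intro Bochner_Integration.integral_nonneg) simp
    ultimately have "k\<^sup>2 * (d * (measure lebesgue P * measure lebesgue Q / k - e')) \<le> trace_sq"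
      by (simp add: ennreal_le_iff)
    \<comment> \<open>The main term k^2 d (m(P) m(Q) / k) of the lower bound is the trace itself, so
      only the part with e' survives.\<close>
    then have "trace - trace_sq \<le> d * (k\<^sup>2 * e')"
      using k unfolding trace by (simp add: power2_eq_square algebra_simps)
    then have "C * (trace - trace_sq) \<le> C * (d * (k\<^sup>2 * e'))" using C by simp
    also have "\<dots> = d * (e / 2)" using C k by (simp add: e'_def)
    finally have "\<bar>real (eig_count (TBT (mat_image A P) (mat_image B Q)) \<epsilon>) - trace\<bar> \<le> d * (e / 2)"
      using near by simp
    then have "\<bar>real (eig_count (TBT (mat_image A P) (mat_image B Q)) \<epsilon>) - trace\<bar> / d \<le> e / 2"
      using d by (simp add: field_simps)
    also have "\<bar>real (eig_count (TBT (mat_image A P) (mat_image B Q)) \<epsilon>) - trace\<bar> / d =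
        \<bar>real (eig_count (TBT (mat_image A P) (mat_image B Q)) \<epsilon>) / d - k * measure lebesgue P * measure lebesgue Q\<bar>"
    proof -
      have "\<bar>real (eig_count (TBT (mat_image A P) (mat_image B Q)) \<epsilon>) - trace\<bar> / d =
          \<bar>(real (eig_count (TBT (mat_image A P) (mat_image B Q)) \<epsilon>) - trace) / d\<bar>"
        using d by simp
      also have "(real (eig_count (TBT (mat_image A P) (mat_image B Q)) \<epsilon>) - trace) / d =
          real (eig_count (TBT (mat_image A P) (mat_image B Q)) \<epsilon>) / d - k * measure lebesgue P * measure lebesgue Q"
        using d unfolding trace by (simp add: diff_divide_distrib)
      finally show ?thesis .
    qed
    finally show ?thesis using e unfolding d_def by linarith
  qed
  then show ?thesis using R unfolding k_def by blast
qed

text \<open>Restricting the neighbourhoods to the image of D, together with injectivity of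
  \<open>ereal\<close>, keeps the parameters in D, where the matrices are invertible.\<close>

lemma eventually_param_filter_mem: "eventually (\<lambda>p. p \<in> D) (param_filter D p0)"
  unfolding param_filter_def eventually_filtercomap
proof (intro exI conjI allI impI)
  show "eventually (\<lambda>q. q \<in> (\<lambda>(t, r). (ereal t, ereal r)) ` D) (at p0 within ((\<lambda>(t, r). (ereal t, ereal r)) ` D))"
    by (simp add: eventually_at_filter)
  fix p :: "real \<times> real" assume "(case p of (t, r) \<Rightarrow> (ereal t, ereal r)) \<in> (\<lambda>(t, r). (ereal t, ereal r)) ` D"
  then show "p \<in> D" by (auto split: prod.splits)
qed

theorem theorem3:
  fixes P Q :: "(real^'n) set"
    and A B :: "real \<Rightarrow> real^'n^'n"
    and D :: "(real \<times> real) set"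
    and tau0 rho0 :: ereal
    and eps :: real
  assumes P_meas: "P \<in> sets lebesgue" and P_fin: "emeasure lebesgue P < \<infinity>"
    and P_bd: "frontier P \<in> null_sets lebesgue"
    and Q_meas: "Q \<in> sets lebesgue" and Q_fin: "emeasure lebesgue Q < \<infinity>"
    and Q_bd: "frontier Q \<in> null_sets lebesgue"
    and A_inv: "\<And>t r. (t, r) \<in> D \<Longrightarrow> invertible (A t)"
    and B_inv: "\<And>t r. (t, r) \<in> D \<Longrightarrow> invertible (B r)"
    and limpt: "(tau0, rho0) islimpt ((\<lambda>(t, r). (ereal t, ereal r)) ` D)"
    and eps: "0 < eps" "eps < 1"
    and conv: "\<And>R. R > 0 \<Longrightarrow> eventually (\<lambda>(t, r).
        cball 0 R \<subseteq> mat_image (transpose (B r) ** A t) (cball 0 1))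
        (param_filter D (tau0, rho0))"
  shows "((\<lambda>(t, r). real (eig_count (TBT (mat_image (A t) P) (mat_image (B r) Q)) eps)
            / (\<bar>det (A t)\<bar> * \<bar>det (B r)\<bar>))
          \<longlongrightarrow> (2 * pi) powr (- real CARD('n)) * measure lebesgue P * measure lebesgue Q)
         (param_filter D (tau0, rho0))"
proof (rule tendstoI)
  fix e :: real assume e: "0 < e"
  obtain R where "0 < R" and R: "\<And>A B :: real^'n^'n. invertible A \<Longrightarrow> invertible B \<Longrightarrow>
    cball 0 R \<subseteq> mat_image (transpose B ** A) (cball 0 1) \<Longrightarrow>
    \<bar>real (eig_count (TBT (mat_image A P) (mat_image B Q)) eps) / (\<bar>det A\<bar> * \<bar>det B\<bar>)
      - 1 / (2 * pi) ^ CARD('n) * measure lebesgue P * measure lebesgue Q\<bar> < e"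
    using eig_count_asymptotics[OF P_meas P_fin P_bd Q_meas Q_fin Q_bd eps e] by metis
  have powr: "(2 * pi) powr (- real CARD('n)) = 1 / (2 * pi) ^ CARD('n)"
    by (simp add: powr_minus powr_realpow inverse_eq_divide)
  from conv[OF \<open>0 < R\<close>] eventually_param_filter_mem
  show "\<forall>\<^sub>F p in param_filter D (tau0, rho0).
      dist (case p of (t, r) \<Rightarrow> real (eig_count (TBT (mat_image (A t) P) (mat_image (B r) Q)) eps)
        / (\<bar>det (A t)\<bar> * \<bar>det (B r)\<bar>))
      ((2 * pi) powr (- real CARD('n)) * measure lebesgue P * measure lebesgue Q) < e"
  proof eventually_elim
    case (elim p)
    obtain t r where p: "p = (t, r)" by (cases p)
    show ?case
      using R[of "A t" "B r"] A_inv[of t r] B_inv[of t r] elim unfolding p dist_real_def powr by simp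
  qed
qed

end
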